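(* Fix an integer $e\ge 2$. Let $G^r(e)$ be the number of Gorenstein Hilbert functions of codimension $r$ and socle degree $e$, and let $SI^r(e)$ be the number of SI-sequences of codimension $r$ and socle degree $e$. Then, as $r\to\infty$, $$G^r(e)\sim SI^r(e)\sim c_{\lfloor e/2\rfloor}\,r^{\binom{\lfloor e/2\rfloor+1}{2}-1},$$ where for a positive integer $m$, $c_m=\dfrac{\prod_{i=0}^{m-2}\binom{\binom{m+1}{2}-\binom{i+1}{2}-1}{i}}{\left(\binom{m+1}{2}-1\right)!}$. In particular almost all Gorenstein Hilbert functions of given socle degree are SI-sequences for large codimension.
   Context: $f(r)\sim g(r)$ means $\lim_{r\to\infty}f(r)/g(r)=1$. A Gorenstein Hilbert function of codimension $r$ and socle degree $e$ is the $h$-vector $(h_0,\dots,h_e)$, $h_i=\dim_kA_i$, $h_1=r$, $h_e\ne0$, of a standard graded Artinian Gorenstein $k$-algebra $A$ (i.e. level of type $1$: one-dimensional socle). For positive integers $n,d$, with $d$-binomial expansion $n=\binom{k_d}{d}+\cdots+\binom{k_\delta}{\delta}$, $k_d>\dots>k_\delta\ge\delta\ge1$, set $(n_{(d)})^1_1=\binom{k_d+1}{d+1}+\cdots+\binom{k_\delta+1}{\delta+1}$ and $(0_{(d)})^1_1=0$; an $O$-sequence is a sequence $(h_0,\dots,h_e)$ of non-negative integers, $h_0=1$, with $h_{d+1}\le((h_d)_{(d)})^1_1$ for $1\le d<e$. An SI-sequence is a sequence $(h_0,\dots,h_e)$ of positive integers that is symmetric ($h_{e-i}=h_i$) and whose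 first half is differentiable, i.e. $(h_0,h_1-h_0,\dots,h_j-h_{j-1})$ is an $O$-sequence for $j=\lfloor e/2\rfloor$. *)

theory Defs
  imports Complex_Main "HOL-Library.Poly_Mapping" "HOL-Algebra.QuotRing"
    "HOL-Algebra.Embedded_Algebras"
begin

section \<open>Standard graded algebras\<close>

text \<open>Monomials are exponent vectors and polynomials are finitely supported coefficient functions;
  multiplication is the convolution product of the library. The polynomial ring
  $k[x_0,\dots,x_{r-1}]$ is the subring of polynomials in the variables with index below $r$.\<close>

type_synonym mono = "nat \<Rightarrow>\<^sub>0 nat"
type_synonym 'k mpol = "mono \<Rightarrow>\<^sub>0 'k"

definition mono_degree :: "mono \<Rightarrow> nat" where
  "mono_degree m = (\<Sum>v\<in>Poly_Mapping.keys m. Poly_Mapping.lookup m v)"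

definition poly_carrier :: "nat \<Rightarrow> 'k::field mpol set" where
  "poly_carrier r = {p. \<forall>m\<in>Poly_Mapping.keys p. Poly_Mapping.keys m \<subseteq> {..<r}}"

definition poly_ring :: "nat \<Rightarrow> 'k::field mpol ring" where
  "poly_ring r = \<lparr>carrier = poly_carrier r, mult = (*), one = 1, zero = 0, add = (+)\<rparr>"

definition forms :: "nat \<Rightarrow> nat \<Rightarrow> 'k::field mpol set" where
  "forms r d = {p \<in> poly_carrier r. \<forall>m\<in>Poly_Mapping.keys p. mono_degree m = d}"

definition hom_part :: "nat \<Rightarrow> 'k::field mpol \<Rightarrow> 'k mpol" where
  "hom_part d p =
     (\<Sum>m\<in>{m \<in> Poly_Mapping.keys p. mono_degree m = d}. Poly_Mapping.single m (Poly_Mapping.lookup p m))"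

definition homogeneous_ideal :: "nat \<Rightarrow> 'k::field mpol set \<Rightarrow> bool" where
  "homogeneous_ideal r I \<longleftrightarrow> ideal I (poly_ring r) \<and> (\<forall>p\<in>I. \<forall>d. hom_part d p \<in> I)"

text \<open>A standard graded algebra is $A = k[x_0,\dots,x_{r-1}]/I$ with $I$ homogeneous. In it, the base
  field, the graded piece $A_d$ and the maximal homogeneous ideal are the images of the constants,
  of the forms of degree $d$, and of the polynomials without constant term.\<close>

definition quot_alg :: "nat \<Rightarrow> 'k::field mpol set \<Rightarrow> 'k mpol set ring" where
  "quot_alg r I = poly_ring r Quot I"

definition residue_class :: "nat \<Rightarrow> 'k::field mpol set \<Rightarrow> 'k mpol \<Rightarrow> 'k mpol set" where
  "residue_class r I p = I +>\<^bsub>poly_ring r\<^esub> p"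

definition base_field :: "nat \<Rightarrow> 'k::field mpol set \<Rightarrow> 'k mpol set set" where
  "base_field r I = range (\<lambda>c. residue_class r I (Poly_Mapping.single 0 c))"

definition graded_piece :: "nat \<Rightarrow> 'k::field mpol set \<Rightarrow> nat \<Rightarrow> 'k mpol set set" where
  "graded_piece r I d = residue_class r I ` forms r d"

definition irrelevant_ideal :: "nat \<Rightarrow> 'k::field mpol set \<Rightarrow> 'k mpol set set" where
  "irrelevant_ideal r I = residue_class r I ` {p \<in> poly_carrier r. Poly_Mapping.lookup p 0 = 0}"

definition hilbert_function :: "nat \<Rightarrow> 'k::field mpol set \<Rightarrow> nat \<Rightarrow> nat" where
  "hilbert_function r I d = ring.dim (quot_alg r I) (base_field r I) (graded_piece r I d)"

definition socle :: "nat \<Rightarrow> 'k::field mpol set \<Rightarrow> 'k mpol set set" where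
  "socle r I = {a \<in> carrier (quot_alg r I).
     \<forall>b\<in>irrelevant_ideal r I. a \<otimes>\<^bsub>quot_alg r I\<^esub> b = \<zero>\<^bsub>quot_alg r I\<^esub>}"

definition artinian :: "('a, 'b) ring_scheme \<Rightarrow> bool" where
  "artinian A \<longleftrightarrow> (\<forall>J :: nat \<Rightarrow> 'a set. (\<forall>n. ideal (J n) A \<and> J (Suc n) \<subseteq> J n) \<longrightarrow>
     (\<exists>N. \<forall>n\<ge>N. J n = J N))"

definition artinian_gorenstein :: "nat \<Rightarrow> 'k::field mpol set \<Rightarrow> bool" where
  "artinian_gorenstein r I \<longleftrightarrow> homogeneous_ideal r I \<and> artinian (quot_alg r I) \<and>
     ring.dimension (quot_alg r I) 1 (base_field r I) (socle r I)"

text \<open>A sequence $(h_0,\dots,h_e)$ is a list of length $e+1$. A standard graded algebra with $h_1 = r$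
  is, up to isomorphism, a quotient of the polynomial ring in exactly $r$ variables.\<close>

definition gorenstein_hilbert_functions :: "'k::field itself \<Rightarrow> nat \<Rightarrow> nat \<Rightarrow> nat list set" where
  "gorenstein_hilbert_functions _ r e = {h. length h = e + 1 \<and> h ! 1 = r \<and> h ! e \<noteq> 0 \<and>
     (\<exists>I :: 'k mpol set. artinian_gorenstein r I \<and>
        (\<forall>i\<le>e. hilbert_function r I i = h ! i) \<and> (\<forall>i>e. hilbert_function r I i = 0))}"

section \<open>SI-sequences\<close>

definition binomial_expansion :: "nat \<Rightarrow> nat \<Rightarrow> nat \<Rightarrow> (nat \<Rightarrow> nat) \<Rightarrow> bool" where
  "binomial_expansion n d \<delta> k \<longleftrightarrow> 1 \<le> \<delta> \<and> \<delta> \<le> d \<and> \<delta> \<le> k \<delta> \<and> strict_mono_on {\<delta>..d} k \<and>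
     n = (\<Sum>i=\<delta>..d. k i choose i)"

text \<open>The number $(n_{(d)})^1_1$; for $n, d \ge 1$ the expansion exists and is unique.\<close>

definition macaulay_bound :: "nat \<Rightarrow> nat \<Rightarrow> nat" where
  "macaulay_bound n d = (if n = 0 then 0 else
     (THE s. \<exists>\<delta> k. binomial_expansion n d \<delta> k \<and> s = (\<Sum>i=\<delta>..d. (k i + 1) choose (i + 1))))"

definition O_sequence :: "int list \<Rightarrow> bool" where
  "O_sequence h \<longleftrightarrow> h \<noteq> [] \<and> (\<forall>x\<in>set h. 0 \<le> x) \<and> h ! 0 = 1 \<and>
     (\<forall>d. 1 \<le> d \<and> d + 1 < length h \<longrightarrow> h ! (d + 1) \<le> int (macaulay_bound (nat (h ! d)) d))"

definition first_difference :: "nat list \<Rightarrow> nat \<Rightarrow> int list" where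
  "first_difference h j =
     map (\<lambda>i. if i = 0 then int (h ! 0) else int (h ! i) - int (h ! (i - 1))) [0..<j + 1]"

definition SI_sequences :: "nat \<Rightarrow> nat \<Rightarrow> nat list set" where
  "SI_sequences r e = {h. length h = e + 1 \<and> h ! 1 = r \<and> (\<forall>i\<le>e. 0 < h ! i) \<and>
     (\<forall>i\<le>e. h ! (e - i) = h ! i) \<and> O_sequence (first_difference h (e div 2))}"

section \<open>Counting\<close>

definition G_count :: "'k::field itself \<Rightarrow> nat \<Rightarrow> nat \<Rightarrow> nat" where
  "G_count K r e = card (gorenstein_hilbert_functions K r e)"

definition SI_count :: "nat \<Rightarrow> nat \<Rightarrow> nat" where
  "SI_count r e = card (SI_sequences r e)"

definition c_const :: "nat \<Rightarrow> real" where
  "c_const m = (\<Prod>i<m - 1. real ((((m + 1) choose 2) - ((i + 1) choose 2) - 1) choose i)) /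
     fact (((m + 1) choose 2) - 1)"

text \<open>$f(r) \sim g(r)$ as $r \to \infty$.\<close>

definition asymptotic :: "(nat \<Rightarrow> real) \<Rightarrow> (nat \<Rightarrow> real) \<Rightarrow> bool" where
  "asymptotic f g \<longleftrightarrow> (\<lambda>r. f r / g r) \<longlonglongrightarrow> 1"

end

theory Submission
  imports Defs "HOL-Combinatorics.Multiset_Permutations"
begin

text \<open>Both counts are squeezed between two counts of chains. Write \<open>m = \<lfloor>e/2\<rfloor>\<close>.

  Upper bound. A Gorenstein sequence is symmetric, hence determined by \<open>h\<^sub>2, \<dots>, h\<^sub>m\<close>. The standard
  monomials of the algebra form an order ideal with \<open>h\<^sub>d\<close> elements of degree \<open>d\<close>, and the words in the
  variables that spell standard monomials are closed under deletion of letters. For such a set of words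
  the \<open>d\<close>-th root \<open>t\<^sub>d\<close> of the number of words of length \<open>d\<close> is nonincreasing in \<open>d\<close>. Only \<open>O(r\<^sup>d\<^sup>-\<^sup>1)\<close>
  monomials of degree \<open>d\<close> are not squarefree, so \<open>d! h\<^sub>d = t\<^sub>d\<^sup>d + O(r\<^sup>d\<^sup>-\<^sup>1)\<close> with
  \<open>r \<ge> t\<^sub>2 \<ge> \<dots> \<ge> t\<^sub>m\<close>. For SI-sequences the Macaulay bound yields numbers \<open>t\<^sub>d\<close> with the same properties.

  Lower bound. If \<open>r - 1 > a\<^sub>2 > \<dots> > a\<^sub>m\<close>, every choice of \<open>f\<^sub>d\<close> with
  \<open>(a\<^sub>d - 1 choose d) < f\<^sub>d \<le> (a\<^sub>d choose d)\<close> is the face vector of a simplicial complex on \<open>r - 1\<close>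
  vertices. The 0/1 points of its faces, which exist over every field, have the Hilbert function
  \<open>1 + f\<^sub>1 + \<dots> + f\<^sub>i\<close>, and the sum of the evaluations of forms of degree \<open>e\<close> at these points is the
  dual socle generator of a Gorenstein algebra with the first half of its Hilbert function equal to that
  of the points.

  Both numbers of chains are asymptotic to \<open>r\<close> to the power \<open>2 + \<dots> + m\<close> times the integral of the
  densities \<open>t\<^sub>d\<^sup>d\<^sup>-\<^sup>1 / (d - 1)!\<close> over \<open>1 \<ge> t\<^sub>2 \<ge> \<dots> \<ge> t\<^sub>m \<ge> 0\<close>, which is \<open>c\<^sub>m\<close>.\<close>

section \<open>Polynomials\<close>

text \<open>The obstacle is that a Gorenstein sequence need not be unimodal, so its first difference
  is in general no O-sequence and the upper bound cannot use growth of differences. Growth of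
  \<open>h\<close> itself suffices: \<open>h_(d-1)\<close> is at most of order
  \<open>r^(d-1)\<close>, so growth conditions on \<open>h_d\<close> and on
  \<open>h_d - h_(d-1)\<close> agree up to an error one power of \<open>r\<close> below the main
  term. Such errors thicken each range of size about \<open>r^d\<close> by \<open>O(r^(d-1))\<close>
  only and disappear in the limit. For the same reason a bound weaker than Macaulay's theorem is
  enough, as long as its leading term is right.

  For the lower bound the field is arbitrary, possibly finite, so general points or general forms
  cannot be chosen. The inclusion matrix of a simplicial complex replaces them: it is unitriangular,
  hence invertible over every field. One explicit family of sequences is Gorenstein and SI at once,
  so the two sets are compared through their intersection and never directly with each
  other.\<close>

abbreviation scal :: "'k::field \<Rightarrow> 'k mpol \<Rightarrow> 'k mpol" where
  "scal c p \<equiv> Poly_Mapping.single 0 c * p"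

lemma lookup_scal [simp]: "Poly_Mapping.lookup (scal c p) m = c * Poly_Mapping.lookup p m"
  by (simp add: mult_map_scale_conv_mult [symmetric] Poly_Mapping.map.rep_eq when_def)

lemma keys_scal: "Poly_Mapping.keys (scal c p) \<subseteq> Poly_Mapping.keys p"
  by (auto simp: in_keys_iff)

lemma keys_minus_subset:
  "Poly_Mapping.keys (p - q) \<subseteq> Poly_Mapping.keys p \<union> Poly_Mapping.keys (q :: 'a \<Rightarrow>\<^sub>0 'b::ab_group_add)"
  by (auto simp: in_keys_iff lookup_minus)

lemma keys_sum_subset:
  "(\<And>i. i \<in> A \<Longrightarrow> Poly_Mapping.keys (f i) \<subseteq> X) \<Longrightarrow> Poly_Mapping.keys (sum f A) \<subseteq> X"
proof (induction A rule: infinite_finite_induct)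
  case (insert x F)
  then show ?case using Poly_Mapping.keys_add[of "f x" "sum f F"] by auto
qed auto

lemma scal_sum_single:
  assumes "Poly_Mapping.keys p \<subseteq> X" "finite X"
  shows "p = (\<Sum>m\<in>X. scal (Poly_Mapping.lookup p m) (Poly_Mapping.single m 1))"
proof (rule poly_mapping_eqI)
  fix k
  have "(\<Sum>m\<in>X. Poly_Mapping.lookup p m * (1 when m = k)) = Poly_Mapping.lookup p k"
  proof (cases "k \<in> X")
    case True
    then show ?thesis
      using assms(2) by (simp add: when_def sum.remove[of X k] if_distrib [of "(*) _"] cong: if_cong)
  next
    case False
    then have "Poly_Mapping.lookup p k = 0" using assms(1) by (auto simp: in_keys_iff)
    then show ?thesis using False by (intro trans [OF sum.neutral]) (auto simp: when_def)
  qed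
  then show "Poly_Mapping.lookup p k = Poly_Mapping.lookup
      (\<Sum>m\<in>X. scal (Poly_Mapping.lookup p m) (Poly_Mapping.single m 1)) k"
    by (simp add: lookup_sum lookup_single)
qed

section \<open>Monomials and their degrees\<close>

lemma keys_add_mono: "Poly_Mapping.keys (a + b :: mono) = Poly_Mapping.keys a \<union> Poly_Mapping.keys b"
  by (auto simp: in_keys_iff lookup_add)

lemma mono_degree_superset:
  assumes "finite A" "Poly_Mapping.keys m \<subseteq> A"
  shows "mono_degree m = (\<Sum>v\<in>A. Poly_Mapping.lookup m v)"
  unfolding mono_degree_def using assms
  by (intro sum.mono_neutral_left) (auto simp: in_keys_iff)

lemma mono_degree_add [simp]: "mono_degree (a + b) = mono_degree a + mono_degree b"
proof -
  let ?A = "Poly_Mapping.keys a \<union> Poly_Mapping.keys b"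
  show ?thesis
    by (subst (1 2 3) mono_degree_superset[of ?A])
      (auto simp: keys_add_mono lookup_add sum.distrib)
qed

lemma mono_degree_zero [simp]: "mono_degree 0 = 0"
  by (simp add: mono_degree_def)

lemma mono_degree_single [simp]: "mono_degree (Poly_Mapping.single v n) = n"
  by (simp add: mono_degree_def)

lemma mono_degree_eq_0_iff [simp]: "mono_degree m = 0 \<longleftrightarrow> m = 0"
proof
  assume "mono_degree m = 0"
  then have "\<forall>v\<in>Poly_Mapping.keys m. Poly_Mapping.lookup m v = 0" by (simp add: mono_degree_def)
  then have "Poly_Mapping.lookup m v = 0" for v by (metis in_keys_iff)
  then show "m = 0" by (intro poly_mapping_eqI) simp
qed simp

definition monomials :: "nat \<Rightarrow> nat \<Rightarrow> mono set" where
  "monomials r d = {m. Poly_Mapping.keys m \<subseteq> {..<r} \<and> mono_degree m = d}"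

lemma monomials_0 [simp]: "monomials r 0 = {0}"
  by (auto simp: monomials_def)

lemma monomials_Suc_split:
  assumes "m \<in> monomials r (Suc d)"
  obtains x m' where "x < r" "m' \<in> monomials r d" "m = m' + Poly_Mapping.single x 1"
proof -
  have "m \<noteq> 0" using assms by (auto simp: monomials_def)
  then obtain x where x: "x \<in> Poly_Mapping.keys m"
    by (metis in_keys_iff lookup_zero poly_mapping_eqI)
  define m' where "m' = m - Poly_Mapping.single x 1"
  have eq: "m = m' + Poly_Mapping.single x 1"
    using x by (intro poly_mapping_eqI)
      (auto simp: m'_def lookup_add lookup_minus lookup_single when_def in_keys_iff)
  have "m' \<in> monomials r d"
    using assms unfolding eq by (auto simp: monomials_def keys_add_mono)
  with x eq assms show ?thesis by (intro that[of x m']) (auto simp: monomials_def)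
qed

lemma monomials_Suc:
  "monomials r (Suc d) = (\<Union>x<r. (\<lambda>m. m + Poly_Mapping.single x 1) ` monomials r d)"
  by (auto simp: monomials_def keys_add_mono elim!: monomials_Suc_split[unfolded monomials_def, simplified])

lemma finite_monomials [simp, intro]: "finite (monomials r d)"
  by (induction d) (auto simp: monomials_Suc)

lemma monomials_add: "a \<in> monomials r i \<Longrightarrow> b \<in> monomials r j \<Longrightarrow> a + b \<in> monomials r (i + j)"
  by (auto simp: monomials_def keys_add_mono)

section \<open>Forms and homogeneous components\<close>

lemma forms_eq: "forms r d = {p. Poly_Mapping.keys p \<subseteq> monomials r d}"
  by (auto simp: forms_def monomials_def poly_carrier_def)

lemma forms_carrier: "p \<in> forms r d \<Longrightarrow> p \<in> poly_carrier r"
  by (simp add: forms_def)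

lemma single_in_forms: "m \<in> monomials r d \<Longrightarrow> Poly_Mapping.single m c \<in> forms r d"
  by (auto simp: forms_eq)

lemma forms_mult: "p \<in> forms r i \<Longrightarrow> q \<in> forms r j \<Longrightarrow> p * q \<in> forms r (i + j)"
  using Poly_Mapping.keys_mult[of p q] by (fastforce simp: forms_eq intro: monomials_add)

lemma forms_zero [simp]: "0 \<in> forms r d" by (simp add: forms_eq)
lemma forms_add: "p \<in> forms r d \<Longrightarrow> q \<in> forms r d \<Longrightarrow> p + q \<in> forms r d"
  using Poly_Mapping.keys_add[of p q] by (auto simp: forms_eq)
lemma forms_minus: "p \<in> forms r d \<Longrightarrow> q \<in> forms r d \<Longrightarrow> p - q \<in> forms r d"
  using keys_minus_subset[of p q] by (auto simp: forms_eq)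
lemma forms_scal: "p \<in> forms r d \<Longrightarrow> scal c p \<in> forms r d"
  using keys_scal[of c p] by (auto simp: forms_eq)
lemma forms_sum: "(\<And>i. i \<in> A \<Longrightarrow> f i \<in> forms r d) \<Longrightarrow> sum f A \<in> forms r d"
  using keys_sum_subset[of A f "monomials r d"] by (auto simp: forms_eq)

lemma carrier_zero [simp]: "0 \<in> poly_carrier r" by (simp add: poly_carrier_def)
lemma carrier_one [simp]: "1 \<in> poly_carrier r" by (simp add: poly_carrier_def)
lemma carrier_const [simp]: "Poly_Mapping.single 0 c \<in> poly_carrier r" by (simp add: poly_carrier_def)
lemma carrier_add: "p \<in> poly_carrier r \<Longrightarrow> q \<in> poly_carrier r \<Longrightarrow> p + q \<in> poly_carrier r"
  using Poly_Mapping.keys_add[of p q] by (auto simp: poly_carrier_def)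
lemma carrier_minus: "p \<in> poly_carrier r \<Longrightarrow> q \<in> poly_carrier r \<Longrightarrow> p - q \<in> poly_carrier r"
  using keys_minus_subset[of p q] by (auto simp: poly_carrier_def)
lemma carrier_uminus: "p \<in> poly_carrier r \<Longrightarrow> - p \<in> poly_carrier r"
  using carrier_minus[of 0 r p] by simp
lemma carrier_mult: "p \<in> poly_carrier r \<Longrightarrow> q \<in> poly_carrier r \<Longrightarrow> p * q \<in> poly_carrier r"
  using Poly_Mapping.keys_mult[of p q] by (fastforce simp: poly_carrier_def keys_add_mono)
lemma carrier_sum: "(\<And>i. i \<in> A \<Longrightarrow> f i \<in> poly_carrier r) \<Longrightarrow> sum f A \<in> poly_carrier r"
  by (induction A rule: infinite_finite_induct) (auto intro: carrier_add)

lemma lookup_hom_part: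
  "Poly_Mapping.lookup (hom_part d p) m = (Poly_Mapping.lookup p m when mono_degree m = d)"
proof -
  have "Poly_Mapping.lookup (hom_part d p) m =
    (\<Sum>n\<in>{n \<in> Poly_Mapping.keys p. mono_degree n = d}. (Poly_Mapping.lookup p n when n = m))"
    by (simp add: hom_part_def lookup_sum lookup_single)
  also have "\<dots> = (Poly_Mapping.lookup p m when mono_degree m = d)"
    by (auto simp: when_def in_keys_iff)
  finally show ?thesis .
qed

lemma hom_part_add: "hom_part d (p + q) = hom_part d p + hom_part d q"
  by (rule poly_mapping_eqI) (simp add: lookup_hom_part lookup_add when_add_distrib)

lemma hom_part_minus: "hom_part d (p - q) = hom_part d p - hom_part d q"
  by (rule poly_mapping_eqI) (simp add: lookup_hom_part lookup_minus when_diff_distrib)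

lemma hom_part_zero [simp]: "hom_part d 0 = 0"
  by (rule poly_mapping_eqI) (simp add: lookup_hom_part)

lemma hom_part_sum: "hom_part d (sum f A) = (\<Sum>i\<in>A. hom_part d (f i))"
  by (induction A rule: infinite_finite_induct) (auto simp: hom_part_add)

lemma hom_part_scal: "hom_part d (scal c p) = scal c (hom_part d p)"
  by (rule poly_mapping_eqI) (simp add: lookup_hom_part mult_when)

lemma hom_part_in_forms: "p \<in> poly_carrier r \<Longrightarrow> hom_part d p \<in> forms r d"
  by (auto simp: forms_eq monomials_def poly_carrier_def in_keys_iff lookup_hom_part)

lemma hom_part_forms: "p \<in> forms r d \<Longrightarrow> hom_part i p = (p when i = d)"
  by (rule poly_mapping_eqI)
    (auto simp: lookup_hom_part when_def forms_eq monomials_def in_keys_iff)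

lemma sum_hom_part:
  assumes "\<And>m. m \<in> Poly_Mapping.keys p \<Longrightarrow> mono_degree m \<le> n"
  shows "p = (\<Sum>d\<le>n. hom_part d p)"
proof (rule poly_mapping_eqI)
  fix k
  show "Poly_Mapping.lookup p k = Poly_Mapping.lookup (\<Sum>d\<le>n. hom_part d p) k"
    using assms[of k] by (cases "k \<in> Poly_Mapping.keys p")
      (auto simp: lookup_sum lookup_hom_part when_def in_keys_iff)
qed

lemma obtain_degree_bound:
  obtains n where "\<And>m. m \<in> Poly_Mapping.keys (p :: 'k::field mpol) \<Longrightarrow> mono_degree m \<le> n" "n \<ge> N"
  by (rule that[of "max N (Max (mono_degree ` Poly_Mapping.keys p))"]) (auto simp: le_max_iff_disj)

lemma forms_0: "p \<in> forms r 0 \<Longrightarrow> p = Poly_Mapping.single 0 (Poly_Mapping.lookup p 0)"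
  by (rule poly_mapping_eqI) (auto simp: forms_eq lookup_single when_def in_keys_iff)

lemma hom_part_mult_form:
  assumes "p \<in> forms r i" "q \<in> poly_carrier r"
  shows "hom_part d (p * q) = (if i \<le> d then p * hom_part (d - i) q else 0)"
proof -
  obtain n where n: "\<And>m. m \<in> Poly_Mapping.keys q \<Longrightarrow> mono_degree m \<le> n" "n \<ge> d"
    using obtain_degree_bound[of q d] by blast
  have "p * q = (\<Sum>j\<le>n. p * hom_part j q)"
    by (subst sum_hom_part[OF n(1)]) (simp_all add: sum_distrib_left)
  then have "hom_part d (p * q) = (\<Sum>j\<le>n. hom_part d (p * hom_part j q))"
    by (simp add: hom_part_sum)
  also have "\<dots> = (\<Sum>j\<le>n. (p * hom_part j q when d = i + j))"
    using assms by (intro sum.cong refl hom_part_forms[of _ r]) (auto intro!: forms_mult hom_part_in_forms)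
  also have "\<dots> = (if i \<le> d then p * hom_part (d - i) q else 0)"
  proof (cases "i \<le> d")
    case True
    then have "(\<Sum>j\<le>n. (p * hom_part j q when d = i + j)) = (\<Sum>j\<le>n. (if j = d - i then p * hom_part j q else 0))"
      by (intro sum.cong) (auto simp: when_def)
    moreover have "d - i \<le> n" using n(2) by simp
    ultimately show ?thesis using True by simp
  qed (auto simp: when_def intro!: sum.neutral)
  finally show ?thesis .
qed

section \<open>Reduction modulo a subspace\<close>

text \<open>Leading monomials for the linear order on exponent vectors. \<open>X\<close> will be the
  finite set of monomials of one degree, so that a reduction can recurse on
  \<open>X\<close>.\<close>

definition lead_monomials :: "'k::field mpol set \<Rightarrow> mono set \<Rightarrow> mono set" where
  "lead_monomials J X = {Max (Poly_Mapping.keys q) | q. q \<in> J \<and> q \<noteq> 0 \<and> Poly_Mapping.keys q \<subseteq> X}"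

text \<open>Division with remainder modulo a subspace. The largest monomial \<open>b\<close> of
  \<open>X\<close> is cancelled by an element of \<open>J\<close> if it leads one, and otherwise
  passes to the remainder; what is left lives on \<open>X\<close> without \<open>b\<close>.\<close>

lemma reduction_exists:
  fixes J :: "'k::field mpol set"
  assumes "finite X" "Poly_Mapping.keys p \<subseteq> X"
    and J0: "0 \<in> J" and Jadd: "\<And>p q. p \<in> J \<Longrightarrow> q \<in> J \<Longrightarrow> p + q \<in> J"
    and Jscal: "\<And>c p. p \<in> J \<Longrightarrow> scal c p \<in> J"
  shows "\<exists>s. p - s \<in> J \<and> Poly_Mapping.keys s \<subseteq> X - lead_monomials J X"
  using assms(1,2)
proof (induction X arbitrary: p rule: finite_linorder_max_induct)
  case empty
  then show ?case using J0 by (intro exI[of _ 0]) auto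
next
  case (insert b A)
  \<comment> \<open>An element of \<open>J\<close> supported on \<open>insert b A\<close> either
    contains \<open>b\<close>, which then leads it, or is supported on \<open>A\<close>
    already.\<close>
  have lead: "lead_monomials J (insert b A) \<subseteq> insert b (lead_monomials J A)"
  proof
    fix x assume "x \<in> lead_monomials J (insert b A)"
    then obtain q where q: "q \<in> J" "q \<noteq> 0" "Poly_Mapping.keys q \<subseteq> insert b A"
        "x = Max (Poly_Mapping.keys q)"
      by (auto simp: lead_monomials_def)
    show "x \<in> insert b (lead_monomials J A)"
    proof (cases "b \<in> Poly_Mapping.keys q")
      case True
      moreover have "y \<le> b" if "y \<in> Poly_Mapping.keys q" for y
        using q(3) insert.hyps(2) that by (auto intro: order.strict_implies_order)
      ultimately have "x = b" unfolding q(4) by (intro Max_eqI) auto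
      then show ?thesis by simp
    next
      case False
      then show ?thesis using q by (auto simp: lead_monomials_def)
    qed
  qed
  show ?case
  proof (cases "b \<in> lead_monomials J (insert b A)")
    case True
    then obtain q where q: "q \<in> J" "q \<noteq> 0" "Poly_Mapping.keys q \<subseteq> insert b A"
        "b = Max (Poly_Mapping.keys q)"
      by (auto simp: lead_monomials_def)
    have "b \<in> Poly_Mapping.keys q"
      unfolding q(4) using q(2) by (intro Max_in) auto
    then have qb: "Poly_Mapping.lookup q b \<noteq> 0" by (simp add: in_keys_iff)
    define c where "c = Poly_Mapping.lookup p b / Poly_Mapping.lookup q b"
    have "b \<notin> Poly_Mapping.keys (p - scal c q)" using qb by (simp add: c_def lookup_minus in_keys_iff)
    moreover have "Poly_Mapping.keys (p - scal c q) \<subseteq> insert b A"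
      using keys_minus_subset[of p "scal c q"] keys_scal[of c q] q(3) insert.prems by blast
    ultimately have "Poly_Mapping.keys (p - scal c q) \<subseteq> A" by blast
    from insert.IH[OF this] obtain s where s: "p - scal c q - s \<in> J" "Poly_Mapping.keys s \<subseteq> A - lead_monomials J A"
      by blast
    have "p - s = (p - scal c q - s) + scal c q" by simp
    then have "p - s \<in> J" using Jadd[OF s(1) Jscal[OF q(1), of c]] by (simp only:)
    moreover have "b \<notin> A" using insert.hyps by auto
    ultimately show ?thesis using s(2) lead by blast
  next
    case False
    define c where "c = Poly_Mapping.lookup p b"
    have "Poly_Mapping.keys (p - Poly_Mapping.single b c) \<subseteq> A"
      using insert.prems by (auto simp: in_keys_iff lookup_minus c_def lookup_single when_def split: if_splits)
    from insert.IH[OF this] obtain s where s: "p - Poly_Mapping.single b c - s \<in> J"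
        "Poly_Mapping.keys s \<subseteq> A - lead_monomials J A"
      by blast
    have "p - (Poly_Mapping.single b c + s) \<in> J" using s(1) by (simp add: algebra_simps)
    moreover have "Poly_Mapping.keys (Poly_Mapping.single b c + s) \<subseteq> insert b (Poly_Mapping.keys s)"
      using Poly_Mapping.keys_add[of "Poly_Mapping.single b c" s] by (auto split: if_splits)
    ultimately show ?thesis
      using s(2) lead False by (intro exI[of _ "Poly_Mapping.single b c + s"]) blast
  qed
qed

lemma reduced_unique:
  assumes "s \<in> J" "Poly_Mapping.keys s \<subseteq> X - lead_monomials J X"
  shows "s = 0"
proof (rule ccontr)
  assume "s \<noteq> 0"
  then have "Max (Poly_Mapping.keys s) \<in> lead_monomials J X"
    using assms by (auto simp: lead_monomials_def)
  moreover have "Max (Poly_Mapping.keys s) \<in> Poly_Mapping.keys s" using \<open>s \<noteq> 0\<close> by (intro Max_in) auto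
  ultimately show False using assms by blast
qed

section \<open>Quotients by homogeneous ideals\<close>

lemma poly_ring_simps [simp]:
  "carrier (poly_ring r) = poly_carrier r" "p \<otimes>\<^bsub>poly_ring r\<^esub> q = p * q"
  "\<one>\<^bsub>poly_ring r\<^esub> = 1" "\<zero>\<^bsub>poly_ring r\<^esub> = 0" "p \<oplus>\<^bsub>poly_ring r\<^esub> q = p + q"
  by (simp_all add: poly_ring_def)

lemma cring_poly_ring: "cring (poly_ring r :: 'k::field mpol ring)"
proof (rule cringI)
  show "abelian_group (poly_ring r :: 'k mpol ring)"
  proof (rule abelian_groupI, goal_cases)
    case (6 x)
    then show ?case using carrier_uminus[of x r] by (intro bexI[of _ "- x"]) auto
  qed (auto simp: carrier_add algebra_simps)
  show "Group.comm_monoid (poly_ring r :: 'k mpol ring)"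
    by (rule comm_monoidI) (auto simp: carrier_mult algebra_simps)
qed (auto simp: algebra_simps)

lemma a_inv_poly_ring:
  assumes "p \<in> poly_carrier r" shows "a_inv (poly_ring r) p = - p"
proof -
  interpret cring "poly_ring r" by (rule cring_poly_ring)
  show ?thesis using assms carrier_uminus[OF assms] by (intro minus_equality) auto
qed

lemma a_minus_poly_ring:
  "p \<in> poly_carrier r \<Longrightarrow> q \<in> poly_carrier r \<Longrightarrow> a_minus (poly_ring r) p q = p - q"
  by (simp add: a_minus_def a_inv_poly_ring)

lemma ideal_poly_ringI:
  assumes "I \<subseteq> poly_carrier r" "0 \<in> I" "\<And>p q. p \<in> I \<Longrightarrow> q \<in> I \<Longrightarrow> p + q \<in> I"
    and mult: "\<And>p q. p \<in> I \<Longrightarrow> q \<in> poly_carrier r \<Longrightarrow> q * p \<in> I"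
  shows "ideal I (poly_ring r)"
proof -
  interpret cring "poly_ring r" by (rule cring_poly_ring)
  have neg: "- p \<in> I" if "p \<in> I" for p
    using mult[OF that, of "-1"] carrier_uminus[OF carrier_one, of r] by simp
  show ?thesis
  proof (rule idealI)
    show "subgroup I (add_monoid (poly_ring r))"
      using assms neg by (intro add.subgroupI)
        (auto simp: subset_iff a_inv_poly_ring simp flip: a_inv_def)
    show "a \<otimes>\<^bsub>poly_ring r\<^esub> x \<in> I" if "a \<in> I" "x \<in> carrier (poly_ring r)" for a x
      using mult[of a x] that by (simp add: mult.commute)
  qed (auto simp: ring_axioms mult)
qed

text \<open>Properness makes the image of the constants a field, which the general lemmas on
  dimension require.\<close>

locale graded_quotient =
  fixes r :: nat and I :: "'k::field mpol set"
  assumes hom: "homogeneous_ideal r I" and proper: "1 \<notin> I"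
begin

lemma ideal: "ideal I (poly_ring r)"
  using hom by (simp add: homogeneous_ideal_def)

lemma zero_mem: "0 \<in> I"
  using additive_subgroup.zero_closed[OF ideal.axioms(1)[OF ideal]] by simp

lemma add_mem: "p \<in> I \<Longrightarrow> q \<in> I \<Longrightarrow> p + q \<in> I"
  using additive_subgroup.a_closed[OF ideal.axioms(1)[OF ideal]] by simp

lemma mult_mem: "p \<in> I \<Longrightarrow> q \<in> poly_carrier r \<Longrightarrow> q * p \<in> I"
  using ideal.I_l_closed[OF ideal] by simp

lemma scal_mem: "p \<in> I \<Longrightarrow> scal c p \<in> I"
  by (simp add: mult_mem)

lemma minus_mem: "p \<in> I \<Longrightarrow> q \<in> I \<Longrightarrow> p - q \<in> I"
  using add_mem[of p "scal (-1) q"] scal_mem[of q "-1"] by (simp add: single_uminus)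

lemma sum_mem: "(\<And>i. i \<in> A \<Longrightarrow> f i \<in> I) \<Longrightarrow> sum f A \<in> I"
  by (induction A rule: infinite_finite_induct) (auto simp: zero_mem add_mem)

lemma hom_part_mem: "p \<in> I \<Longrightarrow> hom_part d p \<in> I"
  using hom by (simp add: homogeneous_ideal_def)

lemma scal_mem_iff: "c \<noteq> 0 \<Longrightarrow> scal c p \<in> I \<longleftrightarrow> p \<in> I"
  using scal_mem[of "scal c p" "inverse c"] scal_mem[of p c]
  by (auto simp: mult.assoc[symmetric] mult_single)

abbreviation rc :: "'k mpol \<Rightarrow> 'k mpol set" where "rc \<equiv> residue_class r I"
abbreviation K :: "'k mpol set set" where "K \<equiv> base_field r I"

sublocale A: cring "quot_alg r I"
  unfolding quot_alg_def by (rule ideal.quotient_is_cring[OF ideal cring_poly_ring])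

lemma rc_hom: "rc \<in> ring_hom (poly_ring r) (quot_alg r I)"
  unfolding quot_alg_def residue_class_def by (rule ideal.rcos_ring_hom[OF ideal])

lemma rc_carrier [simp]: "p \<in> poly_carrier r \<Longrightarrow> rc p \<in> carrier (quot_alg r I)"
  using ring_hom_closed[OF rc_hom] by simp

lemma carrier_quot_alg: "carrier (quot_alg r I) = rc ` poly_carrier r"
  by (auto simp: quot_alg_def FactRing_def A_RCOSETS_def' residue_class_def)

lemma rc_mult: "p \<in> poly_carrier r \<Longrightarrow> q \<in> poly_carrier r \<Longrightarrow> rc p \<otimes>\<^bsub>quot_alg r I\<^esub> rc q = rc (p * q)"
  using ring_hom_mult[OF rc_hom] by simp

lemma rc_add: "p \<in> poly_carrier r \<Longrightarrow> q \<in> poly_carrier r \<Longrightarrow> rc p \<oplus>\<^bsub>quot_alg r I\<^esub> rc q = rc (p + q)"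
  using ring_hom_add[OF rc_hom] by simp

lemma rc_one: "\<one>\<^bsub>quot_alg r I\<^esub> = rc 1"
  using ring_hom_one[OF rc_hom] by simp

lemma rc_zero: "\<zero>\<^bsub>quot_alg r I\<^esub> = rc 0"
  using ring_hom_zero[OF rc_hom] cring.axioms(1)[OF cring_poly_ring] A.ring_axioms by force

lemma rc_eq_iff: "p \<in> poly_carrier r \<Longrightarrow> q \<in> poly_carrier r \<Longrightarrow> rc p = rc q \<longleftrightarrow> p - q \<in> I"
  using ring.quotient_eq_iff_same_a_r_cos[OF cring.axioms(1)[OF cring_poly_ring] ideal, of p q]
  by (simp add: residue_class_def a_minus_poly_ring)

lemma rc_eq_zero_iff: "p \<in> poly_carrier r \<Longrightarrow> rc p = \<zero>\<^bsub>quot_alg r I\<^esub> \<longleftrightarrow> p \<in> I"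
  by (simp add: rc_zero rc_eq_iff)

lemma const_mem_iff: "Poly_Mapping.single 0 c \<in> I \<longleftrightarrow> c = 0"
  using scal_mem_iff[of c 1] proper zero_mem by (cases "c = 0") auto

lemma subfield_K: "subfield K (quot_alg r I)"
proof (rule A.subfieldI)
  have neg: "\<ominus>\<^bsub>quot_alg r I\<^esub> rc (Poly_Mapping.single 0 c) = rc (Poly_Mapping.single 0 (- c))" for c
    by (rule A.minus_equality) (auto simp: rc_add rc_zero simp flip: single_add)
  have sub: "subring K (quot_alg r I)"
    by (rule A.subringI)
      (auto simp: base_field_def rc_one neg rc_mult mult_single rc_add simp flip: single_add single_one)
  show "subcring K (quot_alg r I)"
    by (rule A.subcringI[OF sub]) (auto simp: base_field_def A.m_comm)
  show "Units (quot_alg r I\<lparr>carrier := K\<rparr>) = K - {\<zero>\<^bsub>quot_alg r I\<^esub>}"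
  proof (intro equalityI subsetI)
    fix x assume "x \<in> Units (quot_alg r I\<lparr>carrier := K\<rparr>)"
    then obtain y where xy: "x \<in> K" "y \<in> K" "x \<otimes>\<^bsub>quot_alg r I\<^esub> y = \<one>\<^bsub>quot_alg r I\<^esub>"
      by (auto simp: Units_def)
    have "\<one>\<^bsub>quot_alg r I\<^esub> \<noteq> \<zero>\<^bsub>quot_alg r I\<^esub>" using proper by (simp add: rc_one rc_eq_zero_iff)
    moreover have "y \<in> carrier (quot_alg r I)" using xy(2) by (auto simp: base_field_def)
    ultimately have "x \<noteq> \<zero>\<^bsub>quot_alg r I\<^esub>" using xy(3) A.l_null[of y] by metis
    then show "x \<in> K - {\<zero>\<^bsub>quot_alg r I\<^esub>}" using xy(1) by blast
  next
    fix x assume x: "x \<in> K - {\<zero>\<^bsub>quot_alg r I\<^esub>}"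
    then obtain c where c: "x = rc (Poly_Mapping.single 0 c)" unfolding base_field_def by blast
    have "c \<noteq> 0" using x unfolding c by (metis DiffD2 rc_zero single_zero singletonI)
    have "x \<otimes>\<^bsub>quot_alg r I\<^esub> rc (Poly_Mapping.single 0 (inverse c)) = \<one>\<^bsub>quot_alg r I\<^esub>"
      using \<open>c \<noteq> 0\<close> by (simp add: c rc_mult mult_single rc_one)
    moreover have "rc (Poly_Mapping.single 0 (inverse c)) \<otimes>\<^bsub>quot_alg r I\<^esub> x = \<one>\<^bsub>quot_alg r I\<^esub>"
      using \<open>c \<noteq> 0\<close> by (simp add: c rc_mult mult_single rc_one)
    ultimately show "x \<in> Units (quot_alg r I\<lparr>carrier := K\<rparr>)"
      using c unfolding Units_def base_field_def by simp blast
  qed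
qed

lemma combine_rc:
  assumes "length cs = length ps" "set ps \<subseteq> poly_carrier r"
  shows "A.combine (map (\<lambda>c. rc (Poly_Mapping.single 0 c)) cs) (map rc ps)
    = rc (\<Sum>j<length ps. scal (cs ! j) (ps ! j))"
  using assms
proof (induction cs ps rule: list_induct2)
  case (Cons c cs p ps)
  then have "(\<Sum>j<length ps. scal (cs ! j) (ps ! j)) \<in> poly_carrier r"
    by (intro carrier_sum carrier_mult) auto
  then show ?case using Cons
    by (simp add: rc_mult rc_add carrier_mult sum.lessThan_Suc_shift del: sum.lessThan_Suc)
qed (simp add: rc_zero)

text \<open>The classes of the \<open>p j\<close> form a basis of the image of \<open>W\<close>.
  Linear algebra thus runs on polynomials with arbitrary finite index sets instead of lists of
  cosets.\<close>

definition basis_mod :: "'k mpol set \<Rightarrow> 'a set \<Rightarrow> ('a \<Rightarrow> 'k mpol) \<Rightarrow> bool" where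
  "basis_mod W J p \<longleftrightarrow> finite J \<and> (\<forall>j\<in>J. p j \<in> W) \<and>
     (\<forall>c. (\<Sum>j\<in>J. scal (c j) (p j)) \<in> I \<longrightarrow> (\<forall>j\<in>J. c j = 0)) \<and>
     (\<forall>w\<in>W. \<exists>c. w - (\<Sum>j\<in>J. scal (c j) (p j)) \<in> I)"

lemma K_list: "set Ks \<subseteq> K \<Longrightarrow> \<exists>cs. Ks = map (\<lambda>c. rc (Poly_Mapping.single 0 c)) cs"
proof (induction Ks)
  case (Cons a Ks)
  then obtain c cs where "a = rc (Poly_Mapping.single 0 c)" "Ks = map (\<lambda>c. rc (Poly_Mapping.single 0 c)) cs"
    by (auto simp: base_field_def)
  then show ?case by (intro exI[of _ "c # cs"]) simp
qed auto

lemma Span_rc: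
  assumes W: "W \<subseteq> poly_carrier r" "0 \<in> W" "\<And>p q. p \<in> W \<Longrightarrow> q \<in> W \<Longrightarrow> p + q \<in> W"
    "\<And>c p. p \<in> W \<Longrightarrow> scal c p \<in> W"
    and ps: "set ps \<subseteq> W"
    and span: "\<And>w. w \<in> W \<Longrightarrow> \<exists>c. w - (\<Sum>j<length ps. scal (c j) (ps ! j)) \<in> I"
  shows "A.Span K (map rc ps) = rc ` W"
proof -
  have carr: "set (map rc ps) \<subseteq> carrier (quot_alg r I)" using ps W(1) by auto
  have psS: "set ps \<subseteq> poly_carrier r" using ps W(1) by auto
  have sumW: "(\<Sum>j\<in>A. f j) \<in> W" if "\<And>j. j \<in> A \<Longrightarrow> f j \<in> W" for A and f :: "nat \<Rightarrow> 'k mpol"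
    using that by (induction A rule: infinite_finite_induct) (auto simp: W)
  have combW: "(\<Sum>j<length ps. scal (c j) (ps ! j)) \<in> W" for c
    using ps by (intro sumW W(4)) (auto dest: nth_mem)
  show ?thesis
  proof (intro equalityI subsetI)
    fix x assume "x \<in> A.Span K (map rc ps)"
    then obtain Ks where Ks: "set Ks \<subseteq> K" "length Ks = length ps" "x = A.combine Ks (map rc ps)"
      using A.Span_mem_iff_length_version[OF subfield_K carr] by auto
    from K_list[OF Ks(1)] obtain cs where cs: "Ks = map (\<lambda>c. rc (Poly_Mapping.single 0 c)) cs" by blast
    show "x \<in> rc ` W" using combine_rc[of cs ps] Ks psS cs combW[of "(!) cs"] by simp
  next
    fix x assume "x \<in> rc ` W"
    then obtain w where w: "x = rc w" "w \<in> W" by blast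
    from span[OF w(2)] obtain c where c: "w - (\<Sum>j<length ps. scal (c j) (ps ! j)) \<in> I" by blast
    define cs where "cs = map c [0..<length ps]"
    have "x = rc (\<Sum>j<length ps. scal (c j) (ps ! j))"
      using c w(2) combW[of c] W(1) unfolding w(1) by (subst rc_eq_iff) auto
    also have "(\<Sum>j<length ps. scal (c j) (ps ! j)) = (\<Sum>j<length ps. scal (cs ! j) (ps ! j))"
      by (intro sum.cong) (auto simp: cs_def)
    also have "rc \<dots> = A.combine (map (\<lambda>c. rc (Poly_Mapping.single 0 c)) cs) (map rc ps)"
      using psS by (intro combine_rc[symmetric]) (auto simp: cs_def)
    finally show "x \<in> A.Span K (map rc ps)"
      using A.Span_mem_iff_length_version[OF subfield_K carr]
      by (auto simp: cs_def base_field_def intro!: exI[of _ "map (\<lambda>c. rc (Poly_Mapping.single 0 c)) cs"])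
  qed
qed

lemma basis_mod_imp_dimension:
  assumes W: "W \<subseteq> poly_carrier r" "0 \<in> W" "\<And>p q. p \<in> W \<Longrightarrow> q \<in> W \<Longrightarrow> p + q \<in> W"
    "\<And>c p. p \<in> W \<Longrightarrow> scal c p \<in> W"
    and basis: "basis_mod W J p"
  shows "A.dimension (card J) K (rc ` W)"
proof -
  have "finite J" using basis by (simp add: basis_mod_def)
  then obtain xs where xs: "set xs = J" "distinct xs" by (metis finite_distinct_list)
  define ps where "ps = map p xs"
  have bij: "bij_betw ((!) xs) {..<length xs} J" by (rule bij_betw_nth[OF xs(2)]) (auto simp: xs(1))
  have reindex: "(\<Sum>j<length ps. scal (c (xs ! j)) (ps ! j)) = (\<Sum>j\<in>J. scal (c j) (p j))" for c
    using sum.reindex_bij_betw[OF bij, of "\<lambda>j. scal (c j) (p j)"] by (simp add: ps_def)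
  have psW: "set ps \<subseteq> W" using basis by (auto simp: ps_def xs basis_mod_def)
  have psS: "set ps \<subseteq> poly_carrier r" using psW W(1) by blast
  have span: "A.Span K (map rc ps) = rc ` W"
  proof (rule Span_rc[OF W psW])
    fix w assume "w \<in> W"
    then obtain c where "w - (\<Sum>j\<in>J. scal (c j) (p j)) \<in> I" using basis by (auto simp: basis_mod_def)
    then show "\<exists>c. w - (\<Sum>j<length ps. scal (c j) (ps ! j)) \<in> I"
      using reindex[of c] by (intro exI[of _ "\<lambda>j. c (xs ! j)"]) simp
  qed
  have "A.independent K (map rc ps)"
  proof (rule ccontr)
    assume "A.dependent K (map rc ps)"
    moreover have "set (map rc ps) \<subseteq> carrier (quot_alg r I)" using psS by auto
    ultimately obtain Ks where Ks: "length Ks = length (map rc ps)" "A.combine Ks (map rc ps) = \<zero>\<^bsub>quot_alg r I\<^esub>"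
        "set Ks \<subseteq> K" "set Ks \<noteq> {\<zero>\<^bsub>quot_alg r I\<^esub>}"
      using A.dependent_imp_non_trivial_combine[OF subfield_K] by metis
    from K_list[OF Ks(3)] obtain cs where cs: "Ks = map (\<lambda>c. rc (Poly_Mapping.single 0 c)) cs" by blast
    define c where "c = (\<lambda>j. cs ! inv_into {..<length xs} ((!) xs) j)"
    have c_nth: "c (xs ! j) = cs ! j" if "j < length xs" for j
      using bij_betw_inv_into_left[OF bij, of j] that by (simp add: c_def)
    have "rc (\<Sum>j<length ps. scal (cs ! j) (ps ! j)) = \<zero>\<^bsub>quot_alg r I\<^esub>"
      using Ks(1,2) psS unfolding cs by (subst combine_rc[symmetric]) auto
    moreover have "(\<Sum>j<length ps. scal (cs ! j) (ps ! j)) = (\<Sum>j\<in>J. scal (c j) (p j))"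
      unfolding reindex[symmetric] by (intro sum.cong) (auto simp: c_nth ps_def)
    moreover have "(\<Sum>j<length ps. scal (cs ! j) (ps ! j)) \<in> poly_carrier r"
      using psS by (intro carrier_sum carrier_mult) auto
    ultimately have "(\<Sum>j\<in>J. scal (c j) (p j)) \<in> I" using rc_eq_zero_iff by metis
    then have c0: "\<forall>j\<in>J. c j = 0" using basis by (auto simp: basis_mod_def)
    have "cs ! j = 0" if "j < length xs" for j
      using c_nth[OF that] c0 xs(1) that by (metis nth_mem)
    then have "set cs \<subseteq> {0}" using Ks(1) by (auto simp: in_set_conv_nth cs ps_def)
    then have "set Ks \<subseteq> {\<zero>\<^bsub>quot_alg r I\<^esub>}" by (auto simp: cs rc_zero)
    with Ks(4) have "Ks = []" by (metis set_empty subset_singletonD)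
    then have "ps = []" using Ks(1) by simp
    then show False using \<open>A.dependent K (map rc ps)\<close> by simp
  qed
  from A.dimensionI[OF subfield_K this span] have "A.dimension (length ps) K (rc ` W)" by simp
  moreover have "length ps = card J" using xs distinct_card[of xs] by (simp add: ps_def)
  ultimately show ?thesis by simp
qed

text \<open>Representatives in \<open>W\<close> are chosen for a base of cosets. This is how the
  hypothesis of a one-dimensional socle becomes usable.\<close>

lemma dimension_imp_basis_mod:
  assumes W: "W \<subseteq> poly_carrier r" and dim: "A.dimension n K (rc ` W)"
  obtains p where "basis_mod W {..<n} p"
proof -
  obtain Us where Us: "set Us \<subseteq> carrier (quot_alg r I)" "A.independent K Us" "length Us = n"
      "A.Span K Us = rc ` W"
    using A.exists_base[OF subfield_K dim] by blast
  have "set Us \<subseteq> rc ` W" using A.Span_base_incl[OF subfield_K Us(1)] Us(4) by simp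
  then have "\<forall>j<n. \<exists>p\<in>W. Us ! j = rc p" using Us(3) by (metis imageE nth_mem subsetD)
  then obtain p where p: "\<And>j. j < n \<Longrightarrow> p j \<in> W" "\<And>j. j < n \<Longrightarrow> Us ! j = rc (p j)" by metis
  define ps where "ps = map p [0..<n]"
  have Us_eq: "Us = map rc ps" by (rule nth_equalityI) (auto simp: ps_def Us p)
  have psS: "set ps \<subseteq> poly_carrier r" using p W by (auto simp: ps_def)
  have pS: "(\<Sum>j<n. scal (c j) (p j)) \<in> poly_carrier r" for c
    using p W by (intro carrier_sum carrier_mult) auto
  have comb: "A.combine (map (\<lambda>c. rc (Poly_Mapping.single 0 c)) (map c [0..<n])) Us
      = rc (\<Sum>j<n. scal (c j) (p j))" for c
    using combine_rc[of "map c [0..<n]" ps] psS by (simp add: Us_eq ps_def)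
  have inK: "set (map (\<lambda>c. rc (Poly_Mapping.single 0 c)) cs) \<subseteq> K" for cs
    by (auto simp: base_field_def)
  have "basis_mod W {..<n} p"
    unfolding basis_mod_def
  proof (intro conjI allI impI ballI)
    fix c j assume c: "(\<Sum>j<n. scal (c j) (p j)) \<in> I" and "j \<in> {..<n}"
    have "A.combine (map (\<lambda>c. rc (Poly_Mapping.single 0 c)) (map c [0..<n])) Us = \<zero>\<^bsub>quot_alg r I\<^esub>"
      using c pS by (simp only: comb rc_eq_zero_iff)
    from A.independent_imp_trivial_combine[OF subfield_K Us(2) inK this]
    have "rc (Poly_Mapping.single 0 (c j)) = \<zero>\<^bsub>quot_alg r I\<^esub>"
      using \<open>j \<in> {..<n}\<close> Us(3) by (simp add: image_subset_iff)
    then show "c j = 0" by (simp add: rc_eq_zero_iff const_mem_iff)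
  next
    fix w assume w: "w \<in> W"
    then have "rc w \<in> A.Span K Us" using Us(4) by simp
    then obtain Ks where Ks: "set Ks \<subseteq> K" "length Ks = length Us" "rc w = A.combine Ks Us"
      using A.Span_mem_iff_length_version[OF subfield_K Us(1)] by auto
    from K_list[OF Ks(1)] obtain cs where cs: "Ks = map (\<lambda>c. rc (Poly_Mapping.single 0 c)) cs" by blast
    have "cs = map ((!) cs) [0..<n]" using Ks(2) Us(3) cs by (intro nth_equalityI) auto
    then have "rc w = rc (\<Sum>j<n. scal (cs ! j) (p j))" using comb[of "(!) cs"] Ks(3) cs by metis
    then show "\<exists>c. w - (\<Sum>j<n. scal (c j) (p j)) \<in> I"
      using w W pS by (subst (asm) rc_eq_iff) auto
  qed (use p in auto)
  then show ?thesis by (rule that)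
qed

end

section \<open>Standard monomials\<close>

text \<open>Ideals are subspaces. A member of the chain with the least dimension contains every
  later one, and each later one has at least that dimension.\<close>

lemma (in ring) finite_dimension_imp_artinian:
  assumes K: "subfield K R" and fin: "finite_dimension K (carrier R)"
  shows "artinian R"
  unfolding artinian_def
proof (intro allI impI)
  fix J :: "nat \<Rightarrow> 'a set"
  assume J: "\<forall>n. ideal (J n) R \<and> J (Suc n) \<subseteq> J n"
  have fd: "finite_dimension K (J n)" for n
    using J ideal_is_subalgebra[OF subfieldE(3)[OF K]] ideal.Icarr[of "J n" R]
    by (intro subalbegra_incl_imp_finite_dimension[OF K fin]) auto
  define \<delta> where "\<delta> n = (dim over K) (J n)" for n
  have dim: "dimension (\<delta> n) K (J n)" for n
    unfolding \<delta>_def by (rule finite_dimensionE[OF K fd])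
  have mono: "J n \<subseteq> J N" if "N \<le> n" for n N
    using that J by (induction rule: dec_induct) auto
  define N where "N = (ARG_MIN \<delta> n. True)"
  have N: "\<delta> N \<le> \<delta> n" for n unfolding N_def by (rule arg_min_nat_le) simp
  have "J n = J N" if "N \<le> n" for n
  proof -
    obtain Us where Us: "set Us \<subseteq> carrier R" "independent K Us" "length Us = \<delta> n" "Span K Us = J n"
      using exists_base[OF K dim] by blast
    have "set Us \<subseteq> J N" using Span_base_incl[OF K Us(1)] Us(4) mono[OF that] by blast
    moreover from this have "length Us \<le> \<delta> N"
      by (rule independent_length_le_dimension[OF K dim Us(2)])
    ultimately have "Span K Us = J N"
      using independent_length_eq_dimension[OF K dim[of N] Us(2)] N[of n] Us(3) by simp
    then show ?thesis using Us(4) by simp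
  qed
  then show "\<exists>N. \<forall>n\<ge>N. J n = J N" by blast
qed

lemma lookup_single_mult:
  "Poly_Mapping.lookup (Poly_Mapping.single m c * q) (m + k) = c * Poly_Mapping.lookup q k"
  for q :: "'k::field mpol"
  by (simp add: lookup_mult lookup_single when_mult)

context graded_quotient
begin

lemma mem_if_hom_parts:
  assumes "\<And>d. hom_part d p \<in> I"
  shows "p \<in> I"
proof -
  obtain n where "\<And>m. m \<in> Poly_Mapping.keys p \<Longrightarrow> mono_degree m \<le> n"
    using obtain_degree_bound[of p 0] by blast
  then show ?thesis using assms by (subst sum_hom_part) (auto intro: sum_mem)
qed

lemma hilbert_function_eq_card:
  assumes "basis_mod (forms r d) J p"
  shows "hilbert_function r I d = card J"
proof -
  have "A.dimension (card J) K (rc ` forms r d)"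
    by (rule basis_mod_imp_dimension[OF _ _ _ _ assms]) (auto intro: forms_carrier forms_add forms_scal)
  then show ?thesis
    using A.dimI[OF subfield_K] by (simp add: hilbert_function_def graded_piece_def over_def)
qed

definition std :: "nat \<Rightarrow> mono set" where
  "std d = monomials r d - lead_monomials I (monomials r d)"

lemma finite_std [simp]: "finite (std d)" by (simp add: std_def)

lemma std_subset: "std d \<subseteq> monomials r d" by (auto simp: std_def)

lemma std_reduced: "p \<in> I \<Longrightarrow> Poly_Mapping.keys p \<subseteq> std d \<Longrightarrow> p = 0"
  unfolding std_def by (rule reduced_unique)

lemma std_reduction:
  assumes "p \<in> forms r d"
  obtains s where "p - s \<in> I" "Poly_Mapping.keys s \<subseteq> std d"
  using reduction_exists[of "monomials r d" p I] assms zero_mem add_mem scal_mem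
  by (auto simp: forms_eq std_def)

text \<open>Macaulay's basis theorem: existence of remainders gives spanning, their uniqueness gives
  independence.\<close>

lemma basis_mod_std: "basis_mod (forms r d) (std d) (\<lambda>m. Poly_Mapping.single m 1)"
  unfolding basis_mod_def
proof (intro conjI allI impI ballI)
  fix c m assume c: "(\<Sum>m\<in>std d. scal (c m) (Poly_Mapping.single m 1)) \<in> I" and m: "m \<in> std d"
  have "Poly_Mapping.keys (\<Sum>m\<in>std d. scal (c m) (Poly_Mapping.single m 1)) \<subseteq> std d"
    by (intro keys_sum_subset order_trans[OF keys_scal]) auto
  from std_reduced[OF c this] have "Poly_Mapping.lookup (\<Sum>m\<in>std d. scal (c m) (Poly_Mapping.single m 1)) m = 0"
    by simp
  then show "c m = 0" using m
    by (simp add: lookup_sum lookup_single when_def if_distrib[of "(*) _"] cong: if_cong)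
next
  fix w :: "'k mpol" assume "w \<in> forms r d"
  then obtain s where s: "w - s \<in> I" "Poly_Mapping.keys s \<subseteq> std d" by (rule std_reduction)
  then show "\<exists>c. w - (\<Sum>m\<in>std d. scal (c m) (Poly_Mapping.single m 1)) \<in> I"
    using scal_sum_single[OF s(2)] by (intro exI[of _ "Poly_Mapping.lookup s"]) simp
qed (use std_subset in \<open>auto intro: single_in_forms\<close>)

lemma hilbert_function_std: "hilbert_function r I d = card (std d)"
  by (rule hilbert_function_eq_card[OF basis_mod_std])

text \<open>The order on exponent vectors is invariant under translation, so multiplying by a
  variable translates the leading monomial. A multiple of a leading monomial is therefore
  leading.\<close>

lemma std_divisor:
  assumes "m + Poly_Mapping.single x 1 \<in> std (Suc d)"
  shows "m \<in> std d"
proof (rule ccontr)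
  assume not: "m \<notin> std d"
  have "m + Poly_Mapping.single x 1 \<in> monomials r (Suc d)" using assms std_subset by blast
  then have m: "m \<in> monomials r d" and x: "x < r" by (auto simp: monomials_def keys_add_mono)
  from not m obtain q where q: "q \<in> I" "q \<noteq> 0" "Poly_Mapping.keys q \<subseteq> monomials r d"
      "m = Max (Poly_Mapping.keys q)"
    by (auto simp: std_def lead_monomials_def)
  define X where "X = (Poly_Mapping.single (Poly_Mapping.single x 1) 1 :: 'k mpol)"
  have X: "X \<in> forms r 1" using x by (auto simp: X_def monomials_def intro!: single_in_forms)
  have lookup: "Poly_Mapping.lookup (X * q) (k + Poly_Mapping.single x 1) = Poly_Mapping.lookup q k" for k
    using lookup_single_mult[of "Poly_Mapping.single x 1" 1 q k] by (simp add: X_def add.commute)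
  have keys: "Poly_Mapping.keys (X * q) = (\<lambda>k. k + Poly_Mapping.single x 1) ` Poly_Mapping.keys q"
  proof
    show "Poly_Mapping.keys (X * q) \<subseteq> (\<lambda>k. k + Poly_Mapping.single x 1) ` Poly_Mapping.keys q"
      using Poly_Mapping.keys_mult[of X q] by (auto simp: X_def add.commute)
  qed (use lookup in \<open>auto simp: in_keys_iff\<close>)
  have "Max (Poly_Mapping.keys (X * q)) = m + Poly_Mapping.single x 1"
    unfolding keys q(4) using q(2)
    by (intro mono_Max_commute[symmetric]) (auto simp: mono_def intro: add_right_mono)
  moreover have "X * q \<in> I" using X q(1) by (intro mult_mem) (auto intro: forms_carrier)
  moreover have "X * q \<noteq> 0" using keys q(2) by (metis image_is_empty keys_eq_empty)
  moreover have "Poly_Mapping.keys (X * q) \<subseteq> monomials r (Suc d)"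
    using q(3) x unfolding keys monomials_Suc by blast
  ultimately have "m + Poly_Mapping.single x 1 \<in> lead_monomials I (monomials r (Suc d))"
    unfolding lead_monomials_def by force
  then show False using assms by (simp add: std_def)
qed

end

section \<open>Symmetry of Gorenstein Hilbert functions\<close>

text \<open>Gaussian elimination. Equation \<open>b\<close> is solved for the unknown
  \<open>a0\<close> with pivot \<open>M a0 b\<close>; substitution into the other equations gives
  the matrix of the recursive call.\<close>

lemma exists_nontrivial_solution:
  fixes M :: "'a \<Rightarrow> 'b \<Rightarrow> 'k::field"
  assumes "finite B" "finite A" "card B < card A"
  shows "\<exists>c. (\<exists>a\<in>A. c a \<noteq> 0) \<and> (\<forall>b\<in>B. (\<Sum>a\<in>A. c a * M a b) = 0)"
  using assms
proof (induction B arbitrary: A M rule: finite_induct)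
  case empty
  then show ?case by (intro exI[of _ "\<lambda>_. 1"]) (auto simp: card_gt_0_iff)
next
  case (insert b B)
  show ?case
  proof (cases "\<forall>a\<in>A. M a b = 0")
    case True
    have "card B < card A" using insert by simp
    from insert.IH[OF insert.prems(1) this, of M] True show ?thesis by auto
  next
    case False
    then obtain a0 where a0: "a0 \<in> A" "M a0 b \<noteq> 0" by blast
    let ?A = "A - {a0}"
    have "card B < card ?A" using insert a0 by simp
    then obtain c where c: "\<exists>a\<in>?A. c a \<noteq> 0"
        "\<forall>b'\<in>B. (\<Sum>a\<in>?A. c a * (M a b' - M a b / M a0 b * M a0 b')) = 0"
      using insert.IH[of ?A "\<lambda>a b'. M a b' - M a b / M a0 b * M a0 b'"] insert.prems(1) by auto
    define c0 where "c0 = - (\<Sum>a\<in>?A. c a * M a b) / M a0 b"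
    have sum: "(\<Sum>a\<in>A. (if a = a0 then c0 else c a) * M a b') = c0 * M a0 b' + (\<Sum>a\<in>?A. c a * M a b')" for b'
      using a0 insert.prems(1) by (subst sum.remove[of A a0]) (auto intro!: sum.cong)
    have "(\<Sum>a\<in>A. (if a = a0 then c0 else c a) * M a b') = 0" if "b' \<in> insert b B" for b'
    proof (cases "b' = b")
      case True
      then show ?thesis using a0(2) by (simp add: sum c0_def)
    next
      case False
      then have "0 = (\<Sum>a\<in>?A. c a * (M a b' - M a b / M a0 b * M a0 b'))" using c(2) that by auto
      also have "\<dots> = (\<Sum>a\<in>?A. c a * M a b') - (\<Sum>a\<in>?A. c a * M a b) / M a0 b * M a0 b'"
        by (simp add: right_diff_distrib sum_subtractf sum_distrib_right sum_divide_distrib mult.assoc)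
      finally show ?thesis by (simp add: sum c0_def)
    qed
    then show ?thesis using c(1) by (intro exI[of _ "\<lambda>a. if a = a0 then c0 else c a"]) auto
  qed
qed

definition (in graded_quotient) socle_poly :: "'k mpol set" where
  "socle_poly = {p \<in> poly_carrier r. \<forall>b\<in>poly_carrier r. Poly_Mapping.lookup b 0 = 0 \<longrightarrow> p * b \<in> I}"

lemma (in graded_quotient) socle_eq: "socle r I = rc ` socle_poly"
proof -
  have "rc p \<in> socle r I \<longleftrightarrow> p \<in> socle_poly" if "p \<in> poly_carrier r" for p
    using that by (auto simp: socle_def irrelevant_ideal_def socle_poly_def rc_mult rc_eq_zero_iff carrier_mult)
  moreover have "x \<in> rc ` poly_carrier r" if "x \<in> socle r I" for x
    using that by (simp add: socle_def carrier_quot_alg)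
  ultimately show ?thesis unfolding socle_poly_def by blast
qed

text \<open>A factor without constant term raises the degree above \<open>e\<close>, where every
  form lies in \<open>I\<close>.\<close>

lemma (in graded_quotient) forms_in_socle:
  assumes forms_above: "\<And>i p. i > e \<Longrightarrow> p \<in> forms r i \<Longrightarrow> p \<in> I" and p: "p \<in> forms r e"
  shows "p \<in> socle_poly"
  unfolding socle_poly_def
proof (safe)
  show "p \<in> poly_carrier r" using p by (rule forms_carrier)
  fix b :: "'k mpol" assume b: "b \<in> poly_carrier r" "Poly_Mapping.lookup b 0 = 0"
  have "hom_part d (p * b) \<in> I" for d
  proof (cases "d > e")
    case True
    then show ?thesis using p b forms_carrier
      by (intro forms_above[of d] hom_part_in_forms carrier_mult) auto
  next
    case False
    have "hom_part 0 b = 0"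
      using b hom_part_in_forms[OF b(1), of 0] by (subst forms_0[of _ r]) (auto simp: lookup_hom_part)
    then show ?thesis using False zero_mem by (auto simp: hom_part_mult_form[OF p b(1)])
  qed
  then show "p * b \<in> I" by (rule mem_if_hom_parts)
qed

text \<open>With \<open>1\<close> in \<open>I\<close> the quotient would be the zero ring and its
  base field no field, so the usual facts on dimension are out of reach. The inductive definition
  decides directly: dimension 1 asks for a vector outside the zero space.\<close>

lemma artinian_gorenstein_proper:
  assumes "artinian_gorenstein r (I :: 'k::field mpol set)"
  shows "1 \<notin> I"
proof
  assume "1 \<in> I"
  have I: "ideal I (poly_ring r)" and dim: "ring.dimension (quot_alg r I) 1 (base_field r I) (socle r I)"
    using assms by (auto simp: artinian_gorenstein_def homogeneous_ideal_def)
  interpret A: ring "quot_alg r I" unfolding quot_alg_def by (rule ideal.quotient_is_ring[OF I])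
  have mem: "x \<in> I" if "x \<in> poly_carrier r" for x
    using ideal.I_l_closed[OF I \<open>1 \<in> I\<close>, of x] that by simp
  from dim obtain v E where v: "v \<in> carrier (quot_alg r I)" "v \<notin> E"
      "A.dimension 0 (base_field r I) E"
    by (cases rule: A.dimension.cases) auto
  have "E = {\<zero>\<^bsub>quot_alg r I\<^esub>}" using v(3) by (cases rule: A.dimension.cases) auto
  then have "v \<noteq> I" using v(2) by (simp add: quot_alg_def FactRing_def)
  moreover obtain x where "x \<in> poly_carrier r" "v = I +>\<^bsub>poly_ring r\<^esub> x"
    using v(1) by (auto simp: quot_alg_def FactRing_def A_RCOSETS_def')
  moreover have "I +>\<^bsub>poly_ring r\<^esub> x = I" if "x \<in> poly_carrier r" for x
    using ring.quotient_eq_iff_same_a_r_cos[OF ideal.axioms(2)[OF I] I, of x 0] that mem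
      abelian_group.a_coset_add_zero[of "poly_ring r" I] ideal.Icarr[OF I] ideal.axioms(2)[OF I]
    by (simp add: a_minus_poly_ring ring_def abelian_group_def subset_iff)
  ultimately show False by simp
qed

locale gorenstein_quotient = graded_quotient r I for r and I :: "'k::field mpol set" +
  fixes e :: nat
  assumes gor: "artinian_gorenstein r I"
    and top: "hilbert_function r I e \<noteq> 0" and above: "\<And>i. i > e \<Longrightarrow> hilbert_function r I i = 0"
begin

lemma forms_above: "i > e \<Longrightarrow> p \<in> forms r i \<Longrightarrow> p \<in> I"
  using above[of i] by (auto simp: hilbert_function_std elim!: std_reduction)

lemma forms_top_in_socle: "p \<in> forms r e \<Longrightarrow> p \<in> socle_poly"
  by (rule forms_in_socle[of e]) (rule forms_above)

text \<open>Forms of degree \<open>e\<close> lie in the socle, which is a line; hence any one of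
  them outside \<open>I\<close> spans it.\<close>

lemma obtain_top:
  obtains w where "w \<in> forms r e" "w \<notin> I" "\<And>p. p \<in> socle_poly \<Longrightarrow> \<exists>c. p - scal c w \<in> I"
proof -
  obtain m where m: "m \<in> std e" using top by (auto simp: hilbert_function_std)
  define w where "w = (Poly_Mapping.single m 1 :: 'k mpol)"
  have w: "w \<in> forms r e" using m std_subset by (auto simp: w_def intro: single_in_forms)
  have wI: "w \<notin> I"
  proof
    assume "w \<in> I"
    from std_reduced[OF this, of e] m have "w = 0" by (simp add: w_def)
    then have "Poly_Mapping.lookup w m = 0" by simp
    then show False by (simp add: w_def)
  qed
  have "A.dimension 1 K (rc ` socle_poly)"
    using gor by (simp add: artinian_gorenstein_def socle_eq)
  then obtain p0 where p0: "basis_mod socle_poly {..<1::nat} p0"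
    by (rule dimension_imp_basis_mod[rotated]) (auto simp: socle_poly_def)
  have line: "\<exists>c. p - scal c (p0 0) \<in> I" if "p \<in> socle_poly" for p
    using p0 that by (fastforce simp: basis_mod_def)
  \<comment> \<open>The spanning vector \<open>p0 0\<close> need not be a form. It is traded for
    \<open>w\<close>, a nonzero multiple of it modulo \<open>I\<close>.\<close>
  obtain c0 where c0: "w - scal c0 (p0 0) \<in> I" using line[OF forms_top_in_socle[OF w]] by blast
  have "c0 \<noteq> 0" using c0 wI by auto
  have "\<exists>c. p - scal c w \<in> I" if p: "p \<in> socle_poly" for p
  proof -
    obtain c where c: "p - scal c (p0 0) \<in> I" using line[OF p] by blast
    have "(p - scal c (p0 0)) - scal (c / c0) (w - scal c0 (p0 0)) = p - scal (c / c0) w"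
      using \<open>c0 \<noteq> 0\<close> by (simp add: right_diff_distrib mult.assoc[symmetric] mult_single)
    then show ?thesis using minus_mem[OF c scal_mem[OF c0, of "c / c0"]] by metis
  qed
  with w wI show ?thesis by (rule that)
qed

text \<open>The socle is spanned by a form of degree \<open>e\<close>, so a form of lower degree
  outside \<open>I\<close> is not in it. Some variable then fails to annihilate \<open>p\<close>,
  and the product is one degree closer to the top.\<close>

lemma pairing_nondegenerate:
  assumes "i \<le> e" "p \<in> forms r i" "p \<notin> I"
  shows "\<exists>q\<in>forms r (e - i). p * q \<notin> I"
  using assms
proof (induction "e - i" arbitrary: i p)
  case 0
  then show ?case by (intro bexI[of _ 1]) (auto simp: forms_eq)
next
  case (Suc n)
  obtain w where w: "w \<in> forms r e" "w \<notin> I" "\<And>p. p \<in> socle_poly \<Longrightarrow> \<exists>c. p - scal c w \<in> I"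
    by (rule obtain_top) blast
  have "p \<notin> socle_poly"
  proof
    assume "p \<in> socle_poly"
    then obtain c where "p - scal c w \<in> I" using w(3) by blast
    moreover have "i \<noteq> e" using Suc.hyps(2) by simp
    ultimately have "p \<in> I"
      using hom_part_mem[of "p - scal c w" i] Suc.prems(2) w(1)
      by (simp add: hom_part_minus hom_part_scal hom_part_forms[of _ r i] hom_part_forms[of _ r e] when_def)
    then show False using Suc.prems by simp
  qed
  then obtain b where b: "b \<in> poly_carrier r" "Poly_Mapping.lookup b 0 = 0" "p * b \<notin> I"
    using Suc.prems(2) forms_carrier by (auto simp: socle_poly_def)
  \<comment> \<open>Every monomial of \<open>b\<close> is divisible by a variable; if all variables
    annihilated \<open>p\<close>, so would \<open>b\<close>.\<close>
  have "\<exists>x<r. p * Poly_Mapping.single (Poly_Mapping.single x 1) 1 \<notin> I"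
  proof (rule ccontr)
    assume "\<not> ?thesis"
    then have x: "p * Poly_Mapping.single (Poly_Mapping.single x 1) 1 \<in> I" if "x < r" for x using that by blast
    have "p * Poly_Mapping.single m 1 \<in> I" if m: "m \<in> Poly_Mapping.keys b" for m
    proof -
      have "m \<noteq> 0" using m b(2) by (auto simp: in_keys_iff)
      then obtain d where d: "mono_degree m = Suc d"
        by (metis mono_degree_eq_0_iff not0_implies_Suc)
      then have "m \<in> monomials r (Suc d)" using m b(1) by (auto simp: monomials_def poly_carrier_def)
      then obtain x m' where x': "x < r" "m' \<in> monomials r d" "m = m' + Poly_Mapping.single x 1"
        by (rule monomials_Suc_split)
      have "p * Poly_Mapping.single m 1 = Poly_Mapping.single m' 1 * (p * Poly_Mapping.single (Poly_Mapping.single x 1) 1)"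
        using mult_single[of m' "1 :: 'k" "Poly_Mapping.single x 1" 1] by (simp add: x'(3) mult_ac)
      then show ?thesis
        using mult_mem[OF x[OF x'(1)] forms_carrier[OF single_in_forms[OF x'(2), of 1]]] by (simp only:)
    qed
    then have "(\<Sum>m\<in>Poly_Mapping.keys b. scal (Poly_Mapping.lookup b m) (p * Poly_Mapping.single m 1)) \<in> I"
      by (intro sum_mem scal_mem)
    also have "(\<Sum>m\<in>Poly_Mapping.keys b. scal (Poly_Mapping.lookup b m) (p * Poly_Mapping.single m 1)) = p * b"
      using arg_cong[OF scal_sum_single[of b "Poly_Mapping.keys b"], of "(*) p"]
      by (simp add: sum_distrib_left mult_ac)
    finally show False using b(3) by simp
  qed
  then obtain x where x: "x < r" "p * Poly_Mapping.single (Poly_Mapping.single x 1) 1 \<notin> I" by blast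
  let ?X = "Poly_Mapping.single (Poly_Mapping.single x 1) 1 :: 'k mpol"
  have X: "?X \<in> forms r 1" using x(1) by (auto simp: monomials_def intro!: single_in_forms)
  have "\<exists>q\<in>forms r (e - Suc i). (p * ?X) * q \<notin> I"
    using Suc.hyps Suc.prems x(2) forms_mult[OF Suc.prems(2) X] by (intro Suc.hyps(1)) auto
  then obtain q where q: "q \<in> forms r (e - Suc i)" "(p * ?X) * q \<notin> I" by blast
  have "e - i = 1 + (e - Suc i)" using Suc.hyps(2) by simp
  then show ?case using forms_mult[OF X q(1)] q(2) by (intro bexI[of _ "?X * q"]) (auto simp: mult.assoc)
qed

text \<open>If degree \<open>i\<close> had the larger dimension, some nonzero \<open>p\<close> in it
  would be orthogonal to all of degree \<open>e - i\<close> under the pairing into the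
  one-dimensional top, against nondegeneracy.\<close>

lemma card_std_le:
  assumes "i \<le> e"
  shows "card (std i) \<le> card (std (e - i))"
proof (rule ccontr)
  assume "\<not> ?thesis"
  then have less: "card (std (e - i)) < card (std i)" by simp
  obtain w where w: "w \<in> forms r e" "w \<notin> I" "\<And>p. p \<in> socle_poly \<Longrightarrow> \<exists>c. p - scal c w \<in> I"
    by (rule obtain_top) blast
  have "\<forall>p\<in>forms r e. \<exists>c. p - scal c w \<in> I" using w(3) forms_top_in_socle by blast
  \<comment> \<open>\<open>\<kappa>\<close> is the coordinate of a top form relative to
    \<open>w\<close>, modulo \<open>I\<close>.\<close>
  then obtain \<kappa> where \<kappa>: "\<And>p. p \<in> forms r e \<Longrightarrow> p - scal (\<kappa> p) w \<in> I" by metis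
  let ?x = "\<lambda>m. Poly_Mapping.single m 1 :: 'k mpol"
  obtain c where c: "\<exists>u\<in>std i. c u \<noteq> 0" "\<forall>v\<in>std (e - i). (\<Sum>u\<in>std i. c u * \<kappa> (?x u * ?x v)) = 0"
    using exists_nontrivial_solution[of "std (e - i)" "std i" "\<lambda>u v. \<kappa> (?x u * ?x v)"] less by auto
  define p where "p = (\<Sum>u\<in>std i. scal (c u) (?x u))"
  have pI: "p \<notin> I" using basis_mod_std[of i] c(1) unfolding basis_mod_def p_def by blast
  have x_forms: "?x u \<in> forms r d" if "u \<in> std d" for u d
    using that std_subset by (auto intro: single_in_forms)
  have p: "p \<in> forms r i" unfolding p_def by (intro forms_sum forms_scal x_forms)
  have pv: "p * ?x v \<in> I" if v: "v \<in> std (e - i)" for v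
  proof -
    have "?x u * ?x v \<in> forms r e" if "u \<in> std i" for u
      using forms_mult[OF x_forms[OF that] x_forms[OF v]] assms by simp
    then have "(\<Sum>u\<in>std i. scal (c u) (?x u * ?x v - scal (\<kappa> (?x u * ?x v)) w)) \<in> I"
      by (intro sum_mem scal_mem \<kappa>)
    also have "(\<Sum>u\<in>std i. scal (c u) (?x u * ?x v - scal (\<kappa> (?x u * ?x v)) w))
      = (\<Sum>u\<in>std i. scal (c u) (?x u) * ?x v) - (\<Sum>u\<in>std i. scal (c u * \<kappa> (?x u * ?x v)) w)"
      by (simp add: right_diff_distrib sum_subtractf mult.assoc[symmetric] mult_single)
    also have "(\<Sum>u\<in>std i. scal (c u * \<kappa> (?x u * ?x v)) w) = scal (\<Sum>u\<in>std i. c u * \<kappa> (?x u * ?x v)) w"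
      by (rule poly_mapping_eqI) (simp add: lookup_sum sum_distrib_right)
    also have "\<dots> = 0" using c(2) v by simp
    finally show ?thesis by (simp add: p_def sum_distrib_right)
  qed
  obtain q where q: "q \<in> forms r (e - i)" "p * q \<notin> I" using pairing_nondegenerate[OF assms p pI] by blast
  obtain d where d: "q - (\<Sum>v\<in>std (e - i). scal (d v) (?x v)) \<in> I"
    using basis_mod_std[of "e - i"] q(1) unfolding basis_mod_def by blast
  have "p * (q - (\<Sum>v\<in>std (e - i). scal (d v) (?x v))) \<in> I"
    using d p by (intro mult_mem) (auto intro: forms_carrier)
  moreover have "(\<Sum>v\<in>std (e - i). scal (d v) (p * ?x v)) \<in> I" by (intro sum_mem scal_mem pv)
  ultimately have "p * (q - (\<Sum>v\<in>std (e - i). scal (d v) (?x v))) + (\<Sum>v\<in>std (e - i). scal (d v) (p * ?x v)) \<in> I"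
    by (rule add_mem)
  also have "p * (q - (\<Sum>v\<in>std (e - i). scal (d v) (?x v))) + (\<Sum>v\<in>std (e - i). scal (d v) (p * ?x v)) = p * q"
    by (simp add: right_diff_distrib sum_distrib_left mult_ac)
  finally show False using q(2) by simp
qed

lemma hilbert_function_symmetric: "i \<le> e \<Longrightarrow> hilbert_function r I (e - i) = hilbert_function r I i"
  using card_std_le[of i] card_std_le[of "e - i"] by (simp add: hilbert_function_std)

lemma hilbert_function_0: "hilbert_function r I 0 = 1"
proof -
  have "card (std 0) \<le> 1" using card_mono[OF _ std_subset[of 0]] by simp
  moreover have "hilbert_function r I 0 = hilbert_function r I e"
    using hilbert_function_symmetric[of e] by simp
  ultimately show ?thesis using top unfolding hilbert_function_std by linarith
qed

end

section \<open>Growth of order ideals\<close>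

definition level :: "'a list set \<Rightarrow> nat \<Rightarrow> 'a list set" where
  "level T d = {xs \<in> T. length xs = d}"

text \<open>A weak form of Macaulay's theorem, for words instead of monomials. The links of letters reduce
  the length by one, and each link is bounded both by induction and by the whole level.\<close>

lemma card_level_power_le:
  fixes T :: "'a list set"
  assumes "\<And>xs x ys. xs @ x # ys \<in> T \<Longrightarrow> xs @ ys \<in> T" "\<And>d. finite (level T d)" "T \<noteq> {}"
  shows "card (level T (Suc d)) ^ d \<le> card (level T d) ^ Suc d"
  using assms
proof (induction d arbitrary: T)
  case 0
  obtain xs where "xs \<in> T" using \<open>T \<noteq> {}\<close> by blast
  then have "[] \<in> T"
  proof (induction xs)
    case (Cons x xs)
    then show ?case using "0.prems"(1)[of "[]" x xs] by simp
  qed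
  then have "level T 0 = {[]}" by (auto simp: level_def)
  then show ?case by simp
next
  case (Suc d)
  define V where "V = {v. [v] \<in> T}"
  define L where "L v = {xs. v # xs \<in> T}" for v
  have "V = hd ` level T 1" by (force simp: V_def level_def length_Suc_conv image_iff)
  then have finV: "finite V" using Suc.prems(2) by simp
  have L_closed: "xs @ ys \<in> L v" if "xs @ x # ys \<in> L v" for v xs x ys
    using Suc.prems(1)[of "v # xs" x ys] that by (simp add: L_def)
  have L_sub: "L v \<subseteq> T" for v using Suc.prems(1)[of "[]" v] by (auto simp: L_def)
  have finL: "finite (level (L v) k)" for v k
    by (rule finite_subset[OF _ Suc.prems(2)[of k]]) (use L_sub in \<open>auto simp: level_def\<close>)
  have V_if: "v \<in> V" if "v # xs \<in> T" for v xs
    using that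
  proof (induction xs)
    case (Cons x xs)
    then show ?case using Suc.prems(1)[of "[v]" x xs] by simp
  qed (simp add: V_def)
  have split: "card (level T (Suc k)) = (\<Sum>v\<in>V. card (level (L v) k))" for k
  proof -
    have "level T (Suc k) = (\<Union>v\<in>V. (#) v ` level (L v) k)"
    proof (intro equalityI subsetI)
      fix ys assume ys: "ys \<in> level T (Suc k)"
      then obtain v xs where "ys = v # xs" by (cases ys) (auto simp: level_def)
      then show "ys \<in> (\<Union>v\<in>V. (#) v ` level (L v) k)"
        using ys V_if[of v xs] by (auto simp: level_def L_def)
    qed (auto simp: level_def L_def)
    then have "card (level T (Suc k)) = (\<Sum>v\<in>V. card ((#) v ` level (L v) k))"
      by (simp only:) (rule card_UN_disjoint, use finV finL in auto)
    then show ?thesis by (simp add: card_image)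
  qed
  define B where "B = card (level T (Suc d))"
  \<comment> \<open>Let \<open>a\<close> and \<open>b\<close> be the sizes of levels
    \<open>d + 1\<close> and \<open>d\<close> of the link. Multiplying the induction hypothesis
    \<open>a ^ d \<le> b ^ (d + 1)\<close> by \<open>a \<le> B\<close> and taking the root of order
    \<open>d + 1\<close> gives a bound linear in \<open>b\<close>, which can be summed over the
    letters.\<close>
  have le: "real (card (level (L v) (Suc d))) \<le> real (card (level (L v) d)) * root (Suc d) B" if "v \<in> V" for v
  proof -
    have "card (level (L v) (Suc d)) \<le> B"
      unfolding B_def by (rule card_mono[OF Suc.prems(2)]) (use L_sub in \<open>auto simp: level_def\<close>)
    moreover have "L v \<noteq> {}" using that by (auto simp: V_def L_def)
    then have "card (level (L v) (Suc d)) ^ d \<le> card (level (L v) d) ^ Suc d"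
      using Suc.IH[of "L v"] L_closed finL by blast
    ultimately have "card (level (L v) (Suc d)) ^ Suc d \<le> B * card (level (L v) d) ^ Suc d"
      by (simp add: mult_le_mono)
    then have "real (card (level (L v) (Suc d))) ^ Suc d \<le> real B * real (card (level (L v) d)) ^ Suc d"
      by (metis of_nat_le_iff of_nat_mult of_nat_power)
    then have "root (Suc d) (real (card (level (L v) (Suc d))) ^ Suc d)
        \<le> root (Suc d) (real B * real (card (level (L v) d)) ^ Suc d)"
      by (subst real_root_le_iff) auto
    then show ?thesis
      by (simp add: real_root_mult real_root_power_cancel mult.commute del: power_Suc)
  qed
  have "real (card (level T (Suc (Suc d)))) \<le> (\<Sum>v\<in>V. real (card (level (L v) d)) * root (Suc d) B)"
    unfolding split[of "Suc d"] of_nat_sum by (rule sum_mono[OF le])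
  also have "\<dots> = real B * root (Suc d) B"
    by (simp add: B_def split[of d] sum_distrib_right)
  finally have "real (card (level T (Suc (Suc d)))) ^ Suc d \<le> (real B * root (Suc d) B) ^ Suc d"
    by (rule power_mono) simp
  also have "\<dots> = real B ^ Suc d * real B"
    by (simp add: power_mult_distrib real_root_pow_pos2 del: power_Suc)
  finally have "real (card (level T (Suc (Suc d))) ^ Suc d) \<le> real (B ^ Suc (Suc d))"
    by (simp add: mult_ac)
  then show ?case unfolding B_def by (simp only: of_nat_le_iff)
qed

section \<open>Words that spell a monomial\<close>

definition list_mono :: "nat list \<Rightarrow> mono" where
  "list_mono xs = (\<Sum>x\<leftarrow>xs. Poly_Mapping.single x 1)"

lemma list_mono_simps [simp]:
  "list_mono [] = 0" "list_mono (x # xs) = Poly_Mapping.single x 1 + list_mono xs"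
  "list_mono (xs @ ys) = list_mono xs + list_mono ys"
  by (simp_all add: list_mono_def)

lemma mono_degree_list_mono [simp]: "mono_degree (list_mono xs) = length xs"
  by (induction xs) auto

lemma keys_list_mono [simp]: "Poly_Mapping.keys (list_mono xs) = set xs"
  by (induction xs) (auto simp: keys_add_mono)

lemma lookup_list_mono: "Poly_Mapping.lookup (list_mono xs) x = count (mset xs) x"
  by (induction xs) (auto simp: lookup_add lookup_single when_def)

lemma list_mono_eq_iff: "list_mono xs = list_mono ys \<longleftrightarrow> mset xs = mset ys"
  by (auto simp: poly_mapping_eq_iff multiset_eq_iff fun_eq_iff lookup_list_mono)

lemma obtain_list_mono:
  assumes "m \<in> monomials r d"
  obtains xs where "list_mono xs = m" "set xs \<subseteq> {..<r}" "length xs = d"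
proof -
  have "\<exists>xs. list_mono xs = m"
    using assms
  proof (induction d arbitrary: m)
    case 0
    then show ?case by (intro exI[of _ "[]"]) simp
  next
    case (Suc d)
    then obtain x m' where "m' \<in> monomials r d" "m = m' + Poly_Mapping.single x 1"
      by (elim monomials_Suc_split)
    then obtain xs where "list_mono xs = m'" using Suc.IH by blast
    then show ?case using \<open>m = _\<close> by (intro exI[of _ "x # xs"]) (simp add: add.commute)
  qed
  then obtain xs where xs: "list_mono xs = m" by blast
  have "set xs \<subseteq> {..<r}" "length xs = d"
    using assms unfolding xs[symmetric] monomials_def by auto
  with xs show ?thesis by (rule that)
qed

text \<open>The words are the arrangements of a multiset: \<open>d!\<close> over the product of the
  factorials of the exponents.\<close>

lemma card_list_mono_fibre:
  assumes "m \<in> monomials r d"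
  shows "finite {xs. list_mono xs = m}" "card {xs. list_mono xs = m} \<le> fact d"
    "(\<And>x. Poly_Mapping.lookup m x \<le> 1) \<Longrightarrow> card {xs. list_mono xs = m} = fact d"
proof -
  obtain ys where ys: "list_mono ys = m" "length ys = d" using assms by (rule obtain_list_mono)
  have eq: "{xs. list_mono xs = m} = permutations_of_multiset (mset ys)"
    unfolding ys(1)[symmetric] list_mono_eq_iff permutations_of_multiset_def ..
  show "finite {xs. list_mono xs = m}" unfolding eq by simp
  have card: "card {xs. list_mono xs = m} = fact d div (\<Prod>x\<in>set ys. fact (count (mset ys) x))"
    unfolding eq using ys(2) by (simp add: card_permutations_of_multiset)
  show "card {xs. list_mono xs = m} \<le> fact d" unfolding card by (rule div_le_dividend)
  assume sqf: "\<And>x. Poly_Mapping.lookup m x \<le> 1"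
  have "fact (count (mset ys) x) = (1 :: nat)" for x
    using sqf[of x] fact_0 fact_1 unfolding ys(1)[symmetric] lookup_list_mono
    by (metis One_nat_def le_Suc_eq le_zero_eq)
  then show "card {xs. list_mono xs = m} = fact d" unfolding card by simp
qed

text \<open>A monomial with a repeated variable is spelled by a word whose first letter is doubled;
  the \<open>d - 1\<close> letters after the first determine it.\<close>

lemma card_non_squarefree_le:
  assumes "1 \<le> d"
  shows "card {m \<in> monomials r d. \<exists>x. \<not> Poly_Mapping.lookup m x \<le> 1} \<le> r ^ (d - 1)"
proof -
  let ?W = "{xs. set xs \<subseteq> {..<r} \<and> length xs = d - 1}"
  have "{m \<in> monomials r d. \<exists>x. \<not> Poly_Mapping.lookup m x \<le> 1} \<subseteq> (\<lambda>xs. list_mono (hd xs # xs)) ` ?W"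
  proof safe
    fix m x assume m: "m \<in> monomials r d" and x: "\<not> Poly_Mapping.lookup m x \<le> 1"
    obtain xs where xs: "list_mono xs = m" "set xs \<subseteq> {..<r}" "length xs = d"
      using m by (rule obtain_list_mono)
    have cnt: "2 \<le> count (mset xs) x" using x unfolding xs(1)[symmetric] lookup_list_mono by simp
    then have "{#x, x#} \<subseteq># mset xs" by (intro mset_subset_eqI) (auto simp: numeral_2_eq_2)
    then obtain M where "mset xs = {#x, x#} + M" by (auto simp: mset_subset_eq_exists_conv)
    moreover obtain ys where "M = mset ys" by (metis ex_mset)
    ultimately have ys: "mset xs = mset (x # x # ys)" by simp
    then have "set (x # x # ys) = set xs" "length (x # x # ys) = length xs"
      by (metis set_mset_mset, metis size_mset)
    moreover have "list_mono (hd (x # ys) # (x # ys)) = m"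
      using ys xs(1) list_mono_eq_iff[of xs "x # x # ys"] by simp
    ultimately show "m \<in> (\<lambda>xs. list_mono (hd xs # xs)) ` ?W"
      using xs by (intro image_eqI[of _ _ "x # ys"]) auto
  qed
  moreover have "finite ?W" "card ?W = r ^ (d - 1)"
    using card_lists_length_eq[of "{..<r}" "d - 1"] finite_lists_length_eq[of "{..<r}" "d - 1"] by auto
  ultimately show ?thesis by (metis (no_types, lifting) card_image_le card_mono finite_imageI order_trans)
qed

lemma (in graded_quotient) hilbert_function_growth:
  obtains t :: "nat \<Rightarrow> nat" where
    "\<And>d. t d \<le> fact d * hilbert_function r I d"
    "\<And>d. 1 \<le> d \<Longrightarrow> fact d * hilbert_function r I d \<le> t d + fact d * r ^ (d - 1)"
    "\<And>d. 1 \<le> d \<Longrightarrow> t (Suc d) ^ d \<le> t d ^ Suc d"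
    "t 1 \<le> r"
proof -
  define T where "T = {xs. list_mono xs \<in> std (length xs)}"
  have level: "level T d = (\<Union>m\<in>std d. {xs. list_mono xs = m})" for d
  proof -
    have "length xs = d" if "list_mono xs \<in> std d" for xs
      using that std_subset[of d] mono_degree_list_mono[of xs] unfolding monomials_def by auto
    then show ?thesis by (auto simp: level_def T_def)
  qed
  have card: "card (level T d) = (\<Sum>m\<in>std d. card {xs. list_mono xs = m})" for d
    unfolding level using std_subset[of d] card_list_mono_fibre(1)[of _ r d]
    by (intro card_UN_disjoint) auto
  have fin: "finite (level T d)" for d
    unfolding level using std_subset[of d] card_list_mono_fibre(1)[of _ r d]
    by (intro finite_UN_I finite_std) auto
  \<comment> \<open>Deleting a letter in any position divides the monomial by one variable, so
    \<open>std_divisor\<close> applies.\<close>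
  have closed: "xs @ ys \<in> T" if "xs @ x # ys \<in> T" for xs x ys
    using that std_divisor[of "list_mono (xs @ ys)" x "length (xs @ ys)"]
    by (simp add: T_def add_ac)
  have "card (level T d) \<le> fact d * hilbert_function r I d" for d
  proof -
    have "card (level T d) \<le> (\<Sum>m\<in>std d. fact d)"
      unfolding card using std_subset[of d] card_list_mono_fibre(2)[of _ r d] by (intro sum_mono) auto
    then show ?thesis by (simp add: hilbert_function_std mult.commute)
  qed
  moreover have "fact d * hilbert_function r I d \<le> card (level T d) + fact d * r ^ (d - 1)" if "1 \<le> d" for d
  proof -
    let ?N = "{m \<in> monomials r d. \<exists>x. \<not> Poly_Mapping.lookup m x \<le> 1}"
    have "card (std d) \<le> card (std d - ?N) + card ?N"
      by (rule order_trans[OF card_mono card_Un_le]) auto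
    also have "\<dots> \<le> card (std d - ?N) + r ^ (d - 1)" using card_non_squarefree_le[OF that] by simp
    finally have "fact d * card (std d) \<le> fact d * (card (std d - ?N) + r ^ (d - 1))"
      by (rule mult_le_mono2)
    then have "fact d * card (std d) \<le> fact d * card (std d - ?N) + fact d * r ^ (d - 1)"
      by (simp only: distrib_left)
    also have "fact d * card (std d - ?N) = (\<Sum>m\<in>std d - ?N. card {xs. list_mono xs = m})"
      using std_subset[of d] card_list_mono_fibre(3)[of _ r d] by (subst sum.cong[OF refl, of _ _ "\<lambda>_. fact d"]) auto
    also have "\<dots> \<le> card (level T d)"
      unfolding card by (intro sum_mono2) auto
    finally show ?thesis by (simp add: hilbert_function_std)
  qed
  moreover have "card (level T (Suc d)) ^ d \<le> card (level T d) ^ Suc d" if "1 \<le> d" for d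
  proof (cases "T = {}")
    case True
    then show ?thesis using that by (simp add: level_def)
  next
    case False
    then show ?thesis using card_level_power_le[of T d] closed fin by blast
  qed
  moreover have "card (level T 1) \<le> r"
  proof -
    have "level T 1 \<subseteq> {xs. set xs \<subseteq> {..<r} \<and> length xs = 1}"
      using std_subset[of 1] by (force simp: level_def T_def monomials_def)
    then have "card (level T 1) \<le> card {xs. set xs \<subseteq> {..<r} \<and> length xs = 1}"
      by (intro card_mono finite_lists_length_eq) auto
    then show ?thesis by (simp add: card_lists_length_eq)
  qed
  ultimately show ?thesis by (rule that[of "\<lambda>d. card (level T d)"])
qed

section \<open>Gorenstein algebras from simplicial complexes\<close>

context graded_quotient
begin

definition span_mod :: "'a set \<Rightarrow> ('a \<Rightarrow> 'k mpol) \<Rightarrow> 'k mpol set" where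
  "span_mod J p = {w. \<exists>c. w - (\<Sum>j\<in>J. scal (c j) (p j)) \<in> I}"

lemma span_mod_add:
  assumes "v \<in> span_mod J p" "w \<in> span_mod J p" shows "v + w \<in> span_mod J p"
proof -
  obtain c d where "v - (\<Sum>j\<in>J. scal (c j) (p j)) \<in> I" "w - (\<Sum>j\<in>J. scal (d j) (p j)) \<in> I"
    using assms by (auto simp: span_mod_def)
  from add_mem[OF this] have "v + w - (\<Sum>j\<in>J. scal (c j + d j) (p j)) \<in> I"
    by (simp add: single_add distrib_right sum.distrib algebra_simps)
  then show ?thesis unfolding span_mod_def mem_Collect_eq by (rule exI[of _ "\<lambda>j. c j + d j"])
qed

lemma span_mod_scal:
  assumes "v \<in> span_mod J p" shows "scal a v \<in> span_mod J p"
proof -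
  obtain c where "v - (\<Sum>j\<in>J. scal (c j) (p j)) \<in> I" using assms by (auto simp: span_mod_def)
  from scal_mem[OF this, of a] have "scal a v - (\<Sum>j\<in>J. scal (a * c j) (p j)) \<in> I"
    by (simp add: right_diff_distrib sum_distrib_left mult.assoc[symmetric] mult_single)
  then show ?thesis unfolding span_mod_def mem_Collect_eq by (rule exI[of _ "\<lambda>j. a * c j"])
qed

lemma span_mod_mem: "v \<in> I \<Longrightarrow> v \<in> span_mod J p"
  unfolding span_mod_def by (auto intro!: exI[of _ "\<lambda>_. 0"])

lemma span_mod_sum: "(\<And>i. i \<in> A \<Longrightarrow> f i \<in> span_mod J p) \<Longrightarrow> sum f A \<in> span_mod J p"
  by (induction A rule: infinite_finite_induct) (auto intro: span_mod_add span_mod_mem zero_mem)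

lemma span_mod_congruent:
  assumes "finite J" "j \<in> J" "v - p j \<in> I" shows "v \<in> span_mod J p"
proof -
  have "(\<Sum>i\<in>J. scal (if i = j then 1 else 0) (p i)) = p j"
    using assms(1,2) by (simp add: sum.remove[of J j])
  then show ?thesis using assms(3) unfolding span_mod_def by (auto intro!: exI[of _ "\<lambda>i. if i = j then 1 else 0"])
qed

lemma span_mod_monomials:
  assumes "finite X" "Poly_Mapping.keys w \<subseteq> X" "\<And>m. m \<in> X \<Longrightarrow> Poly_Mapping.single m 1 \<in> span_mod J p"
  shows "w \<in> span_mod J p"
  by (subst scal_sum_single[OF assms(2,1)]) (intro span_mod_sum span_mod_scal assms(3))

lemma span_mod_finite_dimension:
  assumes W: "W \<subseteq> poly_carrier r" "0 \<in> W" "\<And>p q. p \<in> W \<Longrightarrow> q \<in> W \<Longrightarrow> p + q \<in> W"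
    "\<And>c p. p \<in> W \<Longrightarrow> scal c p \<in> W"
    and "finite J" "\<And>j. j \<in> J \<Longrightarrow> p j \<in> W" "W \<subseteq> span_mod J p"
  shows "A.finite_dimension K (rc ` W)"
proof -
  obtain xs where xs: "set xs = J" "distinct xs" using \<open>finite J\<close> by (metis finite_distinct_list)
  have bij: "bij_betw ((!) xs) {..<length xs} J" by (rule bij_betw_nth[OF xs(2)]) (auto simp: xs(1))
  define ps where "ps = map p xs"
  have psW: "set ps \<subseteq> W" using assms(6) by (auto simp: ps_def xs)
  have "A.Span K (map rc ps) = rc ` W"
  proof (rule Span_rc[OF W psW])
    fix w assume "w \<in> W"
    then obtain c where "w - (\<Sum>j\<in>J. scal (c j) (p j)) \<in> I" using assms(7) by (auto simp: span_mod_def)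
    moreover have "(\<Sum>j\<in>J. scal (c j) (p j)) = (\<Sum>j<length ps. scal (c (xs ! j)) (ps ! j))"
      using sum.reindex_bij_betw[OF bij, of "\<lambda>j. scal (c j) (p j)"] by (simp add: ps_def)
    ultimately show "\<exists>c. w - (\<Sum>j<length ps. scal (c j) (ps ! j)) \<in> I"
      by (intro exI[of _ "\<lambda>j. c (xs ! j)"]) simp
  qed
  moreover have "set (map rc ps) \<subseteq> carrier (quot_alg r I)" using psW W(1) by auto
  ultimately show ?thesis using A.Span_finite_dimension[OF subfield_K, of "map rc ps"] by simp
qed

end

text \<open>Evaluation at the 0/1 vector with support \<open>\<sigma>\<close>.\<close>

definition ev :: "nat set \<Rightarrow> 'k::field mpol \<Rightarrow> 'k" where
  "ev \<sigma> p = (\<Sum>m\<in>Poly_Mapping.keys p. (Poly_Mapping.lookup p m when Poly_Mapping.keys m \<subseteq> \<sigma>))"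

lemma ev_superset:
  "finite X \<Longrightarrow> Poly_Mapping.keys p \<subseteq> X \<Longrightarrow>
    ev \<sigma> p = (\<Sum>m\<in>X. (Poly_Mapping.lookup p m when Poly_Mapping.keys m \<subseteq> \<sigma>))"
  unfolding ev_def by (intro sum.mono_neutral_left) (auto simp: in_keys_iff when_def)

lemma ev_zero [simp]: "ev \<sigma> 0 = 0" by (simp add: ev_def)

lemma ev_add: "ev \<sigma> (p + q) = ev \<sigma> p + ev \<sigma> q"
proof -
  let ?X = "Poly_Mapping.keys p \<union> Poly_Mapping.keys q"
  have "ev \<sigma> (p + q) = (\<Sum>m\<in>?X. (Poly_Mapping.lookup (p + q) m when Poly_Mapping.keys m \<subseteq> \<sigma>))"
    using Poly_Mapping.keys_add[of p q] by (intro ev_superset) auto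
  also have "\<dots> = ev \<sigma> p + ev \<sigma> q"
    by (simp add: ev_superset[of ?X p] ev_superset[of ?X q] lookup_add when_add_distrib sum.distrib)
  finally show ?thesis .
qed

lemma ev_scal: "ev \<sigma> (scal c p) = c * ev \<sigma> p"
  by (subst ev_superset[OF _ keys_scal]) (auto simp: ev_def sum_distrib_left mult_when)

lemma ev_sum: "ev \<sigma> (sum f A) = (\<Sum>i\<in>A. ev \<sigma> (f i))"
  by (induction A rule: infinite_finite_induct) (auto simp: ev_add)

lemma ev_minus: "ev \<sigma> (p - q) = ev \<sigma> p - ev \<sigma> q"
  using ev_add[of \<sigma> "p - q" q] by simp

lemma ev_single: "ev \<sigma> (Poly_Mapping.single m c) = (c when Poly_Mapping.keys m \<subseteq> \<sigma>)"
  by (simp add: ev_def)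

text \<open>A monomial has value 1 or 0 according to its support, and the support of a product of
  monomials is the union of the supports; the rest is bilinearity.\<close>

lemma ev_mult: "ev \<sigma> (p * q) = ev \<sigma> p * ev \<sigma> q"
proof -
  let ?x = "\<lambda>m. Poly_Mapping.single m 1 :: 'a mpol"
  have single: "ev \<sigma> (?x m * ?x n) = ev \<sigma> (?x m) * ev \<sigma> (?x n)" for m n
    by (simp add: mult_single ev_single keys_add_mono when_def)
  have "ev \<sigma> (?x m * q) = ev \<sigma> (?x m) * ev \<sigma> q" for m
  proof -
    have q: "q = (\<Sum>n\<in>Poly_Mapping.keys q. scal (Poly_Mapping.lookup q n) (?x n))"
      by (rule scal_sum_single) auto
    have "?x m * q = (\<Sum>n\<in>Poly_Mapping.keys q. scal (Poly_Mapping.lookup q n) (?x m * ?x n))"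
      by (subst q) (simp add: sum_distrib_left mult.left_commute)
    then have "ev \<sigma> (?x m * q) = (\<Sum>n\<in>Poly_Mapping.keys q. ev \<sigma> (?x m) * (Poly_Mapping.lookup q n * ev \<sigma> (?x n)))"
      by (simp only: ev_sum ev_scal single) (simp only: mult.left_commute)
    also have "\<dots> = ev \<sigma> (?x m) * ev \<sigma> q"
      using arg_cong[where f = "ev \<sigma>", OF q] by (simp only: sum_distrib_left ev_sum ev_scal)
    finally show ?thesis .
  qed
  then show ?thesis
    by (subst (1 2) scal_sum_single[of p "Poly_Mapping.keys p"])
      (simp_all add: sum_distrib_right ev_sum ev_scal mult.assoc)
qed

text \<open>The points are the indicator vectors of the faces with a further coordinate 1, the homogenizing
  variable \<open>x\<^sub>r\<^sub>-\<^sub>1\<close>. The functional \<open>\<phi>\<close> is the sum of the values of the degree \<open>e\<close> part at these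
  points, and \<open>I\<close> is the annihilator of the corresponding dual socle generator.\<close>

locale complex_points =
  fixes r e s :: nat and \<Delta> :: "nat set set" and k :: "'k::field itself"
  assumes r: "1 \<le> r" and faces: "\<Delta> \<subseteq> Pow {..<r - 1}" and empty_face: "{} \<in> \<Delta>"
    and down: "\<And>\<sigma> \<tau>. \<sigma> \<in> \<Delta> \<Longrightarrow> \<tau> \<subseteq> \<sigma> \<Longrightarrow> \<tau> \<in> \<Delta>"
    and dim: "\<And>\<sigma>. \<sigma> \<in> \<Delta> \<Longrightarrow> card \<sigma> \<le> s" and e: "2 * s \<le> e"
begin

lemma finite_faces [simp]: "finite \<Delta>"
  using faces by (rule finite_subset) simp

lemma finite_face: "\<sigma> \<in> \<Delta> \<Longrightarrow> finite \<sigma>"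
  using faces finite_subset by blast

definition pt :: "nat set \<Rightarrow> nat set" where "pt \<sigma> = insert (r - 1) \<sigma>"

definition \<phi> :: "'k mpol \<Rightarrow> 'k" where "\<phi> p = (\<Sum>\<sigma>\<in>\<Delta>. ev (pt \<sigma>) (hom_part e p))"

text \<open>Testing each homogeneous part separately makes the annihilator visibly
  homogeneous.\<close>

definition I :: "'k mpol set" where
  "I = {p \<in> poly_carrier r. \<forall>d. \<forall>q\<in>poly_carrier r. \<phi> (hom_part d p * q) = 0}"

lemma \<phi>_zero [simp]: "\<phi> 0 = 0" by (simp add: \<phi>_def)
lemma \<phi>_add: "\<phi> (p + q) = \<phi> p + \<phi> q" by (simp add: \<phi>_def hom_part_add ev_add sum.distrib)
lemma \<phi>_minus: "\<phi> (p - q) = \<phi> p - \<phi> q" by (simp add: \<phi>_def hom_part_minus ev_minus sum_subtractf)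
lemma \<phi>_scal: "\<phi> (scal c p) = c * \<phi> p" by (simp add: \<phi>_def hom_part_scal ev_scal sum_distrib_left)
lemma \<phi>_sum: "\<phi> (sum f A) = (\<Sum>i\<in>A. \<phi> (f i))"
  by (induction A rule: infinite_finite_induct) (auto simp: \<phi>_add)

lemma form_mem_iff:
  assumes "p \<in> forms r i" shows "p \<in> I \<longleftrightarrow> (\<forall>q\<in>poly_carrier r. \<phi> (p * q) = 0)"
proof -
  have "(\<forall>d. \<forall>q\<in>poly_carrier r. \<phi> (hom_part d p * q) = 0) \<longleftrightarrow> (\<forall>q\<in>poly_carrier r. \<phi> (p * q) = 0)"
    by (auto simp: hom_part_forms[OF assms] when_def)
  then show ?thesis using forms_carrier[OF assms] by (simp add: I_def)
qed

lemma homogeneous: "homogeneous_ideal r I"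
  unfolding homogeneous_ideal_def
proof (intro conjI ballI allI)
  show "ideal I (poly_ring r)"
  proof (rule ideal_poly_ringI)
    fix p q :: "'k mpol" assume p: "p \<in> I" and q: "q \<in> poly_carrier r"
    have pS: "p \<in> poly_carrier r" using p by (simp add: I_def)
    have "\<phi> (hom_part d (q * p) * q') = 0" if q': "q' \<in> poly_carrier r" for d q'
    proof -
      obtain n where n: "\<And>m. m \<in> Poly_Mapping.keys p \<Longrightarrow> mono_degree m \<le> n"
        using obtain_degree_bound[of p 0] by blast
      have "q * p = (\<Sum>i\<le>n. hom_part i p * q)"
        using arg_cong[where f = "(*) q", OF sum_hom_part[OF n]] by (simp add: sum_distrib_left mult.commute)
      then have "hom_part d (q * p) * q' = (\<Sum>i\<le>n. hom_part d (hom_part i p * q) * q')"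
        by (simp add: hom_part_sum sum_distrib_right)
      moreover have "\<phi> (hom_part d (hom_part i p * q) * q') = 0" for i
      proof (cases "i \<le> d")
        case True
        have "\<phi> (hom_part i p * (hom_part (d - i) q * q')) = 0"
          using p q' forms_carrier[OF hom_part_in_forms[OF q]] by (auto simp: I_def intro!: carrier_mult)
        then show ?thesis using True
          by (simp add: hom_part_mult_form[OF hom_part_in_forms[OF pS] q] mult.assoc)
      qed (simp add: hom_part_mult_form[OF hom_part_in_forms[OF pS] q])
      ultimately show ?thesis by (simp add: \<phi>_sum)
    qed
    then show "q * p \<in> I" using pS q by (simp add: I_def carrier_mult)
  qed (auto simp: I_def hom_part_add distrib_right \<phi>_add carrier_add)
  fix p d assume "p \<in> I"
  then show "hom_part d p \<in> I"
    using form_mem_iff[OF hom_part_in_forms[of p r d]] unfolding I_def by blast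
qed

text \<open>The squarefree monomial of the face, padded to degree \<open>d\<close> by the
  homogenizing variable. The degree is \<open>d\<close> only if \<open>card \<tau> \<le> d\<close>,
  because the subtraction is truncated.\<close>

definition face_mono :: "nat set \<Rightarrow> nat \<Rightarrow> mono" where
  "face_mono \<tau> d = list_mono (sorted_list_of_set \<tau>) + Poly_Mapping.single (r - 1) (d - card \<tau>)"

lemma face_mono_monomials:
  assumes "\<tau> \<in> \<Delta>" "card \<tau> \<le> d" shows "face_mono \<tau> d \<in> monomials r d"
  using assms faces r finite_face[OF assms(1)]
  by (fastforce simp: face_mono_def monomials_def keys_add_mono)

text \<open>The homogenizing coordinate is 1 at every point, so padding does not change the value.
  The evaluation matrix is the inclusion matrix of the faces, unitriangular for inclusion and thus
  invertible over every field.\<close>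

lemma ev_face_mono:
  assumes "\<tau> \<in> \<Delta>" shows "ev (pt \<sigma>) (Poly_Mapping.single (face_mono \<tau> d) 1) = (1 when \<tau> \<subseteq> \<sigma>)"
proof -
  have "r - 1 \<notin> \<tau>" using assms faces by auto
  then have "Poly_Mapping.keys (face_mono \<tau> d) \<subseteq> pt \<sigma> \<longleftrightarrow> \<tau> \<subseteq> \<sigma>"
    using finite_face[OF assms] by (auto simp: face_mono_def keys_add_mono pt_def split: if_splits)
  then show ?thesis by (simp add: ev_single)
qed

lemma \<phi>_mult_forms:
  assumes "p \<in> forms r i" "q \<in> poly_carrier r" "i \<le> e"
  shows "\<phi> (p * q) = (\<Sum>\<sigma>\<in>\<Delta>. ev (pt \<sigma>) p * ev (pt \<sigma>) (hom_part (e - i) q))"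
  using assms by (simp add: \<phi>_def hom_part_mult_form[OF assms(1,2)] ev_mult)

text \<open>Evaluating at the faces containing a maximal face on which \<open>f\<close> does not vanish isolates one value.\<close>

lemma vanishing_if_orthogonal:
  fixes f :: "nat set \<Rightarrow> 'k"
  assumes orth: "\<And>\<tau>. \<tau> \<in> \<Delta> \<Longrightarrow> (\<Sum>\<sigma>\<in>\<Delta>. f \<sigma> * (1 when \<tau> \<subseteq> \<sigma>)) = 0" and "\<sigma> \<in> \<Delta>"
  shows "f \<sigma> = 0"
proof (rule ccontr)
  assume "f \<sigma> \<noteq> 0"
  then have "finite {\<sigma> \<in> \<Delta>. f \<sigma> \<noteq> 0}" "{\<sigma> \<in> \<Delta>. f \<sigma> \<noteq> 0} \<noteq> {}" using \<open>\<sigma> \<in> \<Delta>\<close> by auto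
  then obtain \<tau> where \<tau>: "\<tau> \<in> \<Delta>" "f \<tau> \<noteq> 0" and max: "\<And>\<sigma>. \<sigma> \<in> \<Delta> \<Longrightarrow> f \<sigma> \<noteq> 0 \<Longrightarrow> \<tau> \<subseteq> \<sigma> \<Longrightarrow> \<tau> = \<sigma>"
    using finite_has_maximal[of "{\<sigma> \<in> \<Delta>. f \<sigma> \<noteq> 0}"] by auto
  have "(\<Sum>\<sigma>\<in>\<Delta>. f \<sigma> * (1 when \<tau> \<subseteq> \<sigma>)) = (\<Sum>\<sigma>\<in>\<Delta>. if \<sigma> = \<tau> then f \<tau> else 0)"
    using max by (intro sum.cong) (auto simp: when_def)
  also have "\<dots> = f \<tau>" using \<tau>(1) by simp
  finally show False using orth[OF \<tau>(1)] \<tau>(2) by simp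
qed

text \<open>For \<open>i \<le> e - s\<close> the complementary degree \<open>e - i\<close> is at
  least \<open>s\<close>, so every face has a padded monomial in it. These monomials separate the
  points, hence in such degrees \<open>I\<close> is the vanishing ideal of the points.\<close>

lemma low_form_mem_iff:
  assumes p: "p \<in> forms r i" and i: "i \<le> e - s"
  shows "p \<in> I \<longleftrightarrow> (\<forall>\<sigma>\<in>\<Delta>. ev (pt \<sigma>) p = 0)"
proof
  assume "\<forall>\<sigma>\<in>\<Delta>. ev (pt \<sigma>) p = 0"
  then show "p \<in> I" using i by (simp add: form_mem_iff[OF p] \<phi>_mult_forms[OF p])
next
  assume pI: "p \<in> I"
  have "(\<Sum>\<sigma>\<in>\<Delta>. ev (pt \<sigma>) p * (1 when \<tau> \<subseteq> \<sigma>)) = 0" if \<tau>: "\<tau> \<in> \<Delta>" for \<tau>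
  proof -
    let ?q = "Poly_Mapping.single (face_mono \<tau> (e - i)) 1 :: 'k mpol"
    have "card \<tau> \<le> e - i" using dim[OF \<tau>] i e by linarith
    then have q: "?q \<in> forms r (e - i)" by (intro single_in_forms face_mono_monomials \<tau>)
    have "0 = \<phi> (p * ?q)" using pI forms_carrier[OF q] by (simp add: form_mem_iff[OF p])
    also have "\<dots> = (\<Sum>\<sigma>\<in>\<Delta>. ev (pt \<sigma>) p * (1 when \<tau> \<subseteq> \<sigma>))"
      using i by (simp add: \<phi>_mult_forms[OF p forms_carrier[OF q]] hom_part_forms[OF q] ev_face_mono[OF \<tau>])
    finally show ?thesis by simp
  qed
  then show "\<forall>\<sigma>\<in>\<Delta>. ev (pt \<sigma>) p = 0" using vanishing_if_orthogonal[of "\<lambda>\<sigma>. ev (pt \<sigma>) p"] by blast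
qed

lemma forms_above: "i > e \<Longrightarrow> p \<in> forms r i \<Longrightarrow> p \<in> I"
  by (simp add: form_mem_iff \<phi>_def hom_part_mult_form)

lemma top_form_mem_iff:
  assumes p: "p \<in> forms r e" shows "p \<in> I \<longleftrightarrow> \<phi> p = 0"
proof
  assume "p \<in> I"
  then show "\<phi> p = 0" using bspec[OF iffD1[OF form_mem_iff[OF p]], of 1] by simp
next
  assume \<phi>: "\<phi> p = 0"
  have "\<phi> (p * q) = 0" if q: "q \<in> poly_carrier r" for q
  proof -
    obtain c where c: "hom_part 0 q = Poly_Mapping.single 0 c"
      using forms_0[OF hom_part_in_forms[OF q]] by blast
    have "hom_part e (p * q) = scal c p"
      using hom_part_mult_form[OF p q, of e] by (simp add: c mult.commute)
    moreover have "hom_part e (scal c p) = scal c p" using hom_part_forms[OF forms_scal[OF p], of e] by simp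
    ultimately have "\<phi> (p * q) = \<phi> (scal c p)" by (simp only: \<phi>_def)
    then show ?thesis using \<phi> by (simp add: \<phi>_scal)
  qed
  then show "p \<in> I" by (simp add: form_mem_iff[OF p])
qed

text \<open>The monomial of a maximal face has value 1 at exactly one point, so the sum over the
  points is 1 in every characteristic.\<close>

lemma obtain_top_form:
  obtains w where "w \<in> forms r e" "\<phi> w = 1"
proof -
  obtain \<tau> where \<tau>: "\<tau> \<in> \<Delta>" "\<And>\<sigma>. \<sigma> \<in> \<Delta> \<Longrightarrow> \<tau> \<subseteq> \<sigma> \<Longrightarrow> \<tau> = \<sigma>"
    using finite_has_maximal[of \<Delta>] empty_face by auto
  let ?w = "Poly_Mapping.single (face_mono \<tau> e) 1 :: 'k mpol"
  have w: "?w \<in> forms r e" using dim[OF \<tau>(1)] e by (intro single_in_forms face_mono_monomials \<tau>) auto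
  have "\<phi> ?w = (\<Sum>\<sigma>\<in>\<Delta>. if \<sigma> = \<tau> then 1 else 0)"
    unfolding \<phi>_def using \<tau>(2) by (intro sum.cong) (auto simp: hom_part_forms[OF w] ev_face_mono[OF \<tau>(1)] when_def)
  also have "\<dots> = 1" using \<tau>(1) by simp
  finally show ?thesis using that w by blast
qed

sublocale graded_quotient r I
proof
  show "homogeneous_ideal r I" by (rule homogeneous)
  obtain w where w: "w \<in> forms r e" "\<phi> w = 1" by (rule obtain_top_form)
  have one: "(1 :: 'k mpol) \<in> forms r 0" by (simp add: forms_eq)
  show "1 \<notin> I" using form_mem_iff[OF one] w forms_carrier[OF w(1)] by auto
qed

lemma artinian_quot: "artinian (quot_alg r I)"
proof -
  let ?J = "\<Union>d\<le>e. monomials r d"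
  have fin: "finite ?J" by simp
  have "poly_carrier r \<subseteq> span_mod ?J (\<lambda>m. Poly_Mapping.single m 1)"
  proof
    fix w :: "'k mpol" assume w: "w \<in> poly_carrier r"
    obtain n where n: "\<And>m. m \<in> Poly_Mapping.keys w \<Longrightarrow> mono_degree m \<le> n"
      using obtain_degree_bound[of w 0] by blast
    have "hom_part d w \<in> span_mod ?J (\<lambda>m. Poly_Mapping.single m 1)" for d
    proof (cases "d \<le> e")
      case True
      then have "Poly_Mapping.keys (hom_part d w) \<subseteq> ?J"
        using hom_part_in_forms[OF w, of d] by (auto simp: forms_eq)
      then show ?thesis
        by (rule span_mod_monomials[OF fin]) (rule span_mod_congruent[OF fin], auto simp: zero_mem)
    next
      case False
      then show ?thesis using forms_above[OF _ hom_part_in_forms[OF w]] by (intro span_mod_mem) auto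
    qed
    then show "w \<in> span_mod ?J (\<lambda>m. Poly_Mapping.single m 1)"
      by (subst sum_hom_part[OF n]) (auto intro: span_mod_sum)
  qed
  then have "A.finite_dimension K (rc ` poly_carrier r)"
    by (intro span_mod_finite_dimension[OF _ _ _ _ fin])
      (auto intro: carrier_add carrier_mult forms_carrier single_in_forms)
  then show ?thesis
    using A.finite_dimension_imp_artinian[OF subfield_K] by (simp add: carrier_quot_alg)
qed

text \<open>For \<open>d < e\<close> the part of \<open>q\<close> of degree \<open>e - d\<close> has
  no constant term, so it annihilates \<open>p\<close> modulo \<open>I\<close>; the component of
  degree \<open>e\<close> of that product is all that \<open>\<phi>\<close> sees of
  \<open>hom_part d p * q\<close>.\<close>

lemma low_part_of_socle:
  assumes p: "p \<in> socle_poly" and d: "d < e"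
  shows "hom_part d p \<in> I"
proof -
  have pS: "p \<in> poly_carrier r" using p by (simp add: socle_poly_def)
  have "\<phi> (hom_part d p * q) = 0" if q: "q \<in> poly_carrier r" for q
  proof -
    let ?q = "hom_part (e - d) q"
    have q': "?q \<in> forms r (e - d)" by (rule hom_part_in_forms[OF q])
    have "Poly_Mapping.lookup ?q 0 = 0" using d by (simp add: lookup_hom_part when_def)
    then have "p * ?q \<in> I" using p forms_carrier[OF q'] by (simp add: socle_poly_def)
    then have "\<phi> (hom_part e (p * ?q) * 1) = 0" unfolding I_def using carrier_one by blast
    moreover have "hom_part e (p * ?q) = hom_part e (hom_part d p * q)"
      using d hom_part_mult_form[OF q' pS, of e] hom_part_mult_form[OF hom_part_in_forms[OF pS] q, of e d]
      by (simp add: mult.commute)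
    ultimately have "\<phi> (hom_part e (hom_part d p * q)) = 0" by simp
    then show ?thesis
      using hom_part_forms[OF hom_part_in_forms[of "hom_part d p * q" r e]] q
        forms_carrier[OF hom_part_in_forms[OF pS]]
      by (simp add: \<phi>_def carrier_mult)
  qed
  then show ?thesis using form_mem_iff[OF hom_part_in_forms[OF pS]] by blast
qed

lemma dimension_socle: "A.dimension 1 K (socle r I)"
proof -
  obtain w where w: "w \<in> forms r e" "\<phi> w = 1" by (rule obtain_top_form)
  have "basis_mod socle_poly {()} (\<lambda>_. w)"
    unfolding basis_mod_def
  proof (intro conjI allI impI ballI)
    show "w \<in> socle_poly" by (rule forms_in_socle[OF forms_above w(1)])
    fix c :: "unit \<Rightarrow> 'k" and j :: unit
    assume "(\<Sum>j\<in>{()}. scal (c j) w) \<in> I"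
    then show "c j = 0"
      using top_form_mem_iff[OF forms_scal[OF w(1), of "c ()"]] w(2) by (simp add: \<phi>_scal)
  next
    fix p assume p: "p \<in> socle_poly"
    then have pS: "p \<in> poly_carrier r" by (simp add: socle_poly_def)
    \<comment> \<open>Parts below degree \<open>e\<close> lie in \<open>I\<close> by
      \<open>low_part_of_socle\<close>, parts above it trivially, and in degree \<open>e\<close>
      membership is decided by \<open>\<phi>\<close>, which takes the same value on \<open>p\<close>
      and on \<open>scal (\<phi> p) w\<close>.\<close>
    have "hom_part d (p - scal (\<phi> p) w) \<in> I" for d
    proof -
      consider "d < e" | "d = e" | "d > e" by linarith
      then show ?thesis
      proof cases
        case 1
        then show ?thesis using low_part_of_socle[OF p 1]
          by (simp add: hom_part_minus hom_part_scal hom_part_forms[OF w(1)])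
      next
        case 2
        have "\<phi> (hom_part e p) = \<phi> p"
          using hom_part_forms[OF hom_part_in_forms[OF pS, of e], of e] by (simp add: \<phi>_def)
        then have "\<phi> (hom_part e p - scal (\<phi> p) w) = 0" by (simp add: \<phi>_minus \<phi>_scal w(2))
        then show ?thesis
          using 2 top_form_mem_iff[OF forms_minus[OF hom_part_in_forms[OF pS] forms_scal[OF w(1)]]]
          by (simp add: hom_part_minus hom_part_scal hom_part_forms[OF w(1)])
      next
        case 3
        then show ?thesis using pS w(1)
          by (intro forms_above[of d] hom_part_in_forms carrier_minus carrier_mult) (auto intro: forms_carrier)
      qed
    qed
    then have "p - scal (\<phi> p) w \<in> I" by (rule mem_if_hom_parts)
    then show "\<exists>c. p - (\<Sum>j\<in>{()}. scal (c j) w) \<in> I" by (intro exI[of _ "\<lambda>_. \<phi> p"]) simp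
  qed simp_all
  then have "A.dimension (card {()}) K (rc ` socle_poly)"
    by (rule basis_mod_imp_dimension[rotated 4])
      (auto simp: socle_poly_def distrib_right mult.assoc zero_mem intro: add_mem scal_mem carrier_add carrier_mult)
  then show ?thesis by (simp add: socle_eq)
qed

lemma gorenstein: "artinian_gorenstein r I"
  unfolding artinian_gorenstein_def using homogeneous artinian_quot dimension_socle by blast

lemma hilbert_function_above: "i > e \<Longrightarrow> hilbert_function r I i = 0"
proof -
  assume "i > e"
  then have "basis_mod (forms r i) ({} :: nat set) (\<lambda>_. 0)" by (simp add: basis_mod_def forms_above)
  then show ?thesis using hilbert_function_eq_card by fastforce
qed

text \<open>The padded monomials of the faces of size at most \<open>i\<close> form a basis. In a
  vanishing combination a minimal face with nonzero coefficient is isolated by evaluation at its own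
  point. They span because at 0/1 points a monomial depends only on its support: it agrees with a
  face monomial, or vanishes at all points if the support is no face.\<close>

lemma hilbert_function_low:
  assumes i: "i \<le> e - s"
  shows "hilbert_function r I i = card {\<tau> \<in> \<Delta>. card \<tau> \<le> i}"
proof -
  let ?J = "{\<tau> \<in> \<Delta>. card \<tau> \<le> i}"
  let ?x = "\<lambda>\<tau>. Poly_Mapping.single (face_mono \<tau> i) 1 :: 'k mpol"
  have x: "?x \<tau> \<in> forms r i" if "\<tau> \<in> ?J" for \<tau> using that by (auto intro: single_in_forms face_mono_monomials)
  have fin: "finite ?J" by simp
  have "basis_mod (forms r i) ?J ?x"
    unfolding basis_mod_def
  proof (intro conjI allI impI ballI)
    fix c \<tau>0 assume c: "(\<Sum>\<tau>\<in>?J. scal (c \<tau>) (?x \<tau>)) \<in> I" and \<tau>0: "\<tau>0 \<in> ?J"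
    have sum0: "(\<Sum>\<tau>\<in>?J. c \<tau> * (1 when \<tau> \<subseteq> \<sigma>)) = 0" if \<sigma>: "\<sigma> \<in> \<Delta>" for \<sigma>
    proof -
      have "ev (pt \<sigma>) (\<Sum>\<tau>\<in>?J. scal (c \<tau>) (?x \<tau>)) = 0"
        using c \<sigma> low_form_mem_iff[OF forms_sum[OF forms_scal[OF x]] i, of ?J "\<lambda>\<tau>. \<tau>" c] by blast
      moreover have "ev (pt \<sigma>) (\<Sum>\<tau>\<in>?J. scal (c \<tau>) (?x \<tau>)) = (\<Sum>\<tau>\<in>?J. c \<tau> * (1 when \<tau> \<subseteq> \<sigma>))"
        unfolding ev_sum ev_scal by (intro sum.cong) (auto simp: ev_face_mono)
      ultimately show ?thesis by simp
    qed
    show "c \<tau>0 = 0"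
    proof (rule ccontr)
      assume "c \<tau>0 \<noteq> 0"
      then have "finite {\<tau> \<in> ?J. c \<tau> \<noteq> 0}" "{\<tau> \<in> ?J. c \<tau> \<noteq> 0} \<noteq> {}" using \<tau>0 by auto
      then obtain \<tau> where \<tau>: "\<tau> \<in> ?J" "c \<tau> \<noteq> 0"
        and min: "\<And>\<sigma>. \<sigma> \<in> ?J \<Longrightarrow> c \<sigma> \<noteq> 0 \<Longrightarrow> \<sigma> \<subseteq> \<tau> \<Longrightarrow> \<tau> = \<sigma>"
        using finite_has_minimal[of "{\<tau> \<in> ?J. c \<tau> \<noteq> 0}"] by auto
      have "(\<Sum>\<sigma>\<in>?J. c \<sigma> * (1 when \<sigma> \<subseteq> \<tau>)) = (\<Sum>\<sigma>\<in>?J. if \<sigma> = \<tau> then c \<tau> else 0)"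
        using min by (intro sum.cong) (auto simp: when_def)
      also have "\<dots> = c \<tau>" using \<tau>(1) fin by simp
      finally show False using sum0[of \<tau>] \<tau> by simp
    qed
  next
    fix w :: "'k mpol" assume w: "w \<in> forms r i"
    have "Poly_Mapping.single m 1 \<in> span_mod ?J ?x" if m: "m \<in> monomials r i" for m
    proof -
      let ?\<tau> = "Poly_Mapping.keys m - {r - 1}"
      have mf: "Poly_Mapping.single m 1 \<in> forms r i" by (rule single_in_forms[OF m])
      have ev_m: "ev (pt \<sigma>) (Poly_Mapping.single m 1) = (1 when ?\<tau> \<subseteq> \<sigma>)" for \<sigma>
        by (auto simp: ev_single pt_def when_def)
      show ?thesis
      proof (cases "?\<tau> \<in> \<Delta>")
        case True
        have "card ?\<tau> \<le> card (Poly_Mapping.keys m)" by (rule card_mono) auto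
        also have "\<dots> \<le> mono_degree m"
          unfolding mono_degree_def card_eq_sum by (intro sum_mono) (auto simp: in_keys_iff)
        also have "\<dots> = i" using m by (simp add: monomials_def)
        finally have \<tau>: "?\<tau> \<in> ?J" using True by simp
        have "Poly_Mapping.single m 1 - ?x ?\<tau> \<in> I"
          using True by (subst low_form_mem_iff[OF forms_minus[OF mf x[OF \<tau>]] i]) (simp add: ev_minus ev_m ev_face_mono)
        then show ?thesis by (rule span_mod_congruent[OF fin \<tau>])
      next
        case False
        then have "\<not> ?\<tau> \<subseteq> \<sigma>" if "\<sigma> \<in> \<Delta>" for \<sigma> using down[OF that] by blast
        then have "Poly_Mapping.single m 1 \<in> I" by (subst low_form_mem_iff[OF mf i]) (simp add: ev_m)
        then show ?thesis by (rule span_mod_mem)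
      qed
    qed
    moreover have "Poly_Mapping.keys w \<subseteq> monomials r i" using w by (simp add: forms_eq)
    ultimately have "w \<in> span_mod ?J ?x" using span_mod_monomials[OF finite_monomials] by blast
    then show "\<exists>c. w - (\<Sum>\<tau>\<in>?J. scal (c \<tau>) (?x \<tau>)) \<in> I" by (simp add: span_mod_def)
  qed (use x in auto)
  then show ?thesis by (rule hilbert_function_eq_card)
qed

lemma hilbert_function_top: "hilbert_function r I e \<noteq> 0"
proof
  assume "hilbert_function r I e = 0"
  then have "std e = {}" by (simp add: hilbert_function_std)
  moreover obtain w where w: "w \<in> forms r e" "\<phi> w = 1" by (rule obtain_top_form)
  ultimately have "w \<in> I" using std_reduction[OF w(1)] by (metis diff_zero keys_eq_empty subset_empty)
  then show False using top_form_mem_iff[OF w(1)] w(2) by simp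
qed

sublocale gorenstein_quotient r I e
  by unfold_locales (use gorenstein hilbert_function_above hilbert_function_top in auto)

lemma gorenstein_hilbert_function:
  assumes h: "h = map (\<lambda>i. card {\<tau> \<in> \<Delta>. card \<tau> \<le> min i (e - i)}) [0..<e + 1]"
    and "h ! 1 = r" "s = e div 2"
  shows "h \<in> gorenstein_hilbert_functions TYPE('k) r e"
proof -
  have "hilbert_function r I i = h ! i" if "i \<le> e" for i
  proof (cases "i \<le> e - s")
    case True
    \<comment> \<open>For odd \<open>e\<close> this range includes \<open>i = s + 1\<close>, where
      \<open>min i (e - i)\<close> is \<open>s\<close>; faces have at most \<open>s\<close>
      vertices, so nothing is lost.\<close>
    have "{\<tau> \<in> \<Delta>. card \<tau> \<le> i} = {\<tau> \<in> \<Delta>. card \<tau> \<le> min i (e - i)}"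
      using True e dim by fastforce
    then show ?thesis using that True by (simp add: h hilbert_function_low del: upt_Suc)
  next
    case False
    have "hilbert_function r I i = hilbert_function r I (e - i)"
      using hilbert_function_symmetric[OF that] by simp
    also have "\<dots> = card {\<tau> \<in> \<Delta>. card \<tau> \<le> e - i}" using False assms(3) by (intro hilbert_function_low) auto
    also have "e - i = min i (e - i)" using False assms(3) by simp
    finally show ?thesis using that by (simp add: h del: upt_Suc)
  qed
  then show ?thesis
    unfolding gorenstein_hilbert_functions_def
    using assms gorenstein hilbert_function_above hilbert_function_top
    by (auto simp: h intro!: exI[of _ I])
qed

end

section \<open>The Macaulay bound\<close>

lemma less_binomial_add: "1 \<le> d \<Longrightarrow> n < (n + d) choose d"
proof (induction n)
  case (Suc n)
  then obtain c where c: "d = Suc c" by (cases d) auto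
  have "(Suc n + d) choose d = (n + d choose c) + (n + d choose d)" by (simp add: c)
  moreover have "0 < (n + d choose c)" by (simp only: c zero_less_binomial_iff)
  ultimately show ?case using Suc by linarith
qed simp

text \<open>The leading entry of the \<open>d\<close>-binomial expansion
  (\<open>binomial_expansion_top\<close>). For \<open>n = 0\<close>, where there is no expansion,
  and \<open>1 \<le> d\<close>, it is \<open>d - 1\<close>, so that
  \<open>binomial_top_le_macaulay\<close> covers zero entries too.\<close>

definition binomial_top :: "nat \<Rightarrow> nat \<Rightarrow> nat" where
  "binomial_top n d = (LEAST b. n < Suc b choose d)"

lemma less_binomial_top: "1 \<le> d \<Longrightarrow> n < Suc (binomial_top n d) choose d"
  unfolding binomial_top_def
proof (rule LeastI)
  assume "1 \<le> d"
  then show "n < Suc (n + d) choose d"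
    using less_binomial_add[of d n] binomial_right_mono[of "n + d" "Suc (n + d)" d] by linarith
qed

lemma binomial_top_le: "1 \<le> d \<Longrightarrow> binomial_top n d choose d \<le> n"
proof (cases "binomial_top n d")
  case (Suc b)
  then have "\<not> n < Suc b choose d"
    unfolding binomial_top_def using not_less_Least[of b "\<lambda>b. n < Suc b choose d"] by simp
  then show ?thesis using Suc by simp
qed (simp add: binomial_eq_0)

lemma binomial_top_le_iff: "n < Suc b choose d \<Longrightarrow> binomial_top n d \<le> b"
  unfolding binomial_top_def by (rule Least_le)

lemma le_binomial_top: "1 \<le> d \<Longrightarrow> b choose d \<le> n \<Longrightarrow> b \<le> binomial_top n d"
  using less_binomial_top[of d n] binomial_right_mono[of "Suc (binomial_top n d)" b d] by linarith

lemma binomial_top_ge: "1 \<le> d \<Longrightarrow> d - 1 \<le> binomial_top n d"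
  by (rule le_binomial_top) (auto simp: binomial_eq_0)

lemma binomial_expansion_restrict:
  assumes "binomial_expansion n (Suc d) \<delta> k" "\<delta> \<noteq> Suc d"
  shows "binomial_expansion (n - (k (Suc d) choose Suc d)) d \<delta> k" "k d < k (Suc d)"
    "n = (k (Suc d) choose Suc d) + (n - (k (Suc d) choose Suc d))"
proof -
  have le: "\<delta> \<le> d" using assms by (auto simp: binomial_expansion_def)
  show "k d < k (Suc d)" using assms le by (auto simp: binomial_expansion_def strict_mono_on_def)
  show "binomial_expansion (n - (k (Suc d) choose Suc d)) d \<delta> k"
    "n = (k (Suc d) choose Suc d) + (n - (k (Suc d) choose Suc d))"
    using assms le by (auto simp: binomial_expansion_def strict_mono_on_def)
qed

text \<open>What remains after the leading binomial is an expansion with a smaller leading entry,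
  hence less than \<open>k (Suc d) choose d\<close>. Pascal's rule turns this into the upper
  bound.\<close>

lemma binomial_expansion_bounds:
  assumes "binomial_expansion n d \<delta> k"
  shows "d \<le> k d \<and> k d choose d \<le> n \<and> n < Suc (k d) choose d"
  using assms
proof (induction d arbitrary: n)
  case 0
  then show ?case by (auto simp: binomial_expansion_def)
next
  case (Suc d)
  show ?case
  proof (cases "\<delta> = Suc d")
    case True
    then show ?thesis using Suc.prems by (simp add: binomial_expansion_def)
  next
    case False
    note restrict = binomial_expansion_restrict[OF Suc.prems False]
    note IH = Suc.IH[OF restrict(1)]
    have "n - (k (Suc d) choose Suc d) < k (Suc d) choose d"
      using IH restrict(2) binomial_right_mono[of "Suc (k d)" "k (Suc d)" d] by linarith
    then show ?thesis using restrict(2,3) IH by (simp del: binomial_Suc_Suc add: binomial_Suc_Suc[of "k (Suc d)"])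
  qed
qed

lemma binomial_expansion_top:
  assumes "binomial_expansion n d \<delta> k" shows "k d = binomial_top n d"
proof -
  have d: "1 \<le> d" using assms by (simp add: binomial_expansion_def)
  show ?thesis
    using binomial_expansion_bounds[OF assms] le_binomial_top[OF d, of "k d" n] binomial_top_le_iff[of n "k d" d]
    by linarith
qed

lemma binomial_expansion_pos: "binomial_expansion n d \<delta> k \<Longrightarrow> 0 < n"
  using binomial_expansion_bounds[of n d \<delta> k] zero_less_binomial[of d "k d"] by linarith

lemma binomial_expansion_shift:
  assumes "binomial_expansion n d \<delta> k"
  shows "binomial_expansion (\<Sum>i=\<delta>..d. (k i + 1) choose (i + 1)) (Suc d) (Suc \<delta>) (\<lambda>i. k (i - 1) + 1)"
proof -
  have mono: "k r < k s" if "\<delta> \<le> r" "r < s" "s \<le> d" for r s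
    using assms that by (auto simp: binomial_expansion_def strict_mono_on_def)
  have "strict_mono_on {Suc \<delta>..Suc d} (\<lambda>i. k (i - 1) + 1)"
    unfolding strict_mono_on_def by (auto intro!: mono)
  then show ?thesis
    using assms unfolding binomial_expansion_def
    by (simp add: sum.shift_bounds_cl_Suc_ivl del: sum.cl_ivl_Suc)
qed

text \<open>The leading entry is determined by \<open>n\<close>, and the remainder is positive
  unless the expansion stops. Uniqueness concerns the shifted sums because \<open>k\<close> is
  arbitrary outside \<open>{\<delta>..d}\<close>.\<close>

lemma binomial_expansion_unique:
  assumes "binomial_expansion n d \<delta> k" "binomial_expansion n d \<delta>' k'"
  shows "(\<Sum>i=\<delta>..d. (k i + 1) choose (i + 1)) = (\<Sum>i=\<delta>'..d. (k' i + 1) choose (i + 1))"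
  using assms
proof (induction d arbitrary: n)
  case 0
  then show ?case by (auto simp: binomial_expansion_def)
next
  case (Suc d)
  have top: "k (Suc d) = k' (Suc d)"
    using binomial_expansion_top[OF Suc.prems(1)] binomial_expansion_top[OF Suc.prems(2)] by simp
  have rem: "0 < n - (l (Suc d) choose Suc d)" if "binomial_expansion n (Suc d) \<gamma> l" "\<gamma> \<noteq> Suc d" for l \<gamma>
    by (rule binomial_expansion_pos[OF binomial_expansion_restrict(1)[OF that]])
  have eq: "n = (l (Suc d) choose Suc d)" if "binomial_expansion n (Suc d) \<gamma> l" "\<gamma> = Suc d" for l \<gamma>
    using that by (simp add: binomial_expansion_def)
  show ?case
  proof (cases "\<delta> = Suc d")
    case True
    then have "\<delta>' = Suc d" using rem[OF Suc.prems(2)] eq[OF Suc.prems(1)] top by auto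
    then show ?thesis using True top by simp
  next
    case False
    then have False': "\<delta>' \<noteq> Suc d" using rem[OF Suc.prems(1)] eq[OF Suc.prems(2)] top by auto
    have "\<delta> \<le> Suc d" "\<delta>' \<le> Suc d" using Suc.prems by (auto simp: binomial_expansion_def)
    then show ?thesis
      using Suc.IH[OF binomial_expansion_restrict(1)[OF Suc.prems(1) False]]
        binomial_expansion_restrict(1)[OF Suc.prems(2) False'] top
      by simp
  qed
qed

lemma binomial_expansion_exists:
  assumes "1 \<le> d" "1 \<le> n"
  shows "\<exists>\<delta> k. binomial_expansion n d \<delta> k"
  using assms
proof (induction d arbitrary: n)
  case (Suc d)
  define b where "b = binomial_top n (Suc d)"
  have le: "b choose Suc d \<le> n" and less: "n < Suc b choose Suc d"
    using binomial_top_le[of "Suc d" n] less_binomial_top[of "Suc d" n] by (auto simp: b_def)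
  show ?case
  proof (cases "n = b choose Suc d")
    case True
    have "Suc d \<le> b" using Suc.prems(2) True by (metis binomial_eq_0 not_le not_one_le_zero)
    then show ?thesis using True
      by (intro exI[of _ "Suc d"] exI[of _ "\<lambda>_. b"]) (auto simp: binomial_expansion_def strict_mono_on_def)
  next
    case False
    define n' where "n' = n - (b choose Suc d)"
    \<comment> \<open>Greedy choice: by Pascal's rule the remainder is below
      \<open>b choose d\<close>, which forces the next entry below \<open>b\<close>.\<close>
    have n': "1 \<le> n'" "n' < b choose d" "n = n' + (b choose Suc d)" using le less False by (auto simp: n'_def)
    then have "1 \<le> d" by (cases d) auto
    from Suc.IH[OF this n'(1)] obtain \<delta> k where k: "binomial_expansion n' d \<delta> k" by blast
    have "k d choose d < b choose d" using binomial_expansion_bounds[OF k] n'(2) by linarith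
    then have "k d < b" by (metis binomial_right_mono not_le)
    moreover have "k i \<le> k d" if "i \<in> {\<delta>..d}" for i
      using k that unfolding binomial_expansion_def strict_mono_on_def
      by (metis atLeastAtMost_iff le_eq_less_or_eq order_refl)
    ultimately have "k i < b" if "i \<in> {\<delta>..d}" for i using that by fastforce
    then have "binomial_expansion n (Suc d) \<delta> (k(Suc d := b))"
      using k n'(3) unfolding binomial_expansion_def strict_mono_on_def by auto
    then show ?thesis by blast
  qed
qed simp

text \<open>The shifted sum is itself an expansion, in degree \<open>d + 1\<close>, so its leading
  entry can be read off. The two estimates that follow, one for each side of the count, rest on
  this.\<close>

lemma binomial_top_macaulay_bound:
  assumes "1 \<le> d" "1 \<le> n"
  shows "binomial_top (macaulay_bound n d) (Suc d) = Suc (binomial_top n d)"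
proof -
  obtain \<delta> k where k: "binomial_expansion n d \<delta> k" using binomial_expansion_exists[OF assms] by blast
  have "macaulay_bound n d = (\<Sum>i=\<delta>..d. (k i + 1) choose (i + 1))"
  proof -
    have "(THE s. \<exists>\<delta> k. binomial_expansion n d \<delta> k \<and> s = (\<Sum>i=\<delta>..d. (k i + 1) choose (i + 1)))
      = (\<Sum>i=\<delta>..d. (k i + 1) choose (i + 1))"
      by (rule the_equality) (use k binomial_expansion_unique[OF _ k] in blast)+
    then show ?thesis using assms(2) by (simp add: macaulay_bound_def)
  qed
  then show ?thesis
    using binomial_expansion_top[OF binomial_expansion_shift[OF k]] binomial_expansion_top[OF k] by simp
qed

lemma le_macaulay_bound:
  assumes "1 \<le> d" "b choose d \<le> n" "1 \<le> n"
  shows "Suc b choose Suc d \<le> macaulay_bound n d"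
proof -
  have "Suc b choose Suc d \<le> Suc (binomial_top n d) choose Suc d"
    using le_binomial_top[OF assms(1,2)] by (intro binomial_right_mono) simp
  also have "\<dots> \<le> macaulay_bound n d"
    using binomial_top_le[of "Suc d" "macaulay_bound n d"] binomial_top_macaulay_bound[OF assms(1,3)] by simp
  finally show ?thesis .
qed

lemma binomial_top_le_macaulay:
  assumes "1 \<le> d" "n' \<le> macaulay_bound n d"
  shows "binomial_top n' (Suc d) \<le> Suc (binomial_top n d)"
proof (cases "n = 0")
  case True
  then have "n' = 0" using assms(2) by (simp add: macaulay_bound_def)
  then have "binomial_top n' (Suc d) \<le> d" by (intro binomial_top_le_iff) simp
  then show ?thesis using binomial_top_ge[OF assms(1), of n] by linarith
next
  case False
  then have "macaulay_bound n d < Suc (Suc (binomial_top n d)) choose Suc d"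
    using less_binomial_top[of "Suc d" "macaulay_bound n d"] binomial_top_macaulay_bound[OF assms(1), of n] by simp
  then show ?thesis using assms(2) by (intro binomial_top_le_iff) simp
qed

section \<open>Counting chains\<close>

lemma power_diff_le: "0 \<le> x \<Longrightarrow> x \<le> y \<Longrightarrow> y ^ Suc n - x ^ Suc n \<le> real (Suc n) * (y - x) * y ^ n"
  for x y :: real
proof (induction n)
  case (Suc n)
  have "y ^ Suc (Suc n) - x ^ Suc (Suc n) = y * (y ^ Suc n - x ^ Suc n) + (y - x) * x ^ Suc n"
    by (simp add: algebra_simps)
  also have "\<dots> \<le> y * (real (Suc n) * (y - x) * y ^ n) + (y - x) * y ^ Suc n"
    using Suc by (intro add_mono mult_left_mono power_mono) auto
  also have "\<dots> = real (Suc (Suc n)) * (y - x) * y ^ Suc n" by (simp add: algebra_simps)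
  finally show ?case .
qed simp

lemma power_diff_ge: "0 \<le> x \<Longrightarrow> real (Suc n) * x ^ n \<le> (x + 1) ^ Suc n - x ^ Suc n"
  for x :: real
proof (induction n)
  case (Suc n)
  have "real (Suc (Suc n)) * x ^ Suc n = x * (real (Suc n) * x ^ n) + x ^ Suc n" by (simp add: algebra_simps)
  also have "\<dots> \<le> x * ((x + 1) ^ Suc n - x ^ Suc n) + (x + 1) ^ Suc n"
    using Suc by (intro add_mono mult_left_mono power_mono) auto
  also have "\<dots> = (x + 1) ^ Suc (Suc n) - x ^ Suc (Suc n)" by (simp add: algebra_simps)
  finally show ?case .
qed simp

text \<open>The truncated shift \<open>c\<close> carries the accumulated loss; one summation raises
  it by one.\<close>

lemma sum_power_ge: "real (q - Suc c) ^ Suc n / real (Suc n) \<le> (\<Sum>a<q. real (a - c) ^ n)"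
proof (induction q)
  case (Suc q)
  show ?case
  proof (cases "c < q")
    case True
    define x where "x = real (q - Suc c)"
    have x: "real (q - c) = x + 1" using True by (simp add: x_def of_nat_diff)
    have "(x + 1) ^ Suc n / real (Suc n) \<le> (x ^ Suc n + real (Suc n) * (x + 1) ^ n) / real (Suc n)"
      using power_diff_le[of x "x + 1" n] by (intro divide_right_mono) (auto simp: x_def)
    also have "\<dots> = x ^ Suc n / real (Suc n) + (x + 1) ^ n"
      by (simp add: add_divide_distrib del: power_Suc of_nat_Suc)
    finally have "(x + 1) ^ Suc n / real (Suc n) \<le> x ^ Suc n / real (Suc n) + (x + 1) ^ n" .
    then show ?thesis using Suc x by (simp add: x_def del: power_Suc)
  next
    case False
    then show ?thesis using sum_nonneg[of "{..<Suc q}" "\<lambda>a. real (a - c) ^ n"] by simp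
  qed
qed simp

lemma sum_power_le: "(\<Sum>j\<le>q. real (j + c) ^ n) \<le> real (q + c + 1) ^ Suc n / real (Suc n)"
proof (induction q)
  case 0
  have "real (Suc n) * real c ^ n \<le> (real c + 1) ^ Suc n"
    using power_diff_ge[of "real c" n] zero_le_power[of "real c" "Suc n"] by linarith
  then have "real c ^ n \<le> (real c + 1) ^ Suc n / real (Suc n)"
    by (subst pos_le_divide_eq) (auto simp: mult.commute simp del: power_Suc)
  then show ?case by (simp add: add.commute del: power_Suc)
next
  case (Suc q)
  have "real (Suc q + c) ^ n \<le> (real (Suc q + c + 1) ^ Suc n - real (Suc q + c) ^ Suc n) / real (Suc n)"
    using power_diff_ge[of "real (Suc q + c)" n] by (simp add: field_simps)
  then have "(\<Sum>j\<le>q. real (j + c) ^ n) + real (Suc q + c) ^ n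
      \<le> real (Suc q + c) ^ Suc n / real (Suc n)
        + (real (Suc q + c + 1) ^ Suc n - real (Suc q + c) ^ Suc n) / real (Suc n)"
    using Suc by (intro add_mono) (simp_all only: add_Suc Suc_eq_plus1 add_ac)
  also have "\<dots> = real (Suc q + c + 1) ^ Suc n / real (Suc n)"
    by (simp add: diff_divide_distrib del: power_Suc of_nat_Suc)
  finally show ?case by (simp only: sum.atMost_Suc)
qed

text \<open>Each index \<open>j\<close> lies in \<open>S\<close> of the preceding index and selects
  a box; only the values are recorded. Strict chains (\<open>lessThan\<close>) through disjoint
  boxes will serve the lower bound, weak chains (\<open>atMost\<close>) through overlapping boxes
  the upper bound.\<close>

fun chain_lists :: "(nat \<Rightarrow> nat set) \<Rightarrow> (nat \<Rightarrow> nat \<Rightarrow> nat set) \<Rightarrow> nat \<Rightarrow> nat \<Rightarrow> nat \<Rightarrow> nat list set" where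
  "chain_lists S B d 0 q = {[]}"
| "chain_lists S B d (Suc n) q = (\<Union>j\<in>S q. (\<lambda>(x, xs). x # xs) ` (B d j \<times> chain_lists S B (Suc d) n j))"

lemma finite_chains:
  assumes "\<And>q. finite (S q)" "\<And>d j. finite (B d j)"
  shows "finite (chain_lists S B d n q)"
  using assms by (induction n arbitrary: d q) auto

lemma card_chains_le:
  assumes "\<And>q. finite (S q)" "\<And>d j. finite (B d j)"
  shows "card (chain_lists S B d (Suc n) q) \<le> (\<Sum>j\<in>S q. card (B d j) * card (chain_lists S B (Suc d) n j))"
proof -
  have "card (chain_lists S B d (Suc n) q)
      \<le> (\<Sum>j\<in>S q. card ((\<lambda>(x, xs). x # xs) ` (B d j \<times> chain_lists S B (Suc d) n j)))"
    using assms by (auto intro!: card_UN_le)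
  also have "\<dots> \<le> (\<Sum>j\<in>S q. card (B d j \<times> chain_lists S B (Suc d) n j))"
    using assms finite_chains[of S B] by (intro sum_mono card_image_le) auto
  finally show ?thesis by (simp add: card_cartesian_product)
qed

lemma card_chains_eq:
  assumes "\<And>q. finite (S q)" "\<And>d j. finite (B d j)" "\<And>i j. i \<noteq> j \<Longrightarrow> B d i \<inter> B d j = {}"
  shows "card (chain_lists S B d (Suc n) q) = (\<Sum>j\<in>S q. card (B d j) * card (chain_lists S B (Suc d) n j))"
proof -
  have "card (chain_lists S B d (Suc n) q)
      = (\<Sum>j\<in>S q. card ((\<lambda>(x, xs). x # xs) ` (B d j \<times> chain_lists S B (Suc d) n j)))"
    unfolding chain_lists.simps using assms finite_chains[of S B]
    by (intro card_UN_disjoint) (auto, blast)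
  also have "\<dots> = (\<Sum>j\<in>S q. card (B d j \<times> chain_lists S B (Suc d) n j))"
    by (intro sum.cong refl card_image) (auto simp: inj_on_def)
  finally show ?thesis by (simp add: card_cartesian_product)
qed

section \<open>The volume of the region of chains and its closed form\<close>

fun chain_degree :: "nat \<Rightarrow> nat \<Rightarrow> nat" where
  "chain_degree d 0 = 0"
| "chain_degree d (Suc n) = d + chain_degree (Suc d) n"

text \<open>The volume of \<open>1 \<ge> t\<^sub>d \<ge> \<dots> \<ge> 0\<close> with respect to the densities \<open>t\<^sub>i\<^sup>i\<^sup>-\<^sup>1 / (i - 1)!\<close>.\<close>

fun chain_volume :: "nat \<Rightarrow> nat \<Rightarrow> real" where
  "chain_volume d 0 = 1"
| "chain_volume d (Suc n) = chain_volume (Suc d) n / (fact (d - 1) * real (chain_degree d (Suc n)))"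

lemma chain_volume_pos: "1 \<le> d \<Longrightarrow> 0 < chain_volume d n"
  by (induction n arbitrary: d) auto

lemma chain_degree_eq: "chain_degree d n + (d choose 2) = (d + n) choose 2"
proof (induction n arbitrary: d)
  case (Suc n)
  have "(Suc d choose 2) = (d choose 2) + d" by (simp add: numeral_2_eq_2)
  then show ?case using Suc[of "Suc d"] by simp
qed simp

text \<open>Origin of the binomials in \<open>c_const\<close>. Removing the outermost variable
  leaves \<open>P / fact (Y - j)\<close> with \<open>Y - j\<close> the total degree, and
  \<open>1 / fact (Y - j)\<close> equals \<open>(Y choose j) * fact j / fact Y\<close>. The general
  starting index \<open>j + 2\<close> carries the induction.\<close>

lemma chain_volume_eq:
  "chain_volume (j + 2) n =
    (\<Prod>i=j..<j + n. real ((((j + n + 2) choose 2) - ((i + 1) choose 2) - 1) choose i)) * fact j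
    / fact (((j + n + 2) choose 2) - ((j + 1) choose 2) - 1)"
proof (induction n arbitrary: j)
  case 0
  have "(j + 2 choose 2) = (j + 1 choose 2) + (j + 1)" by (simp add: numeral_2_eq_2)
  then show ?case by simp
next
  case (Suc n)
  define B where "B = (j + Suc n + 2) choose 2"
  define Y where "Y = B - ((j + 1) choose 2) - 1"
  define P where "P = (\<Prod>i=Suc j..<Suc j + n. real ((B - ((i + 1) choose 2) - 1) choose i))"
  have step: "(Suc j + 1 choose 2) = (j + 1 choose 2) + (j + 1)" by (simp add: numeral_2_eq_2)
  have deg: "chain_degree (j + 2) (Suc n) + (Suc j + 1 choose 2) = B"
    using chain_degree_eq[of "j + 2" "Suc n"] by (simp add: B_def add_ac)
  have pos: "0 < chain_degree (j + 2) (Suc n)" by simp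
  have Y: "chain_degree (j + 2) (Suc n) = Y - j" "j < Y" using deg step pos by (simp_all add: Y_def)
  have Y': "B - ((Suc j + 1) choose 2) - 1 = Y - j - 1" using step by (simp add: Y_def)
  have IH: "chain_volume (j + 3) n = P * fact (Suc j) / fact (Y - j - 1)"
    using Suc[of "Suc j"] Y' by (simp add: B_def P_def add_ac numeral_eq_Suc)
  have fact: "fact (Y - j) = real (Y - j) * fact (Y - j - 1)" using Y(2) by (subst fact_reduce) auto
  have "chain_volume (j + 2) (Suc n) = P * fact (Suc j) / fact (Y - j - 1) / (fact (Suc j) * real (Y - j))"
    using IH Y(1) by (simp add: numeral_eq_Suc del: chain_degree.simps fact_Suc)
  also have "\<dots> = P / fact (Y - j)" using Y(2) by (simp add: fact del: fact_Suc)
  also have "\<dots> = (real (Y choose j) * P) * fact j / fact Y"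
    using Y(2) by (simp add: binomial_fact)
  also have "real (Y choose j) * P = (\<Prod>i=j..<j + Suc n. real ((B - ((i + 1) choose 2) - 1) choose i))"
    by (subst prod.atLeast_Suc_lessThan) (simp_all add: Y_def P_def)
  finally show ?case by (simp add: Y_def B_def)
qed

lemma chain_volume_c_const:
  assumes "1 \<le> m" shows "chain_volume 2 (m - 1) = c_const m"
proof -
  have "m - 1 + 2 = m + 1" using assms by simp
  then show ?thesis
    using chain_volume_eq[of 0 "m - 1"] unfolding c_const_def by (simp add: atLeast0LessThan numeral_2_eq_2)
qed

lemma chain_degree_2: "1 \<le> m \<Longrightarrow> chain_degree 2 (m - 1) = ((m + 1) choose 2) - 1"
  using chain_degree_eq[of 2 "m - 1"] by simp

section \<open>Boxes of integers and the number of chains through them\<close>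

lemma le_fact_binomial: "k \<le> Suc n \<Longrightarrow> (Suc n - k) ^ k \<le> fact k * (n choose k)"
proof (induction k)
  case (Suc k)
  have "(Suc n - Suc k) ^ Suc k \<le> (n - k) * (Suc n - k) ^ k"
    by (simp add: mult_le_mono power_mono)
  also have "\<dots> \<le> (n - k) * (fact k * (n choose k))" using Suc by (intro mult_le_mono2) simp
  also have "\<dots> = fact (Suc k) * (n choose Suc k)"
    using binomial_absorb_comp[of n k] Suc_times_binomial_eq[of n k]
    by (metis (no_types, lifting) binomial_absorption fact_Suc mult.assoc mult.left_commute of_nat_id diff_Suc_1 Suc_times_binomial mult.commute)
  finally show ?case .
qed simp

text \<open>Half-open, so that boxes for different \<open>a\<close> are disjoint. For positive
  \<open>a\<close> and \<open>d\<close> the size is \<open>(a - 1) choose (d - 1)\<close> by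
  Pascal's rule, the source of the density \<open>t ^ (d - 1) / fact (d - 1)\<close>.\<close>

definition low_box :: "nat \<Rightarrow> nat \<Rightarrow> nat set" where
  "low_box d a = {(a - 1) choose d <.. a choose d}"

lemma card_low_box_ge:
  assumes "2 \<le> d" shows "real (a - d) ^ (d - 1) / fact (d - 1) \<le> real (card (low_box d a))"
proof (cases "d \<le> a")
  case True
  then obtain b c where bc: "a = Suc b" "d = Suc c" using assms by (cases a; cases d) auto
  have card: "card (low_box d a) = b choose c" by (simp add: low_box_def bc)
  have "(a - d) ^ c \<le> (Suc b - c) ^ c" by (intro power_mono) (auto simp: bc)
  also have "\<dots> \<le> fact c * (b choose c)" using True by (intro le_fact_binomial) (auto simp: bc)
  finally have "real ((a - d) ^ c) \<le> real (fact c * (b choose c))" by (simp only: of_nat_le_iff)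
  then show ?thesis unfolding card by (simp add: bc divide_le_eq mult.commute)
next
  case False
  then show ?thesis using assms by (simp add: power_0_left)
qed

lemma low_box_disjoint: "i \<noteq> j \<Longrightarrow> low_box d i \<inter> low_box d j = {}"
proof -
  have "low_box d i \<inter> low_box d j = {}" if "i < j" for i j
  proof -
    have "i choose d \<le> (j - 1) choose d" using that by (intro binomial_right_mono) simp
    then show ?thesis by (auto simp: low_box_def)
  qed
  then show "i \<noteq> j \<Longrightarrow> low_box d i \<inter> low_box d j = {}" by (metis Int_commute nat_neq_iff)
qed

text \<open>\<open>R\<close> bounds the degrees of all boxes. The shift \<open>R + n\<close>
  collects a loss of at most \<open>R\<close> in the size of a box and of one for each
  summation.\<close>

lemma card_low_chains_ge:
  assumes "2 \<le> d" "d + n \<le> Suc R"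
  shows "chain_volume d n * real (q - (R + n)) ^ chain_degree d n \<le> real (card (chain_lists lessThan low_box d n q))"
  using assms
proof (induction n arbitrary: d q)
  case (Suc n)
  define p where "p = chain_degree (Suc d) n"
  define v where "v = chain_volume (Suc d) n"
  have v: "0 < v" unfolding v_def by (rule chain_volume_pos) simp
  have deg: "chain_degree d (Suc n) = Suc (d - 1 + p)" using Suc.prems by (simp add: p_def)
  have "chain_volume d (Suc n) * real (q - (R + Suc n)) ^ chain_degree d (Suc n)
      = v / fact (d - 1) * (real (q - Suc (R + n)) ^ Suc (d - 1 + p) / real (Suc (d - 1 + p)))"
    by (simp add: deg v_def del: chain_degree.simps power_Suc)
  also have "\<dots> \<le> v / fact (d - 1) * (\<Sum>a<q. real (a - (R + n)) ^ (d - 1 + p))"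
    using v by (intro mult_left_mono sum_power_ge) auto
  also have "\<dots> = (\<Sum>a<q. (real (a - (R + n)) ^ (d - 1) / fact (d - 1)) * (v * real (a - (R + n)) ^ p))"
    by (simp add: sum_distrib_left power_add mult_ac)
  also have "\<dots> \<le> (\<Sum>a<q. real (card (low_box d a)) * real (card (chain_lists lessThan low_box (Suc d) n a)))"
  proof (rule sum_mono)
    fix a
    have "real (a - (R + n)) ^ (d - 1) / fact (d - 1) \<le> real (a - d) ^ (d - 1) / fact (d - 1)"
      using Suc.prems by (intro divide_right_mono power_mono) auto
    also have "\<dots> \<le> real (card (low_box d a))" by (rule card_low_box_ge[OF Suc.prems(1)])
    finally show "(real (a - (R + n)) ^ (d - 1) / fact (d - 1)) * (v * real (a - (R + n)) ^ p)
      \<le> real (card (low_box d a)) * real (card (chain_lists lessThan low_box (Suc d) n a))"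
      using Suc.IH[of "Suc d" a] Suc.prems v by (intro mult_mono) (auto simp: v_def p_def)
  qed
  also have "\<dots> = real (card (chain_lists lessThan low_box d (Suc n) q))"
    using low_box_disjoint by (subst card_chains_eq) (auto simp: low_box_def)
  finally show ?case .
qed simp

text \<open>The values \<open>x\<close> such that \<open>fact d * x\<close> is within
  \<open>C * r ^ (d - 1)\<close> of some \<open>t ^ d\<close> with \<open>t\<close> in cell
  \<open>j\<close> of a mesh of width \<open>r / N\<close>. The boxes may overlap, so they only
  bound from above.\<close>

definition up_box :: "real \<Rightarrow> real \<Rightarrow> real \<Rightarrow> nat \<Rightarrow> nat \<Rightarrow> nat set" where
  "up_box r N C d j = {x. (real j * (r / N)) ^ d - C * r ^ (d - 1) \<le> fact d * real x \<and>
     fact d * real x \<le> (real (Suc j) * (r / N)) ^ d + C * r ^ (d - 1)}"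

lemma card_nat_interval_le:
  fixes u v :: real
  assumes "u \<le> v"
  shows "finite {x :: nat. u \<le> real x \<and> real x \<le> v}" "real (card {x :: nat. u \<le> real x \<and> real x \<le> v}) \<le> v - u + 1"
proof -
  have sub: "{x :: nat. u \<le> real x \<and> real x \<le> v} \<subseteq> {nat \<lceil>u\<rceil>..<nat (\<lfloor>v\<rfloor> + 1)}"
    by (auto simp: nat_le_iff ceiling_le_iff zless_nat_eq_int_zless) linarith
  then show "finite {x :: nat. u \<le> real x \<and> real x \<le> v}" by (rule finite_subset) simp
  have "card {x :: nat. u \<le> real x \<and> real x \<le> v} \<le> nat (\<lfloor>v\<rfloor> + 1) - nat \<lceil>u\<rceil>"
    using card_mono[OF _ sub] by simp
  moreover have "real (nat (\<lfloor>v\<rfloor> + 1) - nat \<lceil>u\<rceil>) \<le> v - u + 1"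
    using assms by linarith
  ultimately show "real (card {x :: nat. u \<le> real x \<and> real x \<le> v}) \<le> v - u + 1" by linarith
qed

lemma card_up_box_le:
  assumes "0 < r" "0 < N" "0 \<le> C"
  shows "finite (up_box r N C d j)"
    "real (card (up_box r N C d j))
      \<le> ((real (Suc j) ^ d - real j ^ d) * (r / N) ^ d + 2 * C * r ^ (d - 1)) / fact d + 1"
proof -
  let ?u = "((real j * (r / N)) ^ d - C * r ^ (d - 1)) / fact d"
  let ?v = "((real (Suc j) * (r / N)) ^ d + C * r ^ (d - 1)) / fact d"
  have eq: "up_box r N C d j = {x. ?u \<le> real x \<and> real x \<le> ?v}"
    by (auto simp: up_box_def divide_le_eq le_divide_eq mult.commute)
  have "(real j * (r / N)) ^ d \<le> (real (Suc j) * (r / N)) ^ d"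
    using assms by (intro power_mono mult_right_mono) auto
  moreover have "0 \<le> C * r ^ (d - 1)" using assms by simp
  ultimately have "(real j * (r / N)) ^ d - C * r ^ (d - 1) \<le> (real (Suc j) * (r / N)) ^ d + C * r ^ (d - 1)"
    by linarith
  then have le: "?u \<le> ?v" by (rule divide_right_mono) simp
  show "finite (up_box r N C d j)" unfolding eq by (rule card_nat_interval_le(1)[OF le])
  have "?v - ?u + 1 = ((real (Suc j) ^ d - real j ^ d) * (r / N) ^ d + 2 * C * r ^ (d - 1)) / fact d + 1"
    unfolding power_mult_distrib
    by (simp add: left_diff_distrib diff_divide_distrib add_divide_distrib del: of_nat_Suc)
  then show "real (card (up_box r N C d j))
      \<le> ((real (Suc j) ^ d - real j ^ d) * (r / N) ^ d + 2 * C * r ^ (d - 1)) / fact d + 1"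
    using card_nat_interval_le(2)[OF le] unfolding eq by simp
qed

text \<open>For fixed \<open>N\<close> and \<open>q\<close> this majorant is a polynomial in the
  real number \<open>r\<close>, so that its growth can be read off; \<open>limit_weight\<close> is
  the leading coefficient.\<close>

fun up_weight :: "real \<Rightarrow> real \<Rightarrow> real \<Rightarrow> nat \<Rightarrow> nat \<Rightarrow> nat \<Rightarrow> real" where
  "up_weight r N C d 0 q = 1"
| "up_weight r N C d (Suc n) q =
    (\<Sum>j\<le>q. (((real (Suc j) ^ d - real j ^ d) * (r / N) ^ d + 2 * C * r ^ (d - 1)) / fact d + 1)
      * up_weight r N C (Suc d) n j)"

lemma card_up_chains_le:
  assumes "0 < r" "0 < N" "0 \<le> C"
  shows "real (card (chain_lists atMost (up_box r N C) d n q)) \<le> up_weight r N C d n q"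
proof (induction n arbitrary: d q)
  case (Suc n)
  have "real (card (chain_lists atMost (up_box r N C) d (Suc n) q))
      \<le> real (\<Sum>j\<le>q. card (up_box r N C d j) * card (chain_lists atMost (up_box r N C) (Suc d) n j))"
    using card_up_box_le(1)[OF assms] by (intro of_nat_mono card_chains_le) auto
  also have "\<dots> \<le> up_weight r N C d (Suc n) q"
    unfolding up_weight.simps of_nat_sum of_nat_mult
    using card_up_box_le(2)[OF assms, of d] Suc[of "Suc d"]
    by (intro sum_mono mult_mono) (auto intro: order_trans[OF of_nat_0_le_iff])
  finally show ?case .
qed simp

fun limit_weight :: "real \<Rightarrow> nat \<Rightarrow> nat \<Rightarrow> nat \<Rightarrow> real" where
  "limit_weight N d 0 q = 1"
| "limit_weight N d (Suc n) q =
    (\<Sum>j\<le>q. (real (Suc j) ^ d - real j ^ d) / (N ^ d * fact d) * limit_weight N (Suc d) n j)"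

text \<open>The number of cells is fixed while \<open>r\<close> grows. Against the cell size of
  order \<open>r ^ d\<close>, the error \<open>2 * C * r ^ (d - 1)\<close> and the rounding term 1
  vanish.\<close>

lemma up_weight_tendsto:
  assumes "1 \<le> d"
  shows "((\<lambda>r. up_weight r N C d n q / r ^ chain_degree d n) \<longlongrightarrow> limit_weight N d n q) at_top"
  using assms
proof (induction n arbitrary: d q)
  case (Suc n)
  let ?\<beta> = "\<lambda>r j. ((real (Suc j) ^ d - real j ^ d) * (r / N) ^ d + 2 * C * r ^ (d - 1)) / fact d + 1"
  have inv: "((\<lambda>r::real. inverse r) \<longlongrightarrow> 0) at_top" by (rule tendsto_inverse_0_at_top) (rule filterlim_ident)
  have "((\<lambda>r. ?\<beta> r j / r ^ d) \<longlongrightarrow> (real (Suc j) ^ d - real j ^ d) / (N ^ d * fact d)) at_top" for j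
  proof (rule Lim_transform_eventually)
    let ?f = "\<lambda>r::real. ((real (Suc j) ^ d - real j ^ d) / N ^ d + 2 * C * inverse r) / fact d + inverse r ^ d"
    have "(?f \<longlongrightarrow> ((real (Suc j) ^ d - real j ^ d) / N ^ d + 2 * C * 0) / fact d + 0 ^ d) at_top"
      by (intro tendsto_intros inv) auto
    then show "(?f \<longlongrightarrow> (real (Suc j) ^ d - real j ^ d) / (N ^ d * fact d)) at_top"
      using Suc.prems by (simp add: power_0_left)
    show "\<forall>\<^sub>F r in at_top. ?f r = ?\<beta> r j / r ^ d"
      using eventually_gt_at_top[of 0]
    proof eventually_elim
      case (elim r)
      have "r ^ (d - 1) = r ^ d * inverse r" using elim Suc.prems by (cases d) auto
      moreover have "r ^ d * inverse r ^ d = 1" using elim by (simp add: power_mult_distrib[symmetric])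
      ultimately have "?\<beta> r j = r ^ d * ?f r"
        by (simp add: power_divide distrib_left add_divide_distrib mult_ac del: power_inverse)
      then show ?case using elim by (simp only:) simp
    qed
  qed
  then have "((\<lambda>r. \<Sum>j\<le>q. (?\<beta> r j / r ^ d) * (up_weight r N C (Suc d) n j / r ^ chain_degree (Suc d) n))
      \<longlongrightarrow> (\<Sum>j\<le>q. (real (Suc j) ^ d - real j ^ d) / (N ^ d * fact d) * limit_weight N (Suc d) n j)) at_top"
    by (intro tendsto_sum tendsto_mult Suc.IH) auto
  moreover have "(\<Sum>j\<le>q. (?\<beta> r j / r ^ d) * (up_weight r N C (Suc d) n j / r ^ chain_degree (Suc d) n))
      = up_weight r N C d (Suc n) q / r ^ chain_degree d (Suc n)" for r
    by (simp add: sum_divide_distrib power_add)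
  ultimately show ?case by simp
qed simp

text \<open>An upper Riemann sum: \<open>(j + 1) ^ d - j ^ d \<le> d * (j + 1) ^ (d - 1)\<close>
  replaces the increments by densities, and each summation moves the endpoint by one cell, whence
  \<open>q + n + 1\<close>.\<close>

lemma limit_weight_le:
  assumes "1 \<le> d" "0 < N"
  shows "limit_weight N d n q \<le> chain_volume d n * (real (q + n + 1) / N) ^ chain_degree d n"
  using assms(1)
proof (induction n arbitrary: d q)
  case (Suc n)
  define p where "p = chain_degree (Suc d) n"
  define v where "v = chain_volume (Suc d) n"
  have v: "0 < v" unfolding v_def by (rule chain_volume_pos) simp
  obtain c where c: "d = Suc c" using Suc.prems by (cases d) auto
  have deg: "chain_degree d (Suc n) = Suc (c + p)" by (simp add: p_def c)
  have "limit_weight N d (Suc n) q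
      \<le> (\<Sum>j\<le>q. (v / (fact c * N ^ (d + p))) * real (j + Suc n) ^ (c + p))"
    unfolding limit_weight.simps
  proof (rule sum_mono)
    fix j
    have "(real j + 1) ^ Suc c - real j ^ Suc c \<le> real (Suc c) * (real j + 1) ^ c"
      using power_diff_le[of "real j" "real j + 1" c] by simp
    also have "\<dots> \<le> real (Suc c) * real (j + Suc n) ^ c" by (intro mult_left_mono power_mono) auto
    finally have "(real (Suc j) ^ d - real j ^ d) / (N ^ d * fact d) \<le> real (Suc c) * real (j + Suc n) ^ c / (N ^ d * fact d)"
      using assms(2) by (intro divide_right_mono) (auto simp: c add.commute)
    also have "\<dots> = real (j + Suc n) ^ c / (N ^ d * fact c)" by (simp add: c field_simps del: of_nat_Suc)
    finally have *: "(real (Suc j) ^ d - real j ^ d) / (N ^ d * fact d) \<le> real (j + Suc n) ^ c / (N ^ d * fact c)" .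
    have "(real (Suc j) ^ d - real j ^ d) / (N ^ d * fact d) * limit_weight N (Suc d) n j
        \<le> (real (Suc j) ^ d - real j ^ d) / (N ^ d * fact d) * (v * (real (j + Suc n) / N) ^ p)"
      using Suc.IH[of "Suc d" j] assms(2) by (intro mult_left_mono) (auto simp: v_def p_def intro!: divide_nonneg_nonneg power_mono)
    also have "\<dots> \<le> real (j + Suc n) ^ c / (N ^ d * fact c) * (v * (real (j + Suc n) / N) ^ p)"
      using v assms(2) by (intro mult_right_mono *) auto
    also have "\<dots> = (v / (fact c * N ^ (d + p))) * real (j + Suc n) ^ (c + p)"
      by (simp add: power_add power_divide field_simps)
    finally show "(real (Suc j) ^ d - real j ^ d) / (N ^ d * fact d) * limit_weight N (Suc d) n j
      \<le> (v / (fact c * N ^ (d + p))) * real (j + Suc n) ^ (c + p)" .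
  qed
  also have "\<dots> = (v / (fact c * N ^ (d + p))) * (\<Sum>j\<le>q. real (j + Suc n) ^ (c + p))"
    by (simp add: sum_distrib_left)
  also have "\<dots> \<le> (v / (fact c * N ^ (d + p))) * (real (q + Suc n + 1) ^ Suc (c + p) / real (Suc (c + p)))"
    using v assms(2) by (intro mult_left_mono sum_power_le) auto
  also have "\<dots> = chain_volume d (Suc n) * (real (q + Suc n + 1) / N) ^ chain_degree d (Suc n)"
    by (simp add: deg[unfolded c] v_def[unfolded c] power_divide c del: chain_degree.simps power_Suc)
  finally show ?case .
qed simp

text \<open>Letting first \<open>r\<close> and then the mesh parameter \<open>N\<close> tend to infinity.\<close>

lemma eventually_card_le_volume:
  fixes Z :: "nat \<Rightarrow> nat list set"
  assumes Z: "\<And>r N. 1 \<le> r \<Longrightarrow> 1 \<le> N \<Longrightarrow> Z r \<subseteq> chain_lists atMost (up_box (real r) (real N) C) 2 n N"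
    and C: "0 \<le> C" and \<epsilon>: "chain_volume 2 n < b"
  shows "\<forall>\<^sub>F r in sequentially. real (card (Z r)) / real r ^ chain_degree 2 n < b"
proof -
  have "(\<lambda>N. chain_volume 2 n * (real (N + n + 1) / real N) ^ chain_degree 2 n)
      \<longlonglongrightarrow> chain_volume 2 n * 1 ^ chain_degree 2 n"
  proof (intro tendsto_intros)
    have "(\<lambda>N. 1 + real (n + 1) / real N) \<longlonglongrightarrow> 1 + 0"
      by (intro tendsto_intros lim_const_over_n)
    moreover have "\<forall>\<^sub>F N in sequentially. 1 + real (n + 1) / real N = real (N + n + 1) / real N"
      using eventually_gt_at_top[of 0] by eventually_elim (simp add: field_simps)
    ultimately show "(\<lambda>N. real (N + n + 1) / real N) \<longlonglongrightarrow> 1"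
      by (simp add: Lim_transform_eventually)
  qed
  then have "\<forall>\<^sub>F N in sequentially. chain_volume 2 n * (real (N + n + 1) / real N) ^ chain_degree 2 n < b"
    using \<epsilon> by (intro order_tendstoD) auto
  then have "\<exists>N\<ge>1. chain_volume 2 n * (real (N + n + 1) / real N) ^ chain_degree 2 n < b"
    unfolding eventually_sequentially by (metis linorder_not_less nle_le)
  then obtain N where N: "1 \<le> N" "chain_volume 2 n * (real (N + n + 1) / real N) ^ chain_degree 2 n < b" by blast
  then have "limit_weight (real N) 2 n N < b" using limit_weight_le[of 2 "real N" n N] by simp
  moreover have "(\<lambda>r. up_weight (real r) (real N) C 2 n N / real r ^ chain_degree 2 n)
      \<longlonglongrightarrow> limit_weight (real N) 2 n N"
    by (rule filterlim_compose[OF up_weight_tendsto filterlim_real_sequentially]) simp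
  ultimately have "\<forall>\<^sub>F r in sequentially. up_weight (real r) (real N) C 2 n N / real r ^ chain_degree 2 n < b"
    by (intro order_tendstoD) auto
  then show ?thesis using eventually_gt_at_top[of 0]
  proof eventually_elim
    case (elim r)
    have "finite (chain_lists atMost (up_box (real r) (real N) C) 2 n N)"
      using elim N C by (intro finite_chains card_up_box_le(1)) auto
    then have "card (Z r) \<le> card (chain_lists atMost (up_box (real r) (real N) C) 2 n N)"
      using elim N by (intro card_mono Z) auto
    also have "real \<dots> \<le> up_weight (real r) (real N) C 2 n N"
      using elim N C by (intro card_up_chains_le) auto
    finally have "real (card (Z r)) / real r ^ chain_degree 2 n \<le> up_weight (real r) (real N) C 2 n N / real r ^ chain_degree 2 n"
      by (intro divide_right_mono) auto
    then show ?case using elim by linarith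
  qed
qed

text \<open>The common shadow of both kinds of sequences. The witness \<open>t\<close> consists of
  roots of word counts for Gorenstein sequences and of integers for SI-sequences.\<close>

definition near_chain :: "real \<Rightarrow> nat \<Rightarrow> nat \<Rightarrow> (nat \<Rightarrow> nat) \<Rightarrow> bool" where
  "near_chain C m r x \<longleftrightarrow> (\<exists>t :: nat \<Rightarrow> real. t 1 \<le> real r \<and>
     (\<forall>i. 1 \<le> i \<and> i \<le> m \<longrightarrow> 0 \<le> t i \<and> \<bar>fact i * real (x i) - t i ^ i\<bar> \<le> C * real r ^ (i - 1)) \<and>
     (\<forall>i. 1 \<le> i \<and> i < m \<longrightarrow> t (Suc i) \<le> t i))"

lemma near_chain_mem_chains:
  assumes "near_chain C m r x" "1 \<le> r" "1 \<le> N"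
  shows "map x [2..<m + 1] \<in> chain_lists atMost (up_box (real r) (real N) C) 2 (m - 1) N"
proof -
  obtain t :: "nat \<Rightarrow> real" where t1: "t 1 \<le> real r"
    and t: "\<And>i. 1 \<le> i \<Longrightarrow> i \<le> m \<Longrightarrow> 0 \<le> t i"
      "\<And>i. 1 \<le> i \<Longrightarrow> i \<le> m \<Longrightarrow> \<bar>fact i * real (x i) - t i ^ i\<bar> \<le> C * real r ^ (i - 1)"
      "\<And>i. 1 \<le> i \<Longrightarrow> i < m \<Longrightarrow> t (Suc i) \<le> t i"
    using assms(1) unfolding near_chain_def by blast
  define s where "s = real r / real N"
  have s: "0 < s" using assms by (simp add: s_def)
  \<comment> \<open>The cell, in the mesh of width \<open>s\<close>, that contains
    \<open>t i\<close>; these indices inherit the monotonicity of \<open>t\<close>.\<close>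
  define q where "q i = nat \<lfloor>t i / s\<rfloor>" for i
  have q: "real (q i) \<le> t i / s" "t i / s < real (Suc (q i))" if "1 \<le> i" "i \<le> m" for i
    using t(1)[OF that] s by (auto simp: q_def) linarith
  have box: "x i \<in> up_box (real r) (real N) C i (q i)" if "1 \<le> i" "i \<le> m" for i
  proof -
    have "real (q i) * s \<le> t i" "t i \<le> real (Suc (q i)) * s"
      using q[OF that] s by (auto simp: field_simps)
    then have "(real (q i) * s) ^ i \<le> t i ^ i" "t i ^ i \<le> (real (Suc (q i)) * s) ^ i"
      using s t(1)[OF that] by (auto intro!: power_mono simp del: of_nat_Suc)
    then show ?thesis using t(2)[OF that] unfolding up_box_def s_def[symmetric] by (simp add: abs_le_iff)
  qed
  have mono: "q (Suc i) \<le> q i" if "1 \<le> i" "i < m" for i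
    unfolding q_def using t(3)[OF that] s by (intro nat_mono floor_mono divide_right_mono) auto
  have main: "map x [d..<d + n] \<in> chain_lists atMost (up_box (real r) (real N) C) d n q'"
    if "1 \<le> d" "d + n \<le> Suc m" "0 < n \<Longrightarrow> q d \<le> q'" for d n q'
    using that
  proof (induction n arbitrary: d q')
    case (Suc n)
    have "map x [Suc d..<Suc d + n] \<in> chain_lists atMost (up_box (real r) (real N) C) (Suc d) n (q d)"
      using Suc.prems mono[of d] by (intro Suc.IH) auto
    moreover have "map x [d..<d + Suc n] = x d # map x [Suc d..<Suc d + n]"
      by (simp add: upt_conv_Cons del: upt_Suc)
    ultimately show ?case using Suc.prems box[of d] by force
  qed simp
  \<comment> \<open>The chain starts below \<open>N\<close> because
    \<open>t 2 \<le> t 1 \<le> r\<close>, and \<open>r\<close> is \<open>N\<close> cells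
    long.\<close>
  have "q 2 \<le> N" if "2 \<le> m"
  proof -
    have "t 2 \<le> real r" using t(3)[of 1] t1 that by (simp add: numeral_2_eq_2)
    then have "t 2 / s \<le> real N" using s assms by (simp add: s_def field_simps)
    then show ?thesis using q(1)[of 2] that by simp
  qed
  then have "map x [2..<2 + (m - 1)] \<in> chain_lists atMost (up_box (real r) (real N) C) 2 (m - 1) N" if "1 \<le> m"
    using that by (intro main) auto
  then show ?thesis by (cases "1 \<le> m") (simp_all del: upt_Suc)
qed

section \<open>Symmetric sequences\<close>

definition sym_lists :: "nat \<Rightarrow> nat \<Rightarrow> nat list set" where
  "sym_lists r e = {h. length h = e + 1 \<and> h ! 0 = 1 \<and> h ! 1 = r \<and> (\<forall>i\<le>e. h ! (e - i) = h ! i)}"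

lemma inj_on_first_half: "inj_on (\<lambda>h. map ((!) h) [2..<e div 2 + 1]) (sym_lists r e)"
proof (rule inj_onI)
  fix h h' assume h: "h \<in> sym_lists r e" "h' \<in> sym_lists r e"
    and eq: "map ((!) h) [2..<e div 2 + 1] = map ((!) h') [2..<e div 2 + 1]"
  have half: "h ! i = h' ! i" if "i \<le> e div 2" for i
  proof -
    consider "i = 0" | "i = 1" | "2 \<le> i" by linarith
    then show ?thesis
    proof cases
      case 3
      then have "i \<in> set [2..<e div 2 + 1]" using that by (simp del: upt_Suc)
      then show ?thesis using eq unfolding map_eq_conv by blast
    qed (use h in \<open>auto simp: sym_lists_def\<close>)
  qed
  show "h = h'"
  proof (rule nth_equalityI)
    fix i assume "i < length h"
    then have i: "i \<le> e" using h by (simp add: sym_lists_def)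
    show "h ! i = h' ! i"
    proof (cases "i \<le> e div 2")
      case False
      then have "h ! (e - i) = h' ! (e - i)" by (intro half) linarith
      then show ?thesis using h i by (simp add: sym_lists_def)
    qed (rule half)
  qed (use h in \<open>simp add: sym_lists_def\<close>)
qed

lemma near_chain_lists_bounds:
  fixes X :: "nat \<Rightarrow> nat list set"
  assumes X: "\<And>r h. 1 \<le> r \<Longrightarrow> h \<in> X r \<Longrightarrow> h \<in> sym_lists r e \<and> near_chain C (e div 2) r ((!) h)"
    and C: "0 \<le> C"
  shows "\<And>r. 1 \<le> r \<Longrightarrow> finite (X r)"
    and "chain_volume 2 (e div 2 - 1) < b \<Longrightarrow>
      \<forall>\<^sub>F r in sequentially. real (card (X r)) / real r ^ chain_degree 2 (e div 2 - 1) < b"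
proof -
  define \<pi> where "\<pi> h = map ((!) h) [2..<e div 2 + 1]" for h :: "nat list"
  define Z where "Z r = (if 1 \<le> r then \<pi> ` X r else {})" for r
  have inj: "inj_on \<pi> (X r)" if "1 \<le> r" for r
    unfolding \<pi>_def by (rule inj_on_subset[OF inj_on_first_half[of e r]]) (use X[OF that] in blast)
  have Z: "Z r \<subseteq> chain_lists atMost (up_box (real r) (real N) C) 2 (e div 2 - 1) N" if "1 \<le> r" "1 \<le> N" for r N
    using X[OF that(1)] near_chain_mem_chains[OF _ that] that(1) by (auto simp: Z_def \<pi>_def simp del: upt_Suc)
  show "finite (X r)" if r: "1 \<le> r" for r
  proof -
    \<comment> \<open>For finiteness the mesh with a single cell suffices.\<close>
    have "finite (chain_lists atMost (up_box (real r) (real 1) C) 2 (e div 2 - 1) 1)"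
      using r C by (intro finite_chains card_up_box_le(1)) auto
    then have "finite (\<pi> ` X r)" using Z[OF r, of 1] r finite_subset by (auto simp: Z_def)
    then show ?thesis using inj[OF r] by (simp add: finite_image_iff)
  qed
  assume b: "chain_volume 2 (e div 2 - 1) < b"
  have "\<forall>\<^sub>F r in sequentially. real (card (Z r)) / real r ^ chain_degree 2 (e div 2 - 1) < b"
    by (rule eventually_card_le_volume[OF Z C b])
  then show "\<forall>\<^sub>F r in sequentially. real (card (X r)) / real r ^ chain_degree 2 (e div 2 - 1) < b"
    using eventually_ge_at_top[of 1] by eventually_elim (simp add: Z_def card_image inj)
qed

lemma gorenstein_near_chain:
  assumes e: "2 \<le> e" and h: "h \<in> gorenstein_hilbert_functions TYPE('k::field) r e"
  shows "h \<in> sym_lists r e \<and> near_chain (fact (e div 2)) (e div 2) r ((!) h)"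
proof -
  let ?m = "e div 2"
  obtain I :: "'k mpol set" where I: "artinian_gorenstein r I"
    "\<And>i. i \<le> e \<Longrightarrow> hilbert_function r I i = h ! i" "\<And>i. i > e \<Longrightarrow> hilbert_function r I i = 0"
    and h': "length h = e + 1" "h ! 1 = r" "h ! e \<noteq> 0"
    using h unfolding gorenstein_hilbert_functions_def by blast
  interpret gorenstein_quotient r I e
    by unfold_locales (use I h' artinian_gorenstein_proper in \<open>auto simp: artinian_gorenstein_def\<close>)
  have "h \<in> sym_lists r e"
    using hilbert_function_symmetric hilbert_function_0 I(2) h' by (simp add: sym_lists_def)
  moreover obtain T :: "nat \<Rightarrow> nat" where T: "\<And>d. T d \<le> fact d * hilbert_function r I d"
    "\<And>d. 1 \<le> d \<Longrightarrow> fact d * hilbert_function r I d \<le> T d + fact d * r ^ (d - 1)"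
    "\<And>d. 1 \<le> d \<Longrightarrow> T (Suc d) ^ d \<le> T d ^ Suc d" "T 1 \<le> r"
    by (rule hilbert_function_growth) blast
  have "near_chain (fact ?m) ?m r ((!) h)"
    unfolding near_chain_def
  \<comment> \<open>The witness is the root of the number of words. The error carries a factor
    \<open>fact i\<close>, which \<open>fact ?m\<close> bounds for all \<open>i\<close> in
    question.\<close>
  proof (intro exI[of _ "\<lambda>d. root d (real (T d))"] conjI allI impI; (elim conjE)?)
    show "root 1 (real (T 1)) \<le> real r" using T(4) by simp
  next
    fix i assume i: "1 \<le> i" "i \<le> ?m"
    show "0 \<le> root i (real (T i))" using i by (intro real_root_ge_zero) auto
    have pow: "root i (real (T i)) ^ i = real (T i)" using i by (intro real_root_pow_pos2) auto
    have hf: "hilbert_function r I i = h ! i" using i by (intro I(2)) linarith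
    have "real (T i) \<le> fact i * real (h ! i)"
      using T(1)[of i] unfolding hf by (metis of_nat_fact of_nat_le_iff of_nat_mult)
    moreover have "fact i * real (h ! i) \<le> real (T i) + fact i * real r ^ (i - 1)"
      using T(2)[OF i(1)] unfolding hf
      by (metis (no_types, lifting) of_nat_add of_nat_fact of_nat_le_iff of_nat_mult of_nat_power)
    moreover have "fact i * real r ^ (i - 1) \<le> fact ?m * real r ^ (i - 1)"
      using i by (intro mult_right_mono fact_mono) auto
    ultimately show "\<bar>fact i * real (h ! i) - root i (real (T i)) ^ i\<bar> \<le> fact ?m * real r ^ (i - 1)"
      unfolding pow abs_le_iff by linarith
  next
    fix i assume i: "1 \<le> i" "i < ?m"
    have "real (T (Suc i)) ^ i \<le> real (T i) ^ Suc i"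
      using T(3)[OF i(1)] by (metis of_nat_le_iff of_nat_power)
    moreover have "root (Suc i) (real (T (Suc i))) ^ Suc i = real (T (Suc i))"
      "root i (real (T i)) ^ i = real (T i)"
      using i by (intro real_root_pow_pos2; simp)+
    ultimately have "(root (Suc i) (real (T (Suc i))) ^ Suc i) ^ i \<le> (root i (real (T i)) ^ i) ^ Suc i"
      by simp
    then have "root (Suc i) (real (T (Suc i))) ^ (i * Suc i) \<le> root i (real (T i)) ^ (i * Suc i)"
      by (simp only: power_mult[symmetric] mult.commute)
    then show "root (Suc i) (real (T (Suc i))) \<le> root i (real (T i))"
      using i power_mono_iff[of "root (Suc i) (real (T (Suc i)))" "root i (real (T i))" "i * Suc i"] by simp
  qed
  ultimately show ?thesis by blast
qed

lemma SI_sequence_differences: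
  assumes e: "2 \<le> e" and h: "h \<in> SI_sequences r e"
  shows "h \<in> sym_lists r e"
    and "\<And>i. 1 \<le> i \<Longrightarrow> i \<le> e div 2 \<Longrightarrow> h ! (i - 1) \<le> h ! i"
    and "\<And>i. 1 \<le> i \<Longrightarrow> i < e div 2 \<Longrightarrow> h ! Suc i - h ! i \<le> macaulay_bound (h ! i - h ! (i - 1)) i"
proof -
  let ?g = "first_difference h (e div 2)"
  have O: "O_sequence ?g" and h': "length h = e + 1" "h ! 1 = r" "\<And>i. i \<le> e \<Longrightarrow> h ! (e - i) = h ! i"
    using h by (auto simp: SI_sequences_def)
  have len: "length ?g = e div 2 + 1" by (simp add: first_difference_def)
  have g0: "?g ! 0 = int (h ! 0)" by (simp add: first_difference_def nth_append del: upt_Suc)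
  have g: "?g ! i = int (h ! i) - int (h ! (i - 1))" if "1 \<le> i" "i \<le> e div 2" for i
    using that by (simp add: first_difference_def del: upt_Suc)
  show "h \<in> sym_lists r e" using O g0 h' by (simp add: sym_lists_def O_sequence_def)
  show le: "h ! (i - 1) \<le> h ! i" if "1 \<le> i" "i \<le> e div 2" for i
  proof -
    have "?g ! i \<in> set ?g" using that len by (intro nth_mem) simp
    then have "0 \<le> ?g ! i" using O unfolding O_sequence_def by blast
    then show ?thesis using g[OF that] by simp
  qed
  show "h ! Suc i - h ! i \<le> macaulay_bound (h ! i - h ! (i - 1)) i" if i: "1 \<le> i" "i < e div 2" for i
  proof -
    have "?g ! Suc i \<le> int (macaulay_bound (nat (?g ! i)) i)"
      using O i len unfolding O_sequence_def by simp
    moreover have "?g ! Suc i = int (h ! Suc i - h ! i)" using g[of "Suc i"] le[of "Suc i"] i by simp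
    moreover have "nat (?g ! i) = h ! i - h ! (i - 1)" using g[of i] i by simp
    ultimately show ?thesis by simp
  qed
qed

text \<open>The O-sequence condition concerns the differences \<open>g i\<close>, the claim concerns
  \<open>h ! i = g i + h ! (i - 1)\<close>; the last term has order \<open>r ^ (i - 1)\<close> and
  joins the error. In the constant, \<open>(m + 1) ^ m\<close> comes from
  \<open>t i + i \<le> (m + 1) * r\<close>, the summand \<open>m * m\<close> from comparing
  \<open>(t i + i) ^ i\<close> with \<open>t i ^ i\<close>, and \<open>fact m * (m + 1)\<close> from
  \<open>h ! (i - 1)\<close>.\<close>

lemma SI_near_chain:
  assumes e: "2 \<le> e" and r: "1 \<le> r" and h: "h \<in> SI_sequences r e"
  defines "m \<equiv> e div 2"
  shows "near_chain (real ((m + 1) ^ m * (m * m + fact m * (m + 1)))) m r ((!) h)"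
proof -
  note SI = SI_sequence_differences[OF e h, folded m_def]
  define g where "g i = h ! i - h ! (i - 1)" for i
  \<comment> \<open>The leading entry grows by at most one per degree, so subtracting
    \<open>i\<close> yields a nonincreasing sequence. The added one is what
    \<open>le_fact_binomial\<close> allows.\<close>
  define t where "t i = Suc (binomial_top (g i) i) - i" for i
  have h0: "h ! 0 = 1" and h1: "h ! 1 = r" using SI(1) by (auto simp: sym_lists_def)
  have t_eq: "Suc (binomial_top (g i) i) = t i + i" if "1 \<le> i" for i
    using binomial_top_ge[OF that, of "g i"] that by (simp add: t_def)
  have t_mono: "t (Suc i) \<le> t i" if "1 \<le> i" "i < m" for i
  proof -
    have "binomial_top (g (Suc i)) (Suc i) \<le> Suc (binomial_top (g i) i)"
      using binomial_top_le_macaulay[OF that(1), of "g (Suc i)" "g i"] SI(3)[OF that] by (simp add: g_def)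
    then show ?thesis unfolding t_def by linarith
  qed
  have "binomial_top (g 1) 1 \<le> g 1" by (rule binomial_top_le_iff) simp
  then have t1: "t 1 \<le> r" using h0 h1 by (simp add: t_def g_def)
  have t_le: "t i \<le> r" if "1 \<le> i" "i \<le> m" for i
    using that
  proof (induction i rule: dec_induct)
    case base
    then show ?case using t1 by simp
  next
    case (step i)
    then show ?case using t_mono[of i] by simp
  qed
  have lower: "t i ^ i \<le> fact i * g i" if "1 \<le> i" for i
  proof -
    have "t i ^ i \<le> fact i * (binomial_top (g i) i choose i)"
      unfolding t_def using binomial_top_ge[OF that, of "g i"] by (intro le_fact_binomial) linarith
    also have "\<dots> \<le> fact i * g i" by (intro mult_le_mono2 binomial_top_le[OF that])
    finally show ?thesis .
  qed
  have upper: "fact i * g i \<le> (t i + i) ^ i" if "1 \<le> i" for i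
  proof -
    have "g i \<le> Suc (binomial_top (g i) i) choose i" using less_binomial_top[OF that, of "g i"] by simp
    then have "fact i * g i \<le> fact i * (Suc (binomial_top (g i) i) choose i)" by (rule mult_le_mono2)
    also have "\<dots> \<le> Suc (binomial_top (g i) i) ^ i"
      using binomial_fact_pow[of "Suc (binomial_top (g i) i)" i] by (simp only: mult.commute)
    finally show ?thesis by (simp only: t_eq[OF that])
  qed
  have ti: "t i + i \<le> (m + 1) * r" if "1 \<le> i" "i \<le> m" for i
  proof -
    have "t i + i \<le> r + m * 1" using t_le[OF that] that by simp
    also have "\<dots> \<le> r + m * r" using r by (intro add_left_mono mult_le_mono2)
    finally show ?thesis by (simp add: algebra_simps)
  qed
  have h_le: "h ! j \<le> (j + 1) * ((m + 1) ^ m * r ^ j)" if "j \<le> m" for j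
    using that
  proof (induction j)
    case 0
    then show ?case using h0 by simp
  next
    case (Suc j)
    have "h ! Suc j = g (Suc j) + h ! j" using SI(2)[of "Suc j"] Suc.prems by (simp add: g_def)
    moreover have "g (Suc j) \<le> fact (Suc j) * g (Suc j)" using fact_ge_1[of "Suc j"] by (metis mult_le_mono1 nat_mult_1)
    then have "g (Suc j) \<le> (t (Suc j) + Suc j) ^ Suc j" by (rule order_trans) (rule upper, simp)
    also have "\<dots> \<le> ((m + 1) * r) ^ Suc j" using ti[of "Suc j"] Suc.prems by (intro power_mono) auto
    also have "\<dots> = (m + 1) ^ Suc j * r ^ Suc j" by (rule power_mult_distrib)
    also have "\<dots> \<le> (m + 1) ^ m * r ^ Suc j"
      using Suc.prems by (intro mult_le_mono1 power_increasing) auto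
    moreover have "h ! j \<le> (j + 1) * ((m + 1) ^ m * r ^ Suc j)"
    proof -
      have "r ^ j \<le> r ^ Suc j" using r by simp
      then have "(j + 1) * ((m + 1) ^ m * r ^ j) \<le> (j + 1) * ((m + 1) ^ m * r ^ Suc j)"
        by (intro mult_le_mono2)
      then show ?thesis using Suc by linarith
    qed
    ultimately show ?case by (simp add: add_mult_distrib)
  qed
  show ?thesis
    unfolding near_chain_def
  proof (intro exI[of _ "\<lambda>i. real (t i)"] conjI allI impI; (elim conjE)?)
    fix i assume i: "1 \<le> i" "i \<le> m"
    then obtain c where c: "i = Suc c" by (cases i) auto
    have hi: "h ! i = g i + h ! (i - 1)" using SI(2)[OF i] by (simp add: g_def)
    have "t i ^ i \<le> fact i * h ! i" using lower[OF i(1)] hi by (simp add: algebra_simps)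
    then have low: "real (t i) ^ i \<le> fact i * real (h ! i)"
      by (metis of_nat_fact of_nat_le_iff of_nat_mult of_nat_power)
    have "real (t i + i) ^ Suc c - real (t i) ^ Suc c \<le> real (Suc c) * (real (t i + i) - real (t i)) * real (t i + i) ^ c"
      by (rule power_diff_le) auto
    also have "\<dots> = real (i * i) * real (t i + i) ^ c" by (simp add: c algebra_simps)
    also have "\<dots> \<le> real (m * m) * real ((m + 1) ^ m * r ^ c)"
    proof (intro mult_mono)
      have "(t i + i) ^ c \<le> ((m + 1) * r) ^ c" using ti[OF i] by (rule power_mono) simp
      also have "\<dots> = (m + 1) ^ c * r ^ c" by (rule power_mult_distrib)
      also have "\<dots> \<le> (m + 1) ^ m * r ^ c" using i c by (intro mult_le_mono1 power_increasing) auto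
      finally show "real (t i + i) ^ c \<le> real ((m + 1) ^ m * r ^ c)" by (metis of_nat_le_iff of_nat_power)
      show "real (i * i) \<le> real (m * m)" using i by (simp add: mult_le_mono del: of_nat_mult)
    qed auto
    finally have diff: "real (t i + i) ^ i \<le> real (t i) ^ i + real (m * m) * real ((m + 1) ^ m * r ^ c)"
      unfolding c by linarith
    have "fact i * real (g i) \<le> real (t i + i) ^ i"
      using upper[OF i(1)] by (metis of_nat_fact of_nat_le_iff of_nat_mult of_nat_power)
    moreover have "fact i * real (h ! (i - 1)) \<le> fact m * real ((m + 1) * ((m + 1) ^ m * r ^ c))"
    proof (intro mult_mono)
      show "(fact i :: real) \<le> fact m" using i by (intro fact_mono) auto
      have "h ! (i - 1) \<le> (c + 1) * ((m + 1) ^ m * r ^ c)" using h_le[of c] i c by simp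
      also have "\<dots> \<le> (m + 1) * ((m + 1) ^ m * r ^ c)" using i c by (intro mult_le_mono1) simp
      finally show "real (h ! (i - 1)) \<le> real ((m + 1) * ((m + 1) ^ m * r ^ c))" by (simp only: of_nat_le_iff)
    qed auto
    moreover have "fact i * real (h ! i) = fact i * real (g i) + fact i * real (h ! (i - 1))"
      by (simp add: hi algebra_simps)
    ultimately have "fact i * real (h ! i) \<le> real (t i) ^ i + real (m * m) * real ((m + 1) ^ m * r ^ c)
        + fact m * real ((m + 1) * ((m + 1) ^ m * r ^ c))"
      using diff by linarith
    also have "\<dots> = real (t i) ^ i + real ((m + 1) ^ m * (m * m + fact m * (m + 1))) * real r ^ (i - 1)"
      by (simp add: c algebra_simps)
    finally show "\<bar>fact i * real (h ! i) - real (t i) ^ i\<bar>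
        \<le> real ((m + 1) ^ m * (m * m + fact m * (m + 1))) * real r ^ (i - 1)"
      using low unfolding abs_le_iff by linarith
  qed (use t1 t_mono in auto)
qed

section \<open>Realizing almost all sequences\<close>

lemma chain_lists_nth:
  assumes "xs \<in> chain_lists S B d n q"
  shows "length xs = n \<and> (\<exists>a. \<forall>i<n. xs ! i \<in> B (d + i) (a i) \<and> a i \<in> S (if i = 0 then q else a (i - 1)))"
  using assms
proof (induction n arbitrary: xs d q)
  case (Suc n)
  then obtain j x ys where ys: "j \<in> S q" "x \<in> B d j" "ys \<in> chain_lists S B (Suc d) n j" "xs = x # ys" by auto
  from Suc.IH[OF ys(3)] obtain a where "length ys = n"
    and a: "\<forall>i<n. ys ! i \<in> B (Suc d + i) (a i) \<and> a i \<in> S (if i = 0 then j else a (i - 1))" by blast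
  define a' where "a' i = (if i = 0 then j else a (i - 1))" for i
  have "xs ! i \<in> B (d + i) (a' i) \<and> a' i \<in> S (if i = 0 then q else a' (i - 1))" if "i < Suc n" for i
    using ys a that by (cases i) (auto simp: a'_def)
  then show ?case using \<open>length ys = n\<close> ys(4) by (intro conjI exI[of _ a'] allI impI) simp_all
qed auto

text \<open>All \<open>i\<close>-subsets of the first \<open>a i - 1\<close> vertices are taken, and
  the remaining faces of size \<open>i\<close> among the first \<open>a i\<close> vertices. A
  nonempty proper subset, of size \<open>j\<close>, of a face of size \<open>i\<close> lies in the
  first \<open>a i \<le> a j - 1\<close> vertices, where every \<open>j\<close>-subset is
  present.\<close>

lemma exists_complex:
  fixes f a :: "nat \<Rightarrow> nat"
  assumes f: "\<And>i. 1 \<le> i \<Longrightarrow> i \<le> m \<Longrightarrow> f i \<in> low_box i (a i)"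
    and a: "\<And>i. 1 \<le> i \<Longrightarrow> i < m \<Longrightarrow> a (Suc i) < a i" and n: "1 \<le> m \<Longrightarrow> a 1 \<le> n"
  obtains \<Delta> :: "nat set set" where "\<Delta> \<subseteq> Pow {..<n}" "{} \<in> \<Delta>"
    "\<And>\<sigma> \<tau>. \<sigma> \<in> \<Delta> \<Longrightarrow> \<tau> \<subseteq> \<sigma> \<Longrightarrow> \<tau> \<in> \<Delta>" "\<And>\<sigma>. \<sigma> \<in> \<Delta> \<Longrightarrow> card \<sigma> \<le> m"
    "\<And>i. i \<le> m \<Longrightarrow> card {\<tau> \<in> \<Delta>. card \<tau> \<le> i} = 1 + (\<Sum>j=1..i. f j)"
proof -
  define sub where "sub k i = {\<sigma>. \<sigma> \<subseteq> {..<k} \<and> card \<sigma> = i}" for k i :: nat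
  have card_sub: "card (sub k i) = k choose i" for k i unfolding sub_def by (simp add: n_subsets)
  have fin_sub: "finite (sub k i)" for k i by (rule finite_subset[of _ "Pow {..<k}"]) (auto simp: sub_def)
  have "\<exists>\<Phi>. sub (a i - 1) i \<subseteq> \<Phi> \<and> \<Phi> \<subseteq> sub (a i) i \<and> card \<Phi> = f i" if "1 \<le> i" "i \<le> m" for i
  proof -
    have "sub (a i - 1) i \<subseteq> sub (a i) i" by (auto simp: sub_def)
    then show ?thesis
      using f[OF that] exists_subset_between[of "sub (a i - 1) i" "f i" "sub (a i) i"] fin_sub
      by (auto simp: card_sub low_box_def)
  qed
  then obtain \<Phi> where \<Phi>: "\<And>i. 1 \<le> i \<Longrightarrow> i \<le> m \<Longrightarrow> sub (a i - 1) i \<subseteq> \<Phi> i"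
      "\<And>i. 1 \<le> i \<Longrightarrow> i \<le> m \<Longrightarrow> \<Phi> i \<subseteq> sub (a i) i" "\<And>i. 1 \<le> i \<Longrightarrow> i \<le> m \<Longrightarrow> card (\<Phi> i) = f i"
    by metis
  have less: "a j < a i" if "1 \<le> i" "i < j" "j \<le> m" for i j
    using that(2,3)
  proof (induction j)
    case (Suc j)
    then show ?case using a[of j] that(1) by (cases "i = j") auto
  qed simp
  have a_le: "a i \<le> n" if "1 \<le> i" "i \<le> m" for i
    using less[of 1 i] n that by (cases "i = 1") auto
  have mem: "\<sigma> \<subseteq> {..<a i}" "card \<sigma> = i" "\<sigma> \<noteq> {}" if "\<sigma> \<in> \<Phi> i" "1 \<le> i" "i \<le> m" for \<sigma> i
    using \<Phi>(2)[OF that(2,3)] that by (auto simp: sub_def)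
  define \<Delta> where "\<Delta> = insert {} (\<Union>i\<in>{1..m}. \<Phi> i)"
  show ?thesis
  proof (rule that[of \<Delta>])
    show "\<Delta> \<subseteq> Pow {..<n}" using mem(1) a_le by (fastforce simp: \<Delta>_def)
    show "{} \<in> \<Delta>" by (simp add: \<Delta>_def)
    show "card \<sigma> \<le> m" if "\<sigma> \<in> \<Delta>" for \<sigma> using that mem(2) by (auto simp: \<Delta>_def)
    show "\<tau> \<in> \<Delta>" if st: "\<sigma> \<in> \<Delta>" "\<tau> \<subseteq> \<sigma>" for \<sigma> \<tau>
    proof (cases "\<tau> = {} \<or> \<tau> = \<sigma>")
      case False
      then have "\<sigma> \<noteq> {}" using st(2) by blast
      then obtain i where i: "\<sigma> \<in> \<Phi> i" "1 \<le> i" "i \<le> m" using st(1) by (auto simp: \<Delta>_def)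
      have "finite \<sigma>" using mem(1)[OF i] finite_subset by blast
      then have "card \<tau> < i" "1 \<le> card \<tau>"
        using False st(2) mem(2)[OF i] psubset_card_mono[of \<sigma> \<tau>] finite_subset[of \<tau> \<sigma>]
        by (auto simp: Suc_le_eq card_gt_0_iff)
      then have j: "1 \<le> card \<tau>" "card \<tau> \<le> m" "a i < a (card \<tau>)" using i less[of "card \<tau>" i] by auto
      then have "\<tau> \<in> sub (a (card \<tau>) - 1) (card \<tau>)" using mem(1)[OF i] st(2) by (fastforce simp: sub_def)
      then show ?thesis using \<Phi>(1)[OF j(1,2)] j by (auto simp: \<Delta>_def)
    qed (use st in \<open>auto simp: \<Delta>_def\<close>)
    show "card {\<tau> \<in> \<Delta>. card \<tau> \<le> i} = 1 + (\<Sum>j=1..i. f j)" if i: "i \<le> m" for i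
    proof -
      have "{\<tau> \<in> \<Delta>. card \<tau> \<le> i} = insert {} (\<Union>j\<in>{1..i}. \<Phi> j)"
        using i mem(2) by (fastforce simp: \<Delta>_def)
      moreover have fin: "finite (\<Phi> j)" if "j \<in> {1..i}" for j
        using \<Phi>(2)[of j] that i finite_subset[OF _ fin_sub] by auto
      moreover have "card (\<Union>j\<in>{1..i}. \<Phi> j) = (\<Sum>j=1..i. card (\<Phi> j))"
      proof (rule card_UN_disjoint)
        show "\<forall>j\<in>{1..i}. \<forall>j'\<in>{1..i}. j \<noteq> j' \<longrightarrow> \<Phi> j \<inter> \<Phi> j' = {}"
        proof (intro ballI impI)
          fix j j' assume "j \<in> {1..i}" "j' \<in> {1..i}" "j \<noteq> j'"
          then show "\<Phi> j \<inter> \<Phi> j' = {}" using mem(2)[of _ j] mem(2)[of _ j'] i by auto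
        qed
      qed (use fin in auto)
      moreover have "(\<Sum>j=1..i. card (\<Phi> j)) = (\<Sum>j=1..i. f j)" using i \<Phi>(3) by (intro sum.cong) auto
      moreover have "{} \<notin> (\<Union>j\<in>{1..i}. \<Phi> j)" using mem(3) i by force
      ultimately show ?thesis by simp
    qed
  qed
qed

text \<open>A face vector with the empty face in position 0. There are \<open>r - 1\<close> vertices
  because the Hilbert function of the points in degree 1 is one more; the free entries start at
  position 2.\<close>

definition face_counts :: "nat \<Rightarrow> nat list \<Rightarrow> nat \<Rightarrow> nat" where
  "face_counts r xs i = (if i = 0 then 1 else if i = 1 then r - 1 else xs ! (i - 2))"

definition h_vector :: "nat \<Rightarrow> nat \<Rightarrow> nat list \<Rightarrow> nat list" where
  "h_vector r e xs = map (\<lambda>i. \<Sum>j\<le>min i (e - i). face_counts r xs j) [0..<e + 1]"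

lemma h_vector_nth: "i \<le> e \<Longrightarrow> h_vector r e xs ! i = (\<Sum>j\<le>min i (e - i). face_counts r xs j)"
  by (simp add: h_vector_def del: upt_Suc)

lemma h_vector_low: "i \<le> e div 2 \<Longrightarrow> h_vector r e xs ! i = (\<Sum>j\<le>i. face_counts r xs j)"
  by (simp add: h_vector_nth min_def)

lemma h_vector_1: "2 \<le> e \<Longrightarrow> 2 \<le> r \<Longrightarrow> h_vector r e xs ! 1 = r"
  by (simp add: h_vector_low face_counts_def)

lemma h_vector_diff:
  "1 \<le> i \<Longrightarrow> i \<le> e div 2 \<Longrightarrow> h_vector r e xs ! i = h_vector r e xs ! (i - 1) + face_counts r xs i"
  by (cases i) (auto simp: h_vector_low)

text \<open>The first half of the sequence has the face vector as its first difference. The complex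
  therefore gives the Gorenstein algebra, and the chain condition on the boxes gives the Macaulay
  inequalities.\<close>

lemma h_vector_realizable:
  assumes e2: "2 \<le> e" and r2: "2 \<le> r"
    and xs: "xs \<in> chain_lists lessThan low_box 2 (e div 2 - 1) (r - 1)"
  shows "h_vector r e xs \<in> gorenstein_hilbert_functions TYPE('k::field) r e \<inter> SI_sequences r e"
proof -
  define m where "m = e div 2"
  have m: "1 \<le> m" "2 * m \<le> e" using e2 by (auto simp: m_def)
  obtain a0 where a0: "\<And>i. i < m - 1 \<Longrightarrow> xs ! i \<in> low_box (2 + i) (a0 i)"
    "\<And>i. i < m - 1 \<Longrightarrow> a0 i < (if i = 0 then r - 1 else a0 (i - 1))"
    using chain_lists_nth[OF xs] unfolding m_def lessThan_iff by blast
  define f where "f = face_counts r xs"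
  \<comment> \<open>The box \<open>low_box 1 (r - 1)\<close> is \<open>{r - 1}\<close>, so prefixing
    this entry records the vertices, and the bound \<open>r - 1\<close> on the chain becomes
    \<open>a 2 < a 1\<close>.\<close>
  define a where "a i = (if i = 1 then r - 1 else a0 (i - 2))" for i
  have f: "f i \<in> low_box i (a i)" if "1 \<le> i" "i \<le> m" for i
  proof (cases "i = 1")
    case True
    then show ?thesis using r2 by (simp add: f_def face_counts_def a_def low_box_def)
  next
    case False
    then have "2 + (i - 2) = i" "i - 2 < m - 1" using that by linarith+
    then show ?thesis using a0(1)[of "i - 2"] False that by (simp add: f_def face_counts_def a_def)
  qed
  have a: "a (Suc i) < a i" if "1 \<le> i" "i < m" for i
    using a0(2)[of "i - 1"] that by (cases "i = 1") (auto simp: a_def numeral_2_eq_2)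
  obtain \<Delta> :: "nat set set" where \<Delta>: "\<Delta> \<subseteq> Pow {..<r - 1}" "{} \<in> \<Delta>"
    "\<And>\<sigma> \<tau>. \<sigma> \<in> \<Delta> \<Longrightarrow> \<tau> \<subseteq> \<sigma> \<Longrightarrow> \<tau> \<in> \<Delta>" "\<And>\<sigma>. \<sigma> \<in> \<Delta> \<Longrightarrow> card \<sigma> \<le> m"
    and count: "\<And>i. i \<le> m \<Longrightarrow> card {\<tau> \<in> \<Delta>. card \<tau> \<le> i} = 1 + (\<Sum>j=1..i. f j)"
    by (rule exists_complex[of m f a "r - 1"]) (use f a in \<open>auto simp: a_def\<close>)
  interpret complex_points r e m \<Delta> "TYPE('k)"
    by unfold_locales (use r2 m \<Delta> in auto)
  have sum_f: "1 + (\<Sum>j=1..i. f j) = (\<Sum>j\<le>i. f j)" for i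
    by (induction i) (auto simp: f_def face_counts_def)
  have "h_vector r e xs = map (\<lambda>i. card {\<tau> \<in> \<Delta>. card \<tau> \<le> min i (e - i)}) [0..<e + 1]"
    unfolding h_vector_def
  proof (rule map_cong[OF refl])
    fix i assume "i \<in> set [0..<e + 1]"
    have le: "min i (e - i) \<le> m" unfolding m_def by linarith
    show "(\<Sum>j\<le>min i (e - i). face_counts r xs j) = card {\<tau> \<in> \<Delta>. card \<tau> \<le> min i (e - i)}"
      using count[OF le, unfolded sum_f, unfolded f_def] by (simp only:)
  qed
  then have "h_vector r e xs \<in> gorenstein_hilbert_functions TYPE('k) r e"
    by (rule gorenstein_hilbert_function) (rule h_vector_1[OF e2 r2], rule m_def)
  moreover have "h_vector r e xs \<in> SI_sequences r e"
  proof -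
    let ?h = "h_vector r e xs"
    let ?g = "first_difference ?h m"
    have g: "?g ! i = int (f i)" if "i \<le> m" for i
    proof (cases "i = 0")
      case True
      then show ?thesis by (simp add: first_difference_def h_vector_low f_def del: upt_Suc)
    next
      case False
      then show ?thesis
        using that h_vector_diff[of i e r xs] by (simp add: first_difference_def f_def m_def del: upt_Suc)
    qed
    have len: "length ?g = m + 1" by (simp add: first_difference_def)
    \<comment> \<open>The open lower end of the box gives \<open>(a d - 1) choose d < f d\<close>,
      so the Macaulay bound is at least \<open>a d choose Suc d\<close>.\<close>
    have "f (Suc d) \<le> macaulay_bound (f d) d" if d: "1 \<le> d" "d < m" for d
    proof -
      have "f (Suc d) \<le> a (Suc d) choose Suc d" using f[of "Suc d"] d by (simp add: low_box_def)
      also have "\<dots> \<le> Suc (a d - 1) choose Suc d" using a[OF d] by (intro binomial_right_mono) simp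
      also have "\<dots> \<le> macaulay_bound (f d) d"
        using f[of d] d by (intro le_macaulay_bound) (auto simp: low_box_def)
      finally show ?thesis .
    qed
    then have "O_sequence ?g"
      unfolding O_sequence_def using len g by (auto simp: in_set_conv_nth f_def face_counts_def)
    moreover have "0 < ?h ! i" if "i \<le> e" for i
    proof -
      have "face_counts r xs 0 \<le> (\<Sum>j\<le>min i (e - i). face_counts r xs j)" by (rule member_le_sum) auto
      then show ?thesis using that by (simp add: h_vector_nth face_counts_def)
    qed
    moreover have "?h ! (e - i) = ?h ! i" if "i \<le> e" for i
      using that by (simp add: h_vector_nth min.commute)
    ultimately show ?thesis
      using h_vector_1[OF e2 r2] by (simp add: SI_sequences_def m_def h_vector_def del: upt_Suc)
  qed
  ultimately show ?thesis by blast
qed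

text \<open>Differences of consecutive entries in the first half recover the face counts.\<close>

lemma inj_on_h_vector:
  assumes "2 \<le> e"
  shows "inj_on (h_vector r e) (chain_lists S B 2 (e div 2 - 1) q)"
proof (rule inj_onI)
  fix xs ys assume xs: "xs \<in> chain_lists S B 2 (e div 2 - 1) q" and ys: "ys \<in> chain_lists S B 2 (e div 2 - 1) q"
    and eq: "h_vector r e xs = h_vector r e ys"
  have len: "length xs = e div 2 - 1" "length ys = e div 2 - 1"
    using chain_lists_nth[OF xs] chain_lists_nth[OF ys] by auto
  show "xs = ys"
  proof (rule nth_equalityI)
    fix i assume "i < length xs"
    then have "i + 2 \<le> e div 2" using len by simp
    then show "xs ! i = ys ! i"
      using h_vector_diff[of "i + 2" e r xs] h_vector_diff[of "i + 2" e r ys] eq by (simp add: face_counts_def)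
  qed (simp add: len)
qed

lemma eventually_card_low_chains_gt:
  assumes "b < chain_volume 2 n"
  shows "\<forall>\<^sub>F r in sequentially. b < real (card (chain_lists lessThan low_box 2 n (r - 1))) / real r ^ chain_degree 2 n"
proof -
  \<comment> \<open>The degrees run from 2 to \<open>n + 1\<close>, which serves as
    \<open>R\<close>; \<open>n\<close> more is lost in the summations, and one because the chain
    starts at \<open>r - 1\<close>.\<close>
  define k where "k = 1 + (n + 1 + n)"
  have "(\<lambda>r. chain_volume 2 n * (1 - real k / real r) ^ chain_degree 2 n)
      \<longlonglongrightarrow> chain_volume 2 n * (1 - 0) ^ chain_degree 2 n"
    by (intro tendsto_intros lim_const_over_n)
  then have "\<forall>\<^sub>F r in sequentially. b < chain_volume 2 n * (1 - real k / real r) ^ chain_degree 2 n"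
    using assms by (intro order_tendstoD) auto
  then show ?thesis using eventually_ge_at_top[of k]
  proof eventually_elim
    case (elim r)
    have r: "0 < real r" using elim(2) by (simp add: k_def)
    have "real (r - 1 - (n + 1 + n)) = real r * (1 - real k / real r)"
      using elim(2) r by (simp add: k_def of_nat_diff field_simps)
    then have "chain_volume 2 n * (real r * (1 - real k / real r)) ^ chain_degree 2 n
        \<le> real (card (chain_lists lessThan low_box 2 n (r - 1)))"
      using card_low_chains_ge[of 2 n "n + 1" "r - 1"] by simp
    then have "chain_volume 2 n * (1 - real k / real r) ^ chain_degree 2 n
        \<le> real (card (chain_lists lessThan low_box 2 n (r - 1))) / real r ^ chain_degree 2 n"
      using r by (subst pos_le_divide_eq) (auto simp: power_mult_distrib mult_ac)
    then show ?case using elim(1) by linarith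
  qed
qed

theorem theorem5p6:
  fixes e :: nat
  assumes "e \<ge> 2"
  shows "asymptotic (\<lambda>r. real (G_count TYPE('k::field) r e)) (\<lambda>r. real (SI_count r e)) \<and>
    asymptotic (\<lambda>r. real (SI_count r e))
      (\<lambda>r. c_const (e div 2) * real r ^ (((e div 2 + 1) choose 2) - 1)) \<and>
    (\<lambda>r. real (card (gorenstein_hilbert_functions TYPE('k) r e \<inter> SI_sequences r e)) /
         real (card (gorenstein_hilbert_functions TYPE('k) r e))) \<longlonglongrightarrow> 1"
proof -
  define m where "m = e div 2"
  define E where "E = ((m + 1) choose 2) - 1"
  define c where "c = c_const m"
  let ?G = "\<lambda>r. gorenstein_hilbert_functions TYPE('k) r e" and ?SI = "\<lambda>r. SI_sequences r e"
  let ?L = "\<lambda>r. chain_lists lessThan low_box 2 (m - 1) (r - 1)"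
  have m: "1 \<le> m" using assms by (simp add: m_def)
  have c: "chain_volume 2 (m - 1) = c" "0 < c"
    using chain_volume_c_const[OF m] chain_volume_pos[of 2 "m - 1"] by (auto simp: c_def)
  have E: "chain_degree 2 (m - 1) = E" using chain_degree_2[OF m] by (simp add: E_def)
  have low: "card (?L r) \<le> card (?G r \<inter> ?SI r)" if r: "2 \<le> r" and "finite (?G r)" for r
  proof -
    have "card (?L r) = card (h_vector r e ` ?L r)"
      using inj_on_h_vector[OF assms] by (subst card_image) (auto simp: m_def)
    also have "\<dots> \<le> card (?G r \<inter> ?SI r)"
      using that h_vector_realizable[OF assms r] by (intro card_mono) (auto simp: m_def)
    finally show ?thesis .
  qed
  \<comment> \<open>One squeeze serves for the Gorenstein sequences, the SI-sequences and their
    intersection: the realized chains lie in the intersection, hence in each of the three, and all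
    three consist of near chains.\<close>
  have lim: "(\<lambda>r. real (card (X r)) / real r ^ E) \<longlonglongrightarrow> c"
    if X: "\<And>r h. 1 \<le> r \<Longrightarrow> h \<in> X r \<Longrightarrow> h \<in> sym_lists r e \<and> near_chain C m r ((!) h)" "0 \<le> C"
      and sub: "\<And>r. ?G r \<inter> ?SI r \<subseteq> X r" for X C
  proof (rule order_tendstoI)
    fix b assume "c < b"
    then have "chain_volume 2 (e div 2 - 1) < b" using c(1) by (simp only: m_def)
    then have "\<forall>\<^sub>F r in sequentially. real (card (X r)) / real r ^ chain_degree 2 (e div 2 - 1) < b"
      using near_chain_lists_bounds(2)[of X e C b] X unfolding m_def by blast
    then show "\<forall>\<^sub>F r in sequentially. real (card (X r)) / real r ^ E < b"
      unfolding m_def[symmetric] E .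
  next
    fix b assume "b < c"
    then have "\<forall>\<^sub>F r in sequentially. b < real (card (?L r)) / real r ^ E"
      using eventually_card_low_chains_gt[of b "m - 1"] unfolding c E by blast
    then show "\<forall>\<^sub>F r in sequentially. b < real (card (X r)) / real r ^ E"
      using eventually_ge_at_top[of 2]
    proof eventually_elim
      case (elim r)
      \<comment> \<open>\<open>card\<close> is 0 on infinite sets, so bounding it from below needs
        finiteness, which the enclosing boxes provide.\<close>
      have fin: "finite (X r)" "finite (?G r)"
        using elim(2) near_chain_lists_bounds(1)[of X e C r] X gorenstein_near_chain[OF assms]
          near_chain_lists_bounds(1)[of ?G e "fact m" r] by (auto simp: m_def)
      have "card (?L r) \<le> card (X r)"
        using low[OF elim(2) fin(2)] card_mono[OF fin(1) sub[of r]] by linarith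
      then have "real (card (?L r)) / real r ^ E \<le> real (card (X r)) / real r ^ E"
        by (intro divide_right_mono) auto
      then show ?case using elim(1) by linarith
    qed
  qed
  have G: "h \<in> sym_lists r e \<and> near_chain (fact m) m r ((!) h)" if "h \<in> ?G r" for r h
    using gorenstein_near_chain[OF assms that] by (simp add: m_def)
  have limG: "(\<lambda>r. real (card (?G r)) / real r ^ E) \<longlonglongrightarrow> c"
    and limGSI: "(\<lambda>r. real (card (?G r \<inter> ?SI r)) / real r ^ E) \<longlonglongrightarrow> c"
    by (rule lim[of _ "fact m"]; use G in auto)+
  have limSI: "(\<lambda>r. real (card (?SI r)) / real r ^ E) \<longlonglongrightarrow> c"
    by (rule lim[of _ "real ((m + 1) ^ m * (m * m + fact m * (m + 1)))"])
      (use SI_near_chain[OF assms] SI_sequence_differences(1)[OF assms] in \<open>auto simp: m_def\<close>)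
  have quot: "(\<lambda>r. X r / Y r) \<longlonglongrightarrow> 1"
    if "(\<lambda>r. X r / real r ^ E) \<longlonglongrightarrow> c" "(\<lambda>r. Y r / real r ^ E) \<longlonglongrightarrow> c" for X Y
  proof (rule Lim_transform_eventually)
    show "(\<lambda>r. (X r / real r ^ E) / (Y r / real r ^ E)) \<longlonglongrightarrow> 1"
      using tendsto_divide[OF that] c(2) by simp
    show "\<forall>\<^sub>F r in sequentially. (X r / real r ^ E) / (Y r / real r ^ E) = X r / Y r"
      using eventually_gt_at_top[of 0] by eventually_elim simp
  qed
  have limc: "(\<lambda>r. c * real r ^ E / real r ^ E) \<longlonglongrightarrow> c"
    by (rule Lim_transform_eventually[OF tendsto_const])
      (use eventually_gt_at_top[of 0] in eventually_elim, simp)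
  show ?thesis
    unfolding asymptotic_def G_count_def SI_count_def m_def[symmetric] c_def[symmetric] E_def[symmetric]
    by (intro conjI quot limG limSI limGSI limc)
qed

end
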